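(* Let $F\colon\mathscr{D}\to\mathscr{E}$ be a morphism of derivators and let $S$ be a (possibly empty, small) discrete category. The following are equivalent. (i) The morphism $F$ preserves $S$-fold coproducts (i.e., left Kan extensions along $S\to\mathbb{1}$). (ii) The morphism $F$ preserves left Kan extensions along $i_S\colon S\to S^\rhd$. (iii) The functor $F_{S^\rhd}\colon\mathscr{D}(S^\rhd)\to\mathscr{E}(S^\rhd)$ sends coproduct cocones to coproduct cocones. (iv) The underlying functor $F_{\mathbb{1}}\colon\mathscr{D}(\mathbb{1})\to\mathscr{E}(\mathbb{1})$ preserves $S$-fold coproducts (in the usual categorical sense). (v) Every functor $F_A\colon\mathscr{D}(A)\to\mathscr{E}(A)$, $A\in\mathbf{Cat}$, preserves $S$-fold coproducts (in the usual categorical sense).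
   Context: **Derivators.** $\mathbf{Cat}$ is the 2-category of small categories, $\mathbf{CAT}$ that of not necessarily small categories, $\mathbb{1}$ is the terminal category, $\pi_A\colon A\to\mathbb{1}$ the unique functor; objects $a\in A$ are identified with functors $a\colon\mathbb{1}\to A$. A prederivator is a strict 2-functor $\mathscr{D}\colon\mathbf{Cat}^{\mathrm{op}}\to\mathbf{CAT}$ (op reverses functors only); $u\colon A\to B$ induces $u^\ast\colon\mathscr{D}(B)\to\mathscr{D}(A)$, and $X_a:=a^\ast X$. It is a derivator if: (Der1) $\mathscr{D}$ sends coproducts to products; (Der2) $f$ in $\mathscr{D}(A)$ is an isomorphism iff $f_a$ is so for all $a\in A$; (Der3) each $u^\ast$ has a left adjoint $u_!$ and a right adjoint $u_\ast$ (write $\operatorname{colim}_A=(\pi_A)_!$, $\lim_A=(\pi_A)_\ast$); (Der4) for $u\colon A\to B$, $b\in B$, with projections $p\colon(u/b)\to A$, $q\colon(b/u)\to A$ from the slice categories, the canonical mates $\operatorname{colim}_{(u/b)}p^\ast\to b^\ast u_!$ and $b^\ast u_\ast\to\lim_{(b/u)}q^\ast$ are isomorphisms. **Morphisms.** A morphism $F\colon\mathscr{D}\to\mathscr{E}$ of derivators is a pseudo-natural transformation: functors $F_A\colon\mathscr{D}(A)\to\mathscr{E}(A)$ and coherent natural isomorphisms $\gamma_u\colon u^\ast F_B\cong F_Au^\ast$ for $u\colon A\to B$. $F$ preserves left Kan extensions along $u\colon A\to B$ if the canonical mate $$u_!F_A\xrightarrow{\eta}u_!F_Au^\ast u_!\xrightarrow{\gamma_u^{-1}}u_!u^\ast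 F_Bu_!\xrightarrow{\varepsilon}F_Bu_!$$ is an isomorphism. For a discrete category $S$, $F$ preserves $S$-fold coproducts if it preserves left Kan extensions along the unique functor $S\to\mathbb{1}$. **Cocones.** For a small category $A$, the cocone $A^\rhd$ is obtained from $A$ by adjoining a new final object $\infty$; $i_A\colon A\to A^\rhd$ is the inclusion. $X\in\mathscr{D}(A^\rhd)$ is a colimiting cocone if it lies in the essential image of $(i_A)_!\colon\mathscr{D}(A)\to\mathscr{D}(A^\rhd)$; for discrete $A=S$ it is then called a coproduct cocone. *)

theory Defs
  imports Main "HOL-Library.FuncSet"
begin

unbundle cardinal_syntax

section \<open>Categories, functors, natural transformations\<close>

text \<open>
  All structure maps are extensional (undefined off their carriers), so that equality of
  categories, functors and transformations is equality in HOL. This matters for the strict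
  2-functoriality of prederivators.
\<close>

record ('o, 'm) cat =
  Obj :: "'o set"
  Arr :: "'m set"
  Dom :: "'m \<Rightarrow> 'o"
  Cod :: "'m \<Rightarrow> 'o"
  Ident :: "'o \<Rightarrow> 'm"
  Comp :: "'m \<Rightarrow> 'm \<Rightarrow> 'm"  \<comment> \<open>\<open>Comp C g f\<close> is g after f\<close>

definition hom :: "('o, 'm) cat \<Rightarrow> 'o \<Rightarrow> 'o \<Rightarrow> 'm set" where
  "hom C a b = {f \<in> Arr C. Dom C f = a \<and> Cod C f = b}"

definition category :: "('o, 'm) cat \<Rightarrow> bool" where
  "category C \<longleftrightarrow>
     Dom C \<in> Arr C \<rightarrow>\<^sub>E Obj C \<and>
     Cod C \<in> Arr C \<rightarrow>\<^sub>E Obj C \<and>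
     Ident C \<in> extensional (Obj C) \<and>
     (\<forall>a\<in>Obj C. Ident C a \<in> hom C a a) \<and>
     (\<forall>g f. \<not> (g \<in> Arr C \<and> f \<in> Arr C \<and> Dom C g = Cod C f) \<longrightarrow> Comp C g f = undefined) \<and>
     (\<forall>g\<in>Arr C. \<forall>f\<in>Arr C. Dom C g = Cod C f \<longrightarrow> Comp C g f \<in> hom C (Dom C f) (Cod C g)) \<and>
     (\<forall>f\<in>Arr C. Comp C f (Ident C (Dom C f)) = f \<and> Comp C (Ident C (Cod C f)) f = f) \<and>
     (\<forall>h\<in>Arr C. \<forall>g\<in>Arr C. \<forall>f\<in>Arr C. Dom C h = Cod C g \<longrightarrow> Dom C g = Cod C f \<longrightarrow>
        Comp C h (Comp C g f) = Comp C (Comp C h g) f)"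

definition inverse_arrows :: "('o, 'm) cat \<Rightarrow> 'm \<Rightarrow> 'm \<Rightarrow> bool" where
  "inverse_arrows C f g \<longleftrightarrow>
     f \<in> Arr C \<and> g \<in> hom C (Cod C f) (Dom C f) \<and>
     Comp C g f = Ident C (Dom C f) \<and> Comp C f g = Ident C (Cod C f)"

definition iso :: "('o, 'm) cat \<Rightarrow> 'm \<Rightarrow> bool" where
  "iso C f \<longleftrightarrow> (\<exists>g. inverse_arrows C f g)"

definition inv_arr :: "('o, 'm) cat \<Rightarrow> 'm \<Rightarrow> 'm" where
  "inv_arr C f = (THE g. inverse_arrows C f g)"

definition isomorphic :: "('o, 'm) cat \<Rightarrow> 'o \<Rightarrow> 'o \<Rightarrow> bool" where
  "isomorphic C a b \<longleftrightarrow> (\<exists>f\<in>hom C a b. iso C f)"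

record ('o1, 'm1, 'o2, 'm2) ftr =
  Src :: "('o1, 'm1) cat"
  Tgt :: "('o2, 'm2) cat"
  FOb :: "'o1 \<Rightarrow> 'o2"
  FAr :: "'m1 \<Rightarrow> 'm2"

definition is_ftr :: "('o1, 'm1, 'o2, 'm2) ftr \<Rightarrow> bool" where
  "is_ftr F \<longleftrightarrow>
     category (Src F) \<and> category (Tgt F) \<and>
     FOb F \<in> Obj (Src F) \<rightarrow>\<^sub>E Obj (Tgt F) \<and>
     FAr F \<in> extensional (Arr (Src F)) \<and>
     (\<forall>f\<in>Arr (Src F). FAr F f \<in> hom (Tgt F) (FOb F (Dom (Src F) f)) (FOb F (Cod (Src F) f))) \<and>
     (\<forall>a\<in>Obj (Src F). FAr F (Ident (Src F) a) = Ident (Tgt F) (FOb F a)) \<and>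
     (\<forall>g\<in>Arr (Src F). \<forall>f\<in>Arr (Src F). Dom (Src F) g = Cod (Src F) f \<longrightarrow>
        FAr F (Comp (Src F) g f) = Comp (Tgt F) (FAr F g) (FAr F f))"

definition ftr_between ::
  "('o1, 'm1) cat \<Rightarrow> ('o2, 'm2) cat \<Rightarrow> ('o1, 'm1, 'o2, 'm2) ftr \<Rightarrow> bool" where
  "ftr_between C D F \<longleftrightarrow> is_ftr F \<and> Src F = C \<and> Tgt F = D"

definition id_ftr :: "('o, 'm) cat \<Rightarrow> ('o, 'm, 'o, 'm) ftr" where
  "id_ftr C = \<lparr>Src = C, Tgt = C, FOb = (\<lambda>a\<in>Obj C. a), FAr = (\<lambda>f\<in>Arr C. f)\<rparr>"

definition fcomp ::
  "('o2, 'm2, 'o3, 'm3) ftr \<Rightarrow> ('o1, 'm1, 'o2, 'm2) ftr \<Rightarrow> ('o1, 'm1, 'o3, 'm3) ftr"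
  (infixl "\<circ>\<^sub>F" 75) where
  "G \<circ>\<^sub>F F = \<lparr>Src = Src F, Tgt = Tgt G,
     FOb = compose (Obj (Src F)) (FOb G) (FOb F),
     FAr = compose (Arr (Src F)) (FAr G) (FAr F)\<rparr>"

record ('o1, 'm1, 'o2, 'm2) nt =
  NSrc :: "('o1, 'm1, 'o2, 'm2) ftr"
  NTgt :: "('o1, 'm1, 'o2, 'm2) ftr"
  Cmp :: "'o1 \<Rightarrow> 'm2"

definition is_nt :: "('o1, 'm1, 'o2, 'm2) nt \<Rightarrow> bool" where
  "is_nt \<alpha> \<longleftrightarrow>
     (let F = NSrc \<alpha>; G = NTgt \<alpha>; C = Src F; D = Tgt F in
      is_ftr F \<and> is_ftr G \<and> Src G = C \<and> Tgt G = D \<and>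
      Cmp \<alpha> \<in> extensional (Obj C) \<and>
      (\<forall>a\<in>Obj C. Cmp \<alpha> a \<in> hom D (FOb F a) (FOb G a)) \<and>
      (\<forall>f\<in>Arr C. Comp D (Cmp \<alpha> (Cod C f)) (FAr F f) = Comp D (FAr G f) (Cmp \<alpha> (Dom C f))))"

definition nt_between ::
  "('o1, 'm1, 'o2, 'm2) ftr \<Rightarrow> ('o1, 'm1, 'o2, 'm2) ftr \<Rightarrow> ('o1, 'm1, 'o2, 'm2) nt \<Rightarrow> bool" where
  "nt_between F G \<alpha> \<longleftrightarrow> is_nt \<alpha> \<and> NSrc \<alpha> = F \<and> NTgt \<alpha> = G"

definition nat_iso :: "('o1, 'm1, 'o2, 'm2) nt \<Rightarrow> bool" where
  "nat_iso \<alpha> \<longleftrightarrow> is_nt \<alpha> \<and> (\<forall>a\<in>Obj (Src (NSrc \<alpha>)). iso (Tgt (NSrc \<alpha>)) (Cmp \<alpha> a))"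

definition id_nt :: "('o1, 'm1, 'o2, 'm2) ftr \<Rightarrow> ('o1, 'm1, 'o2, 'm2) nt" where
  "id_nt F = \<lparr>NSrc = F, NTgt = F, Cmp = (\<lambda>a\<in>Obj (Src F). Ident (Tgt F) (FOb F a))\<rparr>"

definition inv_nt :: "('o1, 'm1, 'o2, 'm2) nt \<Rightarrow> ('o1, 'm1, 'o2, 'm2) nt" where
  "inv_nt \<alpha> = \<lparr>NSrc = NTgt \<alpha>, NTgt = NSrc \<alpha>,
     Cmp = (\<lambda>a\<in>Obj (Src (NSrc \<alpha>)). inv_arr (Tgt (NSrc \<alpha>)) (Cmp \<alpha> a))\<rparr>"

definition vcomp ::
  "('o1, 'm1, 'o2, 'm2) nt \<Rightarrow> ('o1, 'm1, 'o2, 'm2) nt \<Rightarrow> ('o1, 'm1, 'o2, 'm2) nt"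
  (infixl "\<circ>\<^sub>v" 65) where
  "\<beta> \<circ>\<^sub>v \<alpha> = \<lparr>NSrc = NSrc \<alpha>, NTgt = NTgt \<beta>,
     Cmp = (\<lambda>a\<in>Obj (Src (NSrc \<alpha>)). Comp (Tgt (NSrc \<alpha>)) (Cmp \<beta> a) (Cmp \<alpha> a))\<rparr>"

definition hcomp ::
  "('o2, 'm2, 'o3, 'm3) nt \<Rightarrow> ('o1, 'm1, 'o2, 'm2) nt \<Rightarrow> ('o1, 'm1, 'o3, 'm3) nt"
  (infixl "\<circ>\<^sub>h" 70) where
  "\<beta> \<circ>\<^sub>h \<alpha> = \<lparr>NSrc = NSrc \<beta> \<circ>\<^sub>F NSrc \<alpha>, NTgt = NTgt \<beta> \<circ>\<^sub>F NTgt \<alpha>,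
     Cmp = (\<lambda>a\<in>Obj (Src (NSrc \<alpha>)).
       Comp (Tgt (NSrc \<beta>)) (FAr (NTgt \<beta>) (Cmp \<alpha> a)) (Cmp \<beta> (FOb (NSrc \<alpha>) a)))\<rparr>"

abbreviation whisker_left ::
  "('o2, 'm2, 'o3, 'm3) ftr \<Rightarrow> ('o1, 'm1, 'o2, 'm2) nt \<Rightarrow> ('o1, 'm1, 'o3, 'm3) nt"
  (infixl "\<star>\<^sub>l" 70) where
  "G \<star>\<^sub>l \<alpha> \<equiv> id_nt G \<circ>\<^sub>h \<alpha>"

abbreviation whisker_right ::
  "('o2, 'm2, 'o3, 'm3) nt \<Rightarrow> ('o1, 'm1, 'o2, 'm2) ftr \<Rightarrow> ('o1, 'm1, 'o3, 'm3) nt"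
  (infixl "\<star>\<^sub>r" 70) where
  "\<beta> \<star>\<^sub>r F \<equiv> \<beta> \<circ>\<^sub>h id_nt F"

text \<open>\<open>adjunction L R \<eta> \<epsilon>\<close>: L is left adjoint to R with unit \<open>\<eta>\<close> and counit \<open>\<epsilon>\<close>.\<close>

definition adjunction ::
  "('o1, 'm1, 'o2, 'm2) ftr \<Rightarrow> ('o2, 'm2, 'o1, 'm1) ftr \<Rightarrow>
   ('o1, 'm1, 'o1, 'm1) nt \<Rightarrow> ('o2, 'm2, 'o2, 'm2) nt \<Rightarrow> bool" where
  "adjunction L R \<eta> \<epsilon> \<longleftrightarrow>
     is_ftr L \<and> is_ftr R \<and> Src L = Tgt R \<and> Tgt L = Src R \<and>
     nt_between (id_ftr (Src L)) (R \<circ>\<^sub>F L) \<eta> \<and>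
     nt_between (L \<circ>\<^sub>F R) (id_ftr (Src R)) \<epsilon> \<and>
     (\<epsilon> \<star>\<^sub>r L) \<circ>\<^sub>v (L \<star>\<^sub>l \<eta>) = id_nt L \<and>
     (R \<star>\<^sub>l \<epsilon>) \<circ>\<^sub>v (\<eta> \<star>\<^sub>r R) = id_nt R"

definition equivalence_ftr :: "('o1, 'm1, 'o2, 'm2) ftr \<Rightarrow> bool" where
  "equivalence_ftr F \<longleftrightarrow> is_ftr F \<and>
     (\<exists>G \<alpha> \<beta>. ftr_between (Tgt F) (Src F) G \<and>
        nat_iso \<alpha> \<and> NSrc \<alpha> = id_ftr (Src F) \<and> NTgt \<alpha> = G \<circ>\<^sub>F F \<and>
        nat_iso \<beta> \<and> NSrc \<beta> = F \<circ>\<^sub>F G \<and> NTgt \<beta> = id_ftr (Tgt F))"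

definition is_coproduct ::
  "('o, 'm) cat \<Rightarrow> 'i set \<Rightarrow> ('i \<Rightarrow> 'o) \<Rightarrow> 'o \<Rightarrow> ('i \<Rightarrow> 'm) \<Rightarrow> bool" where
  "is_coproduct C I x c \<iota> \<longleftrightarrow>
     c \<in> Obj C \<and> (\<forall>i\<in>I. x i \<in> Obj C \<and> \<iota> i \<in> hom C (x i) c) \<and>
     (\<forall>d\<in>Obj C. \<forall>f. (\<forall>i\<in>I. f i \<in> hom C (x i) d) \<longrightarrow>
        (\<exists>!h. h \<in> hom C c d \<and> (\<forall>i\<in>I. Comp C h (\<iota> i) = f i)))"

definition preserves_coproducts :: "'i set \<Rightarrow> ('o1, 'm1, 'o2, 'm2) ftr \<Rightarrow> bool" where
  "preserves_coproducts I F \<longleftrightarrow>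
     (\<forall>x c \<iota>. is_coproduct (Src F) I x c \<iota> \<longrightarrow>
        is_coproduct (Tgt F) I (\<lambda>i. FOb F (x i)) (FOb F c) (\<lambda>i. FAr F (\<iota> i)))"

definition prod_cat :: "'i set \<Rightarrow> ('i \<Rightarrow> ('o, 'm) cat) \<Rightarrow> ('i \<Rightarrow> 'o, 'i \<Rightarrow> 'm) cat" where
  "prod_cat I C = \<lparr>
     Obj = (\<Pi>\<^sub>E i\<in>I. Obj (C i)),
     Arr = (\<Pi>\<^sub>E i\<in>I. Arr (C i)),
     Dom = (\<lambda>f\<in>(\<Pi>\<^sub>E i\<in>I. Arr (C i)). \<lambda>i\<in>I. Dom (C i) (f i)),
     Cod = (\<lambda>f\<in>(\<Pi>\<^sub>E i\<in>I. Arr (C i)). \<lambda>i\<in>I. Cod (C i) (f i)),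
     Ident = (\<lambda>a\<in>(\<Pi>\<^sub>E i\<in>I. Obj (C i)). \<lambda>i\<in>I. Ident (C i) (a i)),
     Comp = (\<lambda>g f. if g \<in> (\<Pi>\<^sub>E i\<in>I. Arr (C i)) \<and> f \<in> (\<Pi>\<^sub>E i\<in>I. Arr (C i)) \<and>
                      (\<forall>i\<in>I. Dom (C i) (g i) = Cod (C i) (f i))
                   then (\<lambda>i\<in>I. Comp (C i) (g i) (f i)) else undefined)\<rparr>"

definition tuple_ftr ::
  "'i set \<Rightarrow> ('o1, 'm1) cat \<Rightarrow> ('i \<Rightarrow> ('o2, 'm2) cat) \<Rightarrow> ('i \<Rightarrow> ('o1, 'm1, 'o2, 'm2) ftr) \<Rightarrow>
   ('o1, 'm1, 'i \<Rightarrow> 'o2, 'i \<Rightarrow> 'm2) ftr" where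
  "tuple_ftr I C D F = \<lparr>Src = C, Tgt = prod_cat I D,
     FOb = (\<lambda>a\<in>Obj C. \<lambda>i\<in>I. FOb (F i) a),
     FAr = (\<lambda>f\<in>Arr C. \<lambda>i\<in>I. FAr (F i) f)\<rparr>"

section \<open>Small categories\<close>

text \<open>
  Smallness is relative to a type \<open>'u\<close> that plays the role of a universe: a set is small if its
  cardinality is strictly below that of \<open>'u\<close>, and a small category has objects and arrows drawn
  from \<open>'u\<close>. The theorem assumes that the cardinality of \<open>'u\<close> is infinite and regular; if it is
  strongly inaccessible, these are, up to renaming of elements, the small categories of a
  Grothendieck universe.
\<close>

definition small_set :: "'u set \<Rightarrow> bool" where
  "small_set X \<longleftrightarrow> |X| <o |UNIV :: 'u set|"

definition small_cat :: "('u, 'u) cat \<Rightarrow> bool" where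
  "small_cat A \<longleftrightarrow> category A \<and> small_set (Obj A) \<and> small_set (Arr A)"

definition small_ftr :: "('u, 'u, 'u, 'u) ftr \<Rightarrow> bool" where
  "small_ftr u \<longleftrightarrow> is_ftr u \<and> small_cat (Src u) \<and> small_cat (Tgt u)"

definition small_nt :: "('u, 'u, 'u, 'u) nt \<Rightarrow> bool" where
  "small_nt \<alpha> \<longleftrightarrow> is_nt \<alpha> \<and> small_ftr (NSrc \<alpha>) \<and> small_ftr (NTgt \<alpha>)"

text \<open>
  Constructions such as slices naturally live on product or sum types; \<open>encode\<close> copies them back
  into \<open>'u\<close> along a fixed injection, which exists for all types used below because \<open>'u\<close> is infinite.
\<close>

definition code :: "'x \<Rightarrow> 'u" where
  "code = (SOME e. inj e)"

definition encode :: "('x, 'y) cat \<Rightarrow> ('u, 'u) cat" where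
  "encode C = \<lparr>
     Obj = code ` Obj C,
     Arr = code ` Arr C,
     Dom = (\<lambda>f\<in>code ` Arr C. code (Dom C (inv code f))),
     Cod = (\<lambda>f\<in>code ` Arr C. code (Cod C (inv code f))),
     Ident = (\<lambda>a\<in>code ` Obj C. code (Ident C (inv code a))),
     Comp = (\<lambda>g f. if g \<in> code ` Arr C \<and> f \<in> code ` Arr C \<and>
                      Dom C (inv code g) = Cod C (inv code f)
                   then code (Comp C (inv code g) (inv code f)) else undefined)\<rparr>"

definition encode_ftr :: "('x, 'y) cat \<Rightarrow> ('x, 'y, 'u, 'u) ftr" where
  "encode_ftr C = \<lparr>Src = C, Tgt = encode C,
     FOb = (\<lambda>a\<in>Obj C. code a), FAr = (\<lambda>f\<in>Arr C. code f)\<rparr>"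

definition decode_ftr :: "('x, 'y) cat \<Rightarrow> ('u, 'u, 'x, 'y) ftr" where
  "decode_ftr C = \<lparr>Src = encode C, Tgt = C,
     FOb = (\<lambda>a\<in>code ` Obj C. inv code a), FAr = (\<lambda>f\<in>code ` Arr C. inv code f)\<rparr>"

definition discrete :: "('o, 'm) cat \<Rightarrow> bool" where
  "discrete S \<longleftrightarrow> category S \<and> Arr S = Ident S ` Obj S"

definition one :: "('u, 'u) cat" where
  "one = \<lparr>Obj = {undefined}, Arr = {undefined},
     Dom = (\<lambda>f. undefined), Cod = (\<lambda>f. undefined),
     Ident = (\<lambda>a. undefined), Comp = (\<lambda>g f. undefined)\<rparr>"

definition to_one :: "('o, 'm) cat \<Rightarrow> ('o, 'm, 'u, 'u) ftr" where
  "to_one A = \<lparr>Src = A, Tgt = one, FOb = (\<lambda>a. undefined), FAr = (\<lambda>f. undefined)\<rparr>"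

definition pick :: "('o, 'm) cat \<Rightarrow> 'o \<Rightarrow> ('u, 'u, 'o, 'm) ftr" where
  "pick A a = \<lparr>Src = one, Tgt = A,
     FOb = (\<lambda>x\<in>Obj one. a), FAr = (\<lambda>x\<in>Arr one. Ident A a)\<rparr>"

definition coprod_cat :: "'i set \<Rightarrow> ('i \<Rightarrow> ('o, 'm) cat) \<Rightarrow> ('i \<times> 'o, 'i \<times> 'm) cat" where
  "coprod_cat I A = \<lparr>
     Obj = (SIGMA i:I. Obj (A i)),
     Arr = (SIGMA i:I. Arr (A i)),
     Dom = (\<lambda>(i, f)\<in>(SIGMA i:I. Arr (A i)). (i, Dom (A i) f)),
     Cod = (\<lambda>(i, f)\<in>(SIGMA i:I. Arr (A i)). (i, Cod (A i) f)),
     Ident = (\<lambda>(i, a)\<in>(SIGMA i:I. Obj (A i)). (i, Ident (A i) a)),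
     Comp = (\<lambda>(j, g) (i, f). if i \<in> I \<and> j = i \<and> g \<in> Arr (A i) \<and> f \<in> Arr (A i) \<and>
                                 Dom (A i) g = Cod (A i) f
                              then (i, Comp (A i) g f) else undefined)\<rparr>"

definition coprod_inj ::
  "'i set \<Rightarrow> ('i \<Rightarrow> ('o, 'm) cat) \<Rightarrow> 'i \<Rightarrow> ('o, 'm, 'i \<times> 'o, 'i \<times> 'm) ftr" where
  "coprod_inj I A i = \<lparr>Src = A i, Tgt = coprod_cat I A,
     FOb = (\<lambda>a\<in>Obj (A i). (i, a)), FAr = (\<lambda>f\<in>Arr (A i). (i, f))\<rparr>"

definition small_coprod :: "'u set \<Rightarrow> ('u \<Rightarrow> ('u, 'u) cat) \<Rightarrow> ('u, 'u) cat" where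
  "small_coprod I A = encode (coprod_cat I A)"

definition small_coprod_inj :: "'u set \<Rightarrow> ('u \<Rightarrow> ('u, 'u) cat) \<Rightarrow> 'u \<Rightarrow> ('u, 'u, 'u, 'u) ftr" where
  "small_coprod_inj I A i = encode_ftr (coprod_cat I A) \<circ>\<^sub>F coprod_inj I A i"

text \<open>
  The slice \<open>(u/b)\<close>: objects are pairs (a, f) with f from u a to b. An arrow from
  \<open>(a, f' \<circ> u h)\<close> to (a', f') lying over h from a to a' is determined by h and f' and is
  represented by (h, f').
\<close>

definition slice_over_cat :: "('o1, 'm1, 'o2, 'm2) ftr \<Rightarrow> 'o2 \<Rightarrow> ('o1 \<times> 'm2, 'm1 \<times> 'm2) cat" where
  "slice_over_cat u b =
    (let A = Src u; B = Tgt u;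
         Ob = {(a, f). a \<in> Obj A \<and> f \<in> hom B (FOb u a) b};
         Ar = {(h, f). h \<in> Arr A \<and> f \<in> hom B (FOb u (Cod A h)) b};
         dm = (\<lambda>(h, f)\<in>Ar. (Dom A h, Comp B f (FAr u h)));
         cd = (\<lambda>(h, f)\<in>Ar. (Cod A h, f))
     in \<lparr>Obj = Ob, Arr = Ar, Dom = dm, Cod = cd,
         Ident = (\<lambda>(a, f)\<in>Ob. (Ident A a, f)),
         Comp = (\<lambda>k' k. if k' \<in> Ar \<and> k \<in> Ar \<and> dm k' = cd k
                        then (Comp A (fst k') (fst k), snd k') else undefined)\<rparr>)"

text \<open>
  The slice \<open>(b/u)\<close>: objects are pairs (a, f) with f from b to u a. An arrow from (a, f) to
  \<open>(a', u h \<circ> f)\<close> lying over h from a to a' is represented by (h, f).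
\<close>

definition slice_under_cat :: "('o1, 'm1, 'o2, 'm2) ftr \<Rightarrow> 'o2 \<Rightarrow> ('o1 \<times> 'm2, 'm1 \<times> 'm2) cat" where
  "slice_under_cat u b =
    (let A = Src u; B = Tgt u;
         Ob = {(a, f). a \<in> Obj A \<and> f \<in> hom B b (FOb u a)};
         Ar = {(h, f). h \<in> Arr A \<and> f \<in> hom B b (FOb u (Dom A h))};
         dm = (\<lambda>(h, f)\<in>Ar. (Dom A h, f));
         cd = (\<lambda>(h, f)\<in>Ar. (Cod A h, Comp B (FAr u h) f))
     in \<lparr>Obj = Ob, Arr = Ar, Dom = dm, Cod = cd,
         Ident = (\<lambda>(a, f)\<in>Ob. (Ident A a, f)),
         Comp = (\<lambda>k' k. if k' \<in> Ar \<and> k \<in> Ar \<and> dm k' = cd k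
                        then (Comp A (fst k') (fst k), snd k) else undefined)\<rparr>)"

text \<open>
  The projections from the slices to \<open>A\<close>, and the canonical transformations
  \<open>u \<circ> p \<Rightarrow> b \<circ> \<pi>\<close> and \<open>b \<circ> \<pi> \<Rightarrow> u \<circ> q\<close>, where b is regarded as a functor from \<open>one\<close>.
\<close>

definition slice_over_proj ::
  "('o1, 'm1, 'o2, 'm2) ftr \<Rightarrow> 'o2 \<Rightarrow> ('o1 \<times> 'm2, 'm1 \<times> 'm2, 'o1, 'm1) ftr" where
  "slice_over_proj u b = \<lparr>Src = slice_over_cat u b, Tgt = Src u,
     FOb = (\<lambda>x\<in>Obj (slice_over_cat u b). fst x), FAr = (\<lambda>k\<in>Arr (slice_over_cat u b). fst k)\<rparr>"

definition slice_over_nt ::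
  "('u, 'u, 'u, 'u) ftr \<Rightarrow> 'u \<Rightarrow> ('u \<times> 'u, 'u \<times> 'u, 'u, 'u) nt" where
  "slice_over_nt u b = \<lparr>NSrc = u \<circ>\<^sub>F slice_over_proj u b,
     NTgt = pick (Tgt u) b \<circ>\<^sub>F (to_one (slice_over_cat u b) :: ('u \<times> 'u, 'u \<times> 'u, 'u, 'u) ftr),
     Cmp = (\<lambda>x\<in>Obj (slice_over_cat u b). snd x)\<rparr>"

definition slice_under_proj ::
  "('o1, 'm1, 'o2, 'm2) ftr \<Rightarrow> 'o2 \<Rightarrow> ('o1 \<times> 'm2, 'm1 \<times> 'm2, 'o1, 'm1) ftr" where
  "slice_under_proj u b = \<lparr>Src = slice_under_cat u b, Tgt = Src u,
     FOb = (\<lambda>x\<in>Obj (slice_under_cat u b). fst x), FAr = (\<lambda>k\<in>Arr (slice_under_cat u b). fst k)\<rparr>"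

definition slice_under_nt ::
  "('u, 'u, 'u, 'u) ftr \<Rightarrow> 'u \<Rightarrow> ('u \<times> 'u, 'u \<times> 'u, 'u, 'u) nt" where
  "slice_under_nt u b = \<lparr>
     NSrc = pick (Tgt u) b \<circ>\<^sub>F (to_one (slice_under_cat u b) :: ('u \<times> 'u, 'u \<times> 'u, 'u, 'u) ftr),
     NTgt = u \<circ>\<^sub>F slice_under_proj u b,
     Cmp = (\<lambda>x\<in>Obj (slice_under_cat u b). snd x)\<rparr>"

definition small_slice_over :: "('u, 'u, 'u, 'u) ftr \<Rightarrow> 'u \<Rightarrow> ('u, 'u) cat" where
  "small_slice_over u b = encode (slice_over_cat u b)"

definition small_slice_over_proj :: "('u, 'u, 'u, 'u) ftr \<Rightarrow> 'u \<Rightarrow> ('u, 'u, 'u, 'u) ftr" where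
  "small_slice_over_proj u b = slice_over_proj u b \<circ>\<^sub>F decode_ftr (slice_over_cat u b)"

definition small_slice_over_nt :: "('u, 'u, 'u, 'u) ftr \<Rightarrow> 'u \<Rightarrow> ('u, 'u, 'u, 'u) nt" where
  "small_slice_over_nt u b = slice_over_nt u b \<star>\<^sub>r decode_ftr (slice_over_cat u b)"

definition small_slice_under :: "('u, 'u, 'u, 'u) ftr \<Rightarrow> 'u \<Rightarrow> ('u, 'u) cat" where
  "small_slice_under u b = encode (slice_under_cat u b)"

definition small_slice_under_proj :: "('u, 'u, 'u, 'u) ftr \<Rightarrow> 'u \<Rightarrow> ('u, 'u, 'u, 'u) ftr" where
  "small_slice_under_proj u b = slice_under_proj u b \<circ>\<^sub>F decode_ftr (slice_under_cat u b)"

definition small_slice_under_nt :: "('u, 'u, 'u, 'u) ftr \<Rightarrow> 'u \<Rightarrow> ('u, 'u, 'u, 'u) nt" where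
  "small_slice_under_nt u b = slice_under_nt u b \<star>\<^sub>r decode_ftr (slice_under_cat u b)"

text \<open>
  The cocone: \<open>None\<close> is the new final object, \<open>Inl f\<close> is an arrow f of A, and for every object x
  (including \<open>None\<close>) \<open>Inr x\<close> is the unique arrow from x to \<open>None\<close>.
\<close>

definition cocone_cat :: "('o, 'm) cat \<Rightarrow> ('o option, 'm + 'o option) cat" where
  "cocone_cat A =
    (let Ob = insert None (Some ` Obj A);
         Ar = Inl ` Arr A \<union> Inr ` Ob;
         dm = (\<lambda>k\<in>Ar. case k of Inl f \<Rightarrow> Some (Dom A f) | Inr x \<Rightarrow> x);
         cd = (\<lambda>k\<in>Ar. case k of Inl f \<Rightarrow> Some (Cod A f) | Inr x \<Rightarrow> None)
     in \<lparr>Obj = Ob, Arr = Ar, Dom = dm, Cod = cd,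
         Ident = (\<lambda>x\<in>Ob. case x of Some a \<Rightarrow> Inl (Ident A a) | None \<Rightarrow> Inr None),
         Comp = (\<lambda>k' k. if k' \<in> Ar \<and> k \<in> Ar \<and> dm k' = cd k
                        then (case (k', k) of
                                (Inl g, Inl f) \<Rightarrow> Inl (Comp A g f)
                              | _ \<Rightarrow> Inr (dm k))
                        else undefined)\<rparr>)"

definition cocone_incl :: "('o, 'm) cat \<Rightarrow> ('o, 'm, 'o option, 'm + 'o option) ftr" where
  "cocone_incl A = \<lparr>Src = A, Tgt = cocone_cat A,
     FOb = (\<lambda>a\<in>Obj A. Some a), FAr = (\<lambda>f\<in>Arr A. Inl f)\<rparr>"

definition small_cocone :: "('u, 'u) cat \<Rightarrow> ('u, 'u) cat"  ("_\<rhd>" [1000] 1000) where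
  "A\<rhd> = encode (cocone_cat A)"

definition small_cocone_incl :: "('u, 'u) cat \<Rightarrow> ('u, 'u, 'u, 'u) ftr" where
  "small_cocone_incl A = encode_ftr (cocone_cat A) \<circ>\<^sub>F cocone_incl A"

section \<open>Derivators\<close>

record ('u, 'o, 'm) prederivator =
  On_cat :: "('u, 'u) cat \<Rightarrow> ('o, 'm) cat"
  On_ftr :: "('u, 'u, 'u, 'u) ftr \<Rightarrow> ('o, 'm, 'o, 'm) ftr"
  On_nt :: "('u, 'u, 'u, 'u) nt \<Rightarrow> ('o, 'm, 'o, 'm) nt"

definition is_prederivator :: "('u, 'o, 'm) prederivator \<Rightarrow> bool" where
  "is_prederivator \<D> \<longleftrightarrow>
     (\<forall>A. small_cat A \<longrightarrow> category (On_cat \<D> A)) \<and>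
     (\<forall>u. small_ftr u \<longrightarrow> ftr_between (On_cat \<D> (Tgt u)) (On_cat \<D> (Src u)) (On_ftr \<D> u)) \<and>
     (\<forall>\<alpha>. small_nt \<alpha> \<longrightarrow> nt_between (On_ftr \<D> (NSrc \<alpha>)) (On_ftr \<D> (NTgt \<alpha>)) (On_nt \<D> \<alpha>)) \<and>
     (\<forall>A. small_cat A \<longrightarrow> On_ftr \<D> (id_ftr A) = id_ftr (On_cat \<D> A)) \<and>
     (\<forall>u v. small_ftr u \<longrightarrow> small_ftr v \<longrightarrow> Tgt u = Src v \<longrightarrow>
        On_ftr \<D> (v \<circ>\<^sub>F u) = On_ftr \<D> u \<circ>\<^sub>F On_ftr \<D> v) \<and>
     (\<forall>u. small_ftr u \<longrightarrow> On_nt \<D> (id_nt u) = id_nt (On_ftr \<D> u)) \<and>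
     (\<forall>\<alpha> \<beta>. small_nt \<alpha> \<longrightarrow> small_nt \<beta> \<longrightarrow> NTgt \<alpha> = NSrc \<beta> \<longrightarrow>
        On_nt \<D> (\<beta> \<circ>\<^sub>v \<alpha>) = On_nt \<D> \<beta> \<circ>\<^sub>v On_nt \<D> \<alpha>) \<and>
     (\<forall>\<alpha> \<beta>. small_nt \<alpha> \<longrightarrow> small_nt \<beta> \<longrightarrow> Tgt (NSrc \<alpha>) = Src (NSrc \<beta>) \<longrightarrow>
        On_nt \<D> (\<beta> \<circ>\<^sub>h \<alpha>) = On_nt \<D> \<alpha> \<circ>\<^sub>h On_nt \<D> \<beta>)"

definition left_adj_data ::
  "('o2, 'm2, 'o1, 'm1) ftr \<Rightarrow>
   ('o1, 'm1, 'o2, 'm2) ftr \<times> ('o1, 'm1, 'o1, 'm1) nt \<times> ('o2, 'm2, 'o2, 'm2) nt" where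
  "left_adj_data R = (SOME (L, \<eta>, \<epsilon>). adjunction L R \<eta> \<epsilon>)"

definition right_adj_data ::
  "('o1, 'm1, 'o2, 'm2) ftr \<Rightarrow>
   ('o2, 'm2, 'o1, 'm1) ftr \<times> ('o1, 'm1, 'o1, 'm1) nt \<times> ('o2, 'm2, 'o2, 'm2) nt" where
  "right_adj_data L = (SOME (R, \<eta>, \<epsilon>). adjunction L R \<eta> \<epsilon>)"

text \<open>
  Adjoints are unique up to canonical isomorphism, so whether a mate is invertible does not depend
  on the choice. Chosen left Kan extensions \<open>u\<^sub>!\<close> and right Kan extensions \<open>u\<^sub>*\<close>, with unit and counit.
\<close>

definition lkan :: "('u, 'o, 'm) prederivator \<Rightarrow> ('u, 'u, 'u, 'u) ftr \<Rightarrow> ('o, 'm, 'o, 'm) ftr" where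
  "lkan \<D> u = fst (left_adj_data (On_ftr \<D> u))"

definition lkan_unit :: "('u, 'o, 'm) prederivator \<Rightarrow> ('u, 'u, 'u, 'u) ftr \<Rightarrow> ('o, 'm, 'o, 'm) nt" where
  "lkan_unit \<D> u = fst (snd (left_adj_data (On_ftr \<D> u)))"

definition lkan_counit :: "('u, 'o, 'm) prederivator \<Rightarrow> ('u, 'u, 'u, 'u) ftr \<Rightarrow> ('o, 'm, 'o, 'm) nt" where
  "lkan_counit \<D> u = snd (snd (left_adj_data (On_ftr \<D> u)))"

definition rkan :: "('u, 'o, 'm) prederivator \<Rightarrow> ('u, 'u, 'u, 'u) ftr \<Rightarrow> ('o, 'm, 'o, 'm) ftr" where
  "rkan \<D> u = fst (right_adj_data (On_ftr \<D> u))"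

definition rkan_unit :: "('u, 'o, 'm) prederivator \<Rightarrow> ('u, 'u, 'u, 'u) ftr \<Rightarrow> ('o, 'm, 'o, 'm) nt" where
  "rkan_unit \<D> u = fst (snd (right_adj_data (On_ftr \<D> u)))"

definition rkan_counit :: "('u, 'o, 'm) prederivator \<Rightarrow> ('u, 'u, 'u, 'u) ftr \<Rightarrow> ('o, 'm, 'o, 'm) nt" where
  "rkan_counit \<D> u = snd (snd (right_adj_data (On_ftr \<D> u)))"

text \<open>The mates \<open>colim p\<^sup>* \<Rightarrow> b\<^sup>* u\<^sub>!\<close> and \<open>b\<^sup>* u\<^sub>* \<Rightarrow> lim q\<^sup>*\<close> of (Der4).\<close>

definition slice_mate_left ::
  "('u, 'o, 'm) prederivator \<Rightarrow> ('u, 'u, 'u, 'u) ftr \<Rightarrow> 'u \<Rightarrow> ('o, 'm, 'o, 'm) nt" where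
  "slice_mate_left \<D> u b =
    (let t = to_one (small_slice_over u b);
         p = small_slice_over_proj u b;
         bb = pick (Tgt u) b
     in (lkan_counit \<D> t \<star>\<^sub>r (On_ftr \<D> bb \<circ>\<^sub>F lkan \<D> u)) \<circ>\<^sub>v
        (lkan \<D> t \<star>\<^sub>l (On_nt \<D> (small_slice_over_nt u b) \<star>\<^sub>r lkan \<D> u)) \<circ>\<^sub>v
        ((lkan \<D> t \<circ>\<^sub>F On_ftr \<D> p) \<star>\<^sub>l lkan_unit \<D> u))"

definition slice_mate_right ::
  "('u, 'o, 'm) prederivator \<Rightarrow> ('u, 'u, 'u, 'u) ftr \<Rightarrow> 'u \<Rightarrow> ('o, 'm, 'o, 'm) nt" where
  "slice_mate_right \<D> u b =
    (let t = to_one (small_slice_under u b);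
         q = small_slice_under_proj u b;
         bb = pick (Tgt u) b
     in ((rkan \<D> t \<circ>\<^sub>F On_ftr \<D> q) \<star>\<^sub>l rkan_counit \<D> u) \<circ>\<^sub>v
        (rkan \<D> t \<star>\<^sub>l (On_nt \<D> (small_slice_under_nt u b) \<star>\<^sub>r rkan \<D> u)) \<circ>\<^sub>v
        (rkan_unit \<D> t \<star>\<^sub>r (On_ftr \<D> bb \<circ>\<^sub>F rkan \<D> u)))"

text \<open>In (Der1), "sends coproducts to products" is read up to equivalence of categories.\<close>

definition Der1 :: "('u, 'o, 'm) prederivator \<Rightarrow> bool" where
  "Der1 \<D> \<longleftrightarrow> (\<forall>(I :: 'u set) A. small_set I \<longrightarrow> (\<forall>i\<in>I. small_cat (A i)) \<longrightarrow>
     equivalence_ftr (tuple_ftr I (On_cat \<D> (small_coprod I A)) (\<lambda>i. On_cat \<D> (A i))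
                        (\<lambda>i. On_ftr \<D> (small_coprod_inj I A i))))"

definition Der2 :: "('u, 'o, 'm) prederivator \<Rightarrow> bool" where
  "Der2 \<D> \<longleftrightarrow> (\<forall>A. small_cat A \<longrightarrow> (\<forall>f\<in>Arr (On_cat \<D> A).
     iso (On_cat \<D> A) f \<longleftrightarrow> (\<forall>a\<in>Obj A. iso (On_cat \<D> one) (FAr (On_ftr \<D> (pick A a)) f))))"

definition Der3 :: "('u, 'o, 'm) prederivator \<Rightarrow> bool" where
  "Der3 \<D> \<longleftrightarrow> (\<forall>u. small_ftr u \<longrightarrow>
     (\<exists>L \<eta> \<epsilon>. adjunction L (On_ftr \<D> u) \<eta> \<epsilon>) \<and> (\<exists>R \<eta> \<epsilon>. adjunction (On_ftr \<D> u) R \<eta> \<epsilon>))"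

definition Der4 :: "('u, 'o, 'm) prederivator \<Rightarrow> bool" where
  "Der4 \<D> \<longleftrightarrow> (\<forall>u. small_ftr u \<longrightarrow> (\<forall>b\<in>Obj (Tgt u).
     nat_iso (slice_mate_left \<D> u b) \<and> nat_iso (slice_mate_right \<D> u b)))"

definition is_derivator :: "('u, 'o, 'm) prederivator \<Rightarrow> bool" where
  "is_derivator \<D> \<longleftrightarrow> is_prederivator \<D> \<and> Der1 \<D> \<and> Der2 \<D> \<and> Der3 \<D> \<and> Der4 \<D>"

text \<open>\<open>Mor_ftr F A\<close> is \<open>F\<^sub>A\<close>, and \<open>Mor_coh F u\<close> is \<open>\<gamma>\<^sub>u\<close> from \<open>u\<^sup>* F\<^sub>B\<close> to \<open>F\<^sub>A u\<^sup>*\<close>.\<close>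

record ('u, 'o1, 'm1, 'o2, 'm2) mor =
  Mor_ftr :: "('u, 'u) cat \<Rightarrow> ('o1, 'm1, 'o2, 'm2) ftr"
  Mor_coh :: "('u, 'u, 'u, 'u) ftr \<Rightarrow> ('o1, 'm1, 'o2, 'm2) nt"

text \<open>The last three clauses are the coherence axioms of a pseudo-natural transformation.\<close>

definition is_morphism ::
  "('u, 'o1, 'm1) prederivator \<Rightarrow> ('u, 'o2, 'm2) prederivator \<Rightarrow>
   ('u, 'o1, 'm1, 'o2, 'm2) mor \<Rightarrow> bool" where
  "is_morphism \<D> \<E> F \<longleftrightarrow>
     (\<forall>A. small_cat A \<longrightarrow> ftr_between (On_cat \<D> A) (On_cat \<E> A) (Mor_ftr F A)) \<and>
     (\<forall>u. small_ftr u \<longrightarrow>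
        nt_between (On_ftr \<E> u \<circ>\<^sub>F Mor_ftr F (Tgt u)) (Mor_ftr F (Src u) \<circ>\<^sub>F On_ftr \<D> u) (Mor_coh F u) \<and>
        nat_iso (Mor_coh F u)) \<and>
     (\<forall>A. small_cat A \<longrightarrow> Mor_coh F (id_ftr A) = id_nt (Mor_ftr F A)) \<and>
     (\<forall>u v. small_ftr u \<longrightarrow> small_ftr v \<longrightarrow> Tgt u = Src v \<longrightarrow>
        Mor_coh F (v \<circ>\<^sub>F u) =
          (Mor_coh F u \<star>\<^sub>r On_ftr \<D> v) \<circ>\<^sub>v (On_ftr \<E> u \<star>\<^sub>l Mor_coh F v)) \<and>
     (\<forall>\<alpha>. small_nt \<alpha> \<longrightarrow>
        Mor_coh F (NTgt \<alpha>) \<circ>\<^sub>v (On_nt \<E> \<alpha> \<star>\<^sub>r Mor_ftr F (Tgt (NSrc \<alpha>))) =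
        (Mor_ftr F (Src (NSrc \<alpha>)) \<star>\<^sub>l On_nt \<D> \<alpha>) \<circ>\<^sub>v Mor_coh F (NSrc \<alpha>))"

definition lkan_mate ::
  "('u, 'o1, 'm1) prederivator \<Rightarrow> ('u, 'o2, 'm2) prederivator \<Rightarrow>
   ('u, 'o1, 'm1, 'o2, 'm2) mor \<Rightarrow> ('u, 'u, 'u, 'u) ftr \<Rightarrow> ('o1, 'm1, 'o2, 'm2) nt" where
  "lkan_mate \<D> \<E> F u =
     (lkan_counit \<E> u \<star>\<^sub>r (Mor_ftr F (Tgt u) \<circ>\<^sub>F lkan \<D> u)) \<circ>\<^sub>v
     (lkan \<E> u \<star>\<^sub>l (inv_nt (Mor_coh F u) \<star>\<^sub>r lkan \<D> u)) \<circ>\<^sub>v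
     ((lkan \<E> u \<circ>\<^sub>F Mor_ftr F (Src u)) \<star>\<^sub>l lkan_unit \<D> u)"

definition preserves_lkan ::
  "('u, 'o1, 'm1) prederivator \<Rightarrow> ('u, 'o2, 'm2) prederivator \<Rightarrow>
   ('u, 'o1, 'm1, 'o2, 'm2) mor \<Rightarrow> ('u, 'u, 'u, 'u) ftr \<Rightarrow> bool" where
  "preserves_lkan \<D> \<E> F u \<longleftrightarrow> nat_iso (lkan_mate \<D> \<E> F u)"

definition colimiting_cocone :: "('u, 'o, 'm) prederivator \<Rightarrow> ('u, 'u) cat \<Rightarrow> 'o \<Rightarrow> bool" where
  "colimiting_cocone \<D> A X \<longleftrightarrow> X \<in> Obj (On_cat \<D> (A\<rhd>)) \<and>
     (\<exists>Y\<in>Obj (On_cat \<D> A). isomorphic (On_cat \<D> (A\<rhd>)) (FOb (lkan \<D> (small_cocone_incl A)) Y) X)"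

end

theory Submission
  imports Defs
begin

text \<open>
  Every condition amounts to preservation of ordinary coproducts by the functor at the point. Two
  principles turn statements about Kan extensions into statements about coproducts.

  First, a mate is invertible exactly when certain arrows are universal for a restriction functor
  (\<open>nat_iso_mate_iff\<close>). This eliminates the chosen left adjoint on the side of the target, and it
  applies both to the mates of a morphism and to those of (Der4).

  Second, by (Der1) a diagram on the discrete category \<open>S\<close> is a family of objects, and restriction along
  \<open>S \<rightarrow> one\<close> is the diagonal. Its universal arrows are therefore ordinary coproducts
  (\<open>universal_arrow_iff_coproduct\<close>). It follows that \<open>F\<close> preserves left Kan extensions along
  \<open>S \<rightarrow> one\<close> if and only if it preserves the coproducts that these extensions provide, and up to
  isomorphism these are all coproducts (\<open>preserves_lkan_to_one_iff\<close>, \<open>preserves_coproductsI\<close>).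

  For the inclusion of \<open>S\<close> into its cocone, an arrow from \<open>Y\<close> to the restriction of \<open>X\<close> is universal if
  and only if it is invertible and the legs of \<open>X\<close> form a coproduct in the value at the point
  (\<open>universal_along_incl_iff\<close>). There are three reasons. The unit of the extension is invertible by
  (Der4), since the slices over the legs are terminal. The apex is terminal in the cocone, so evaluation
  there computes the colimit. And isomorphisms are detected pointwise by (Der2). In particular the
  colimiting cocones are the cocones whose legs form a coproduct (\<open>colimiting_cocone_iff\<close>), and \<open>F\<close>, by
  its coherence isomorphisms, acts on the cocone as it acts on this coproduct
  (\<open>coproduct_cocone_image_iff\<close>).

  The passage from the point to an arbitrary \<open>A\<close> uses that coproducts exist in the value at \<open>A\<close>, that
  evaluation at the objects of \<open>A\<close> preserves them because it has a right adjoint, and that it jointly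
  detects isomorphisms (\<open>preserves_coproducts_levelwise\<close>).
\<close>

section \<open>Categories, functors and natural transformations\<close>

lemma category_arr:
  assumes "category C"
  shows "f \<in> Arr C \<Longrightarrow> Dom C f \<in> Obj C" "f \<in> Arr C \<Longrightarrow> Cod C f \<in> Obj C"
    and "a \<in> Obj C \<Longrightarrow> Ident C a \<in> Arr C"
    and "a \<in> Obj C \<Longrightarrow> Dom C (Ident C a) = a" "a \<in> Obj C \<Longrightarrow> Cod C (Ident C a) = a"
    and "g \<in> Arr C \<Longrightarrow> f \<in> Arr C \<Longrightarrow> Dom C g = Cod C f \<Longrightarrow> Comp C g f \<in> Arr C"
    and "g \<in> Arr C \<Longrightarrow> f \<in> Arr C \<Longrightarrow> Dom C g = Cod C f \<Longrightarrow> Dom C (Comp C g f) = Dom C f"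
    and "g \<in> Arr C \<Longrightarrow> f \<in> Arr C \<Longrightarrow> Dom C g = Cod C f \<Longrightarrow> Cod C (Comp C g f) = Cod C g"
    and "f \<in> Arr C \<Longrightarrow> Comp C f (Ident C (Dom C f)) = f"
    and "f \<in> Arr C \<Longrightarrow> Comp C (Ident C (Cod C f)) f = f"
    and "h \<in> Arr C \<Longrightarrow> g \<in> Arr C \<Longrightarrow> f \<in> Arr C \<Longrightarrow> Dom C h = Cod C g \<Longrightarrow> Dom C g = Cod C f \<Longrightarrow>
      Comp C h (Comp C g f) = Comp C (Comp C h g) f"
  using assms unfolding category_def hom_def by auto

lemma comp_in_hom:
  assumes "category C" "g \<in> hom C b c" "f \<in> hom C a b"
  shows "Comp C g f \<in> hom C a c"
  using assms unfolding category_def hom_def by auto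

lemma comp_assoc:
  assumes "category C" "h \<in> hom C c d" "g \<in> hom C b c" "f \<in> hom C a b"
  shows "Comp C h (Comp C g f) = Comp C (Comp C h g) f"
  using assms unfolding category_def hom_def by auto

lemma comp_id_left:
  assumes "category C" "f \<in> hom C a b"
  shows "Comp C (Ident C b) f = f"
  using assms unfolding category_def hom_def by auto

lemma comp_id_right:
  assumes "category C" "f \<in> hom C a b"
  shows "Comp C f (Ident C a) = f"
  using assms unfolding category_def hom_def by auto

lemma id_in_hom:
  assumes "category C" "a \<in> Obj C"
  shows "Ident C a \<in> hom C a a"
  using assms unfolding category_def by auto

lemma hom_dom_in: "category C \<Longrightarrow> f \<in> hom C a b \<Longrightarrow> a \<in> Obj C"
  and hom_cod_in: "category C \<Longrightarrow> f \<in> hom C a b \<Longrightarrow> b \<in> Obj C"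
  unfolding category_def hom_def by auto

lemma arr_in_hom: "f \<in> Arr C \<Longrightarrow> f \<in> hom C (Dom C f) (Cod C f)"
  by (simp add: hom_def)

lemma isoI:
  assumes "f \<in> hom C a b" "g \<in> hom C b a" "Comp C g f = Ident C a" "Comp C f g = Ident C b"
  shows "iso C f"
  using assms unfolding iso_def inverse_arrows_def hom_def by auto

lemma isoE:
  assumes "iso C f" "f \<in> hom C a b"
  obtains g where "g \<in> hom C b a" "Comp C g f = Ident C a" "Comp C f g = Ident C b"
  using assms unfolding iso_def inverse_arrows_def hom_def by auto

lemma inverse_unique:
  assumes "category C" "f \<in> hom C a b" "g \<in> hom C b a" "g' \<in> hom C b a"
    and "Comp C g f = Ident C a" "Comp C f g' = Ident C b"
  shows "g = g'"
proof -
  have "g = Comp C g (Comp C f g')" using assms comp_id_right by metis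
  also have "\<dots> = Comp C (Comp C g f) g'" using assms comp_assoc by metis
  also have "\<dots> = g'" using assms comp_id_left by metis
  finally show ?thesis .
qed

lemma inv_arr:
  assumes C: "category C" and i: "iso C f" and f: "f \<in> hom C a b"
  shows "inv_arr C f \<in> hom C b a" "Comp C (inv_arr C f) f = Ident C a"
    "Comp C f (inv_arr C f) = Ident C b"
proof -
  obtain g where g: "inverse_arrows C f g" using i iso_def by metis
  have "inverse_arrows C f (inv_arr C f)" unfolding inv_arr_def
  proof (rule theI[of _ g])
    show "inverse_arrows C f g" by (rule g)
    fix g' assume "inverse_arrows C f g'"
    then show "g' = g" using inverse_unique[OF C f, of g' g] g f
      by (auto simp: inverse_arrows_def hom_def)
  qed
  then show "inv_arr C f \<in> hom C b a" "Comp C (inv_arr C f) f = Ident C a"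
    "Comp C f (inv_arr C f) = Ident C b"
    using f by (auto simp: inverse_arrows_def hom_def)
qed

lemma iso_inv_arr:
  assumes "category C" "iso C f" "f \<in> hom C a b"
  shows "iso C (inv_arr C f)"
  using isoI[of "inv_arr C f" C b a f] inv_arr[OF assms] assms by blast

lemma iso_ident: "category C \<Longrightarrow> a \<in> Obj C \<Longrightarrow> iso C (Ident C a)"
  by (rule isoI[of _ _ a a "Ident C a"]) (auto intro: id_in_hom comp_id_left)

lemma comp_cancel_middle:
  assumes C: "category C" and k: "k \<in> hom C b d" and g': "g' \<in> hom C c b" and g: "g \<in> hom C b c"
    and f: "f \<in> hom C a b" and id: "Comp C g' g = Ident C b"
  shows "Comp C (Comp C k g') (Comp C g f) = Comp C k f"
proof -
  have "Comp C (Comp C k g') (Comp C g f) = Comp C k (Comp C g' (Comp C g f))"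
    using comp_assoc[OF C k g' comp_in_hom[OF C g f]] by simp
  also have "\<dots> = Comp C k f"
    using comp_assoc[OF C g' g f] id comp_id_left[OF C f] by simp
  finally show ?thesis .
qed

lemma paste_squares:
  assumes C: "category C" and p: "p \<in> hom C a a'" and q: "q \<in> hom C b b'"
    and p': "p' \<in> hom C a' a''" and q': "q' \<in> hom C b' b''"
    and f: "f \<in> hom C a b" and f': "f' \<in> hom C a' b'" and f'': "f'' \<in> hom C a'' b''"
    and sq: "Comp C q f = Comp C f' p" and sq': "Comp C q' f' = Comp C f'' p'"
  shows "Comp C (Comp C q' q) f = Comp C f'' (Comp C p' p)"
proof -
  have "Comp C (Comp C q' q) f = Comp C q' (Comp C f' p)"
    using comp_assoc[OF C q' q f] sq by simp
  also have "\<dots> = Comp C f'' (Comp C p' p)"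
    using comp_assoc[OF C q' f' p] comp_assoc[OF C f'' p' p] sq' by simp
  finally show ?thesis .
qed

lemma iso_comp:
  assumes C: "category C" and g: "g \<in> hom C b c" "iso C g" and f: "f \<in> hom C a b" "iso C f"
  shows "iso C (Comp C g f)"
proof -
  obtain g' where g': "g' \<in> hom C c b" "Comp C g' g = Ident C b" "Comp C g g' = Ident C c"
    using isoE g by metis
  obtain f' where f': "f' \<in> hom C b a" "Comp C f' f = Ident C a" "Comp C f f' = Ident C b"
    using isoE f by metis
  show ?thesis
  proof (rule isoI[OF comp_in_hom[OF C g(1) f(1)] comp_in_hom[OF C f'(1) g'(1)]])
    show "Comp C (Comp C f' g') (Comp C g f) = Ident C a"
      using comp_cancel_middle[OF C f'(1) g'(1) g(1) f(1) g'(2)] f'(2) by simp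
    show "Comp C (Comp C g f) (Comp C f' g') = Ident C c"
      using comp_cancel_middle[OF C g(1) f(1) f'(1) g'(1) f'(3)] g'(3) by simp
  qed
qed

lemma iso_cancel_right:
  assumes C: "category C" and f: "f \<in> hom C a b" "iso C f" and g: "g \<in> hom C b c"
    and gf: "iso C (Comp C g f)"
  shows "iso C g"
proof -
  obtain f' where f': "f' \<in> hom C b a" "Comp C f' f = Ident C a" "Comp C f f' = Ident C b"
    using isoE f by metis
  have "Comp C (Comp C g f) f' = g"
    by (metis C g f(1) f' comp_assoc comp_id_right)
  moreover have "iso C f'" using isoI f' f(1) by metis
  ultimately show ?thesis using iso_comp[OF C _ gf f'(1)] comp_in_hom[OF C g f(1)] by metis
qed

lemma iso_comp_cancel:
  assumes C: "category C" and m: "m \<in> hom C b c" "iso C m"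
    and f: "f \<in> hom C a b" and g: "g \<in> hom C a b" and eq: "Comp C m f = Comp C m g"
  shows "f = g"
proof -
  obtain n where n: "n \<in> hom C c b" "Comp C n m = Ident C b"
    using isoE[OF m(2,1)] by metis
  have "f = Comp C n (Comp C m f)"
    using comp_assoc[OF C n(1) m(1) f] n(2) comp_id_left[OF C f] by simp
  also have "\<dots> = g"
    using comp_assoc[OF C n(1) m(1) g] n(2) comp_id_left[OF C g] eq by simp
  finally show ?thesis .
qed

lemma ftr_betweenD:
  assumes "ftr_between C D F"
  shows "category C" "category D" "Src F = C" "Tgt F = D" "is_ftr F"
  using assms by (auto simp: ftr_between_def is_ftr_def)

lemma ftr_ob:
  assumes "ftr_between C D F" "a \<in> Obj C"
  shows "FOb F a \<in> Obj D"
  using assms by (auto simp: ftr_between_def is_ftr_def)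

lemma ftr_hom:
  assumes "ftr_between C D F" "f \<in> hom C a b"
  shows "FAr F f \<in> hom D (FOb F a) (FOb F b)"
  using assms by (auto simp: ftr_between_def is_ftr_def hom_def)

lemma ftr_ident:
  assumes "ftr_between C D F" "a \<in> Obj C"
  shows "FAr F (Ident C a) = Ident D (FOb F a)"
  using assms by (auto simp: ftr_between_def is_ftr_def)

lemma ftr_comp:
  assumes "ftr_between C D F" "g \<in> hom C b c" "f \<in> hom C a b"
  shows "FAr F (Comp C g f) = Comp D (FAr F g) (FAr F f)"
  using assms by (auto simp: ftr_between_def is_ftr_def hom_def)

lemma ftr_iso:
  assumes F: "ftr_between C D F" and f: "f \<in> hom C a b" "iso C f"
  shows "iso D (FAr F f)"
proof -
  obtain g where g: "g \<in> hom C b a" "Comp C g f = Ident C a" "Comp C f g = Ident C b"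
    using isoE f by metis
  have ab: "a \<in> Obj C" "b \<in> Obj C"
    using ftr_betweenD(1)[OF F] f(1) hom_dom_in hom_cod_in by metis+
  show ?thesis
    by (rule isoI[OF ftr_hom[OF F f(1)] ftr_hom[OF F g(1)]])
      (metis F ab f(1) g ftr_comp ftr_ident)+
qed

lemma ftr_betweenI:
  assumes "category C" "category D" "Src F = C" "Tgt F = D"
    and "\<And>a. a \<in> Obj C \<Longrightarrow> FOb F a \<in> Obj D" "FOb F \<in> extensional (Obj C)"
    and "FAr F \<in> extensional (Arr C)"
    and "\<And>a b f. f \<in> hom C a b \<Longrightarrow> FAr F f \<in> hom D (FOb F a) (FOb F b)"
    and "\<And>a. a \<in> Obj C \<Longrightarrow> FAr F (Ident C a) = Ident D (FOb F a)"
    and "\<And>a b c f g. g \<in> hom C b c \<Longrightarrow> f \<in> hom C a b \<Longrightarrow>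
      FAr F (Comp C g f) = Comp D (FAr F g) (FAr F f)"
  shows "ftr_between C D F"
  using assms unfolding ftr_between_def is_ftr_def
  by (auto simp: hom_def PiE_def Pi_def)

lemma ftr_eqI:
  assumes F: "ftr_between C D F" and G: "ftr_between C D G"
    and ob: "\<And>a. a \<in> Obj C \<Longrightarrow> FOb F a = FOb G a"
    and ar: "\<And>f. f \<in> Arr C \<Longrightarrow> FAr F f = FAr G f"
  shows "F = G"
proof -
  have "FOb F = FOb G"
    using F G ob by (intro extensionalityI[of _ "Obj C"]) (auto simp: ftr_between_def is_ftr_def PiE_def)
  moreover have "FAr F = FAr G"
    using F G ar by (intro extensionalityI[of _ "Arr C"]) (auto simp: ftr_between_def is_ftr_def PiE_def)
  ultimately show ?thesis using F G by (auto simp: ftr_between_def)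
qed

lemma id_ftr_simps [simp]:
  "Src (id_ftr C) = C" "Tgt (id_ftr C) = C"
  "a \<in> Obj C \<Longrightarrow> FOb (id_ftr C) a = a" "f \<in> Arr C \<Longrightarrow> FAr (id_ftr C) f = f"
  "f \<in> hom C x y \<Longrightarrow> FAr (id_ftr C) f = f"
  by (auto simp: id_ftr_def hom_def)

lemma id_ftr: "category C \<Longrightarrow> ftr_between C C (id_ftr C)"
proof (rule ftr_betweenI)
  fix a assume "category C" "a \<in> Obj C"
  then show "FAr (id_ftr C) (Ident C a) = Ident C (FOb (id_ftr C) a)"
    using id_in_hom by fastforce
next
  fix a b c f g
  assume "category C" "g \<in> hom C b c" "f \<in> hom C a b"
  then show "FAr (id_ftr C) (Comp C g f) = Comp C (FAr (id_ftr C) g) (FAr (id_ftr C) f)"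
    using comp_in_hom by fastforce
next
  fix a b f
  assume "category C" "f \<in> hom C a b"
  then show "FAr (id_ftr C) f \<in> hom C (FOb (id_ftr C) a) (FOb (id_ftr C) b)"
    using hom_dom_in[of C f a b] hom_cod_in[of C f a b] by simp
qed (auto simp: id_ftr_def)

lemma fcomp_simps [simp]:
  "Src (G \<circ>\<^sub>F F) = Src F" "Tgt (G \<circ>\<^sub>F F) = Tgt G"
  "a \<in> Obj (Src F) \<Longrightarrow> FOb (G \<circ>\<^sub>F F) a = FOb G (FOb F a)"
  "f \<in> Arr (Src F) \<Longrightarrow> FAr (G \<circ>\<^sub>F F) f = FAr G (FAr F f)"
  by (auto simp: fcomp_def compose_def)

lemma fcomp_hom:
  assumes "ftr_between C D F" "f \<in> hom C a b"
  shows "FAr (G \<circ>\<^sub>F F) f = FAr G (FAr F f)"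
  using assms by (auto simp: ftr_between_def hom_def)

lemma fcomp_ob:
  assumes "ftr_between C D F" "a \<in> Obj C"
  shows "FOb (G \<circ>\<^sub>F F) a = FOb G (FOb F a)"
  using assms by (auto simp: ftr_between_def)

lemma fcomp:
  assumes F: "ftr_between C D F" and G: "ftr_between D E G"
  shows "ftr_between C E (G \<circ>\<^sub>F F)"
proof (rule ftr_betweenI)
  note FC = ftr_betweenD[OF F] and GC = ftr_betweenD[OF G]
  show "category C" "category E" "Src (G \<circ>\<^sub>F F) = C" "Tgt (G \<circ>\<^sub>F F) = E"
    using FC GC by auto
  show "FOb (G \<circ>\<^sub>F F) a \<in> Obj E" if "a \<in> Obj C" for a
    using that by (simp add: fcomp_ob[OF F] ftr_ob[OF G] ftr_ob[OF F])
  show "FOb (G \<circ>\<^sub>F F) \<in> extensional (Obj C)" "FAr (G \<circ>\<^sub>F F) \<in> extensional (Arr C)"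
    using FC by (auto simp: fcomp_def)
  show "FAr (G \<circ>\<^sub>F F) f \<in> hom E (FOb (G \<circ>\<^sub>F F) a) (FOb (G \<circ>\<^sub>F F) b)" if f: "f \<in> hom C a b" for a b f
    unfolding fcomp_hom[OF F f] fcomp_ob[OF F hom_dom_in[OF FC(1) f]] fcomp_ob[OF F hom_cod_in[OF FC(1) f]]
    by (rule ftr_hom[OF G ftr_hom[OF F f]])
  show "FAr (G \<circ>\<^sub>F F) (Ident C a) = Ident E (FOb (G \<circ>\<^sub>F F) a)" if "a \<in> Obj C" for a
    using ftr_ident[OF G ftr_ob[OF F that]] ftr_ident[OF F that]
    by (simp add: fcomp_hom[OF F id_in_hom[OF FC(1) that]] fcomp_ob[OF F that])
  show "FAr (G \<circ>\<^sub>F F) (Comp C g f) = Comp E (FAr (G \<circ>\<^sub>F F) g) (FAr (G \<circ>\<^sub>F F) f)"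
    if g: "g \<in> hom C b c" and f: "f \<in> hom C a b" for a b c f g
    unfolding fcomp_hom[OF F comp_in_hom[OF FC(1) g f]] fcomp_hom[OF F g] fcomp_hom[OF F f]
      ftr_comp[OF F g f] by (rule ftr_comp[OF G ftr_hom[OF F g] ftr_hom[OF F f]])
qed

lemma fcomp_assoc:
  assumes F: "ftr_between A B F" and G: "ftr_between B C G" and H: "ftr_between C D H"
  shows "H \<circ>\<^sub>F (G \<circ>\<^sub>F F) = (H \<circ>\<^sub>F G) \<circ>\<^sub>F F"
proof (rule ftr_eqI[OF fcomp[OF fcomp[OF F G] H] fcomp[OF F fcomp[OF G H]]])
  show "FOb (H \<circ>\<^sub>F (G \<circ>\<^sub>F F)) a = FOb ((H \<circ>\<^sub>F G) \<circ>\<^sub>F F) a" if "a \<in> Obj A" for a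
    using that by (simp add: fcomp_ob[OF fcomp[OF F G]] fcomp_ob[OF F] fcomp_ob[OF G] ftr_ob[OF F])
  show "FAr (H \<circ>\<^sub>F (G \<circ>\<^sub>F F)) f = FAr ((H \<circ>\<^sub>F G) \<circ>\<^sub>F F) f" if "f \<in> Arr A" for f
  proof -
    note f = arr_in_hom[OF that]
    show ?thesis
      by (simp add: fcomp_hom[OF fcomp[OF F G] f] fcomp_hom[OF F f] fcomp_hom[OF G ftr_hom[OF F f]])
  qed
qed

lemma fcomp_id:
  assumes F: "ftr_between C D F"
  shows "id_ftr D \<circ>\<^sub>F F = F" "F \<circ>\<^sub>F id_ftr C = F"
proof -
  note FC = ftr_betweenD[OF F]
  show "id_ftr D \<circ>\<^sub>F F = F"
  proof (rule ftr_eqI[OF fcomp[OF F id_ftr[OF FC(2)]] F])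
    show "FOb (id_ftr D \<circ>\<^sub>F F) a = FOb F a" if "a \<in> Obj C" for a
      using that F by (simp add: fcomp_ob[OF F] ftr_ob)
    show "FAr (id_ftr D \<circ>\<^sub>F F) f = FAr F f" if "f \<in> Arr C" for f
      using id_ftr_simps(5)[OF ftr_hom[OF F arr_in_hom[OF that]]]
      by (simp add: fcomp_hom[OF F arr_in_hom[OF that]])
  qed
  show "F \<circ>\<^sub>F id_ftr C = F"
    by (rule ftr_eqI[OF fcomp[OF id_ftr[OF FC(1)] F] F]) auto
qed

lemma nt_hom:
  assumes "nt_between F G \<alpha>" "ftr_between C D F" "a \<in> Obj C"
  shows "Cmp \<alpha> a \<in> hom D (FOb F a) (FOb G a)"
  using assms by (auto simp: nt_between_def is_nt_def ftr_between_def Let_def)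

lemma nt_natural:
  assumes "nt_between F G \<alpha>" "ftr_between C D F" "f \<in> hom C a b"
  shows "Comp D (Cmp \<alpha> b) (FAr F f) = Comp D (FAr G f) (Cmp \<alpha> a)"
  using assms by (auto simp: nt_between_def is_nt_def ftr_between_def Let_def hom_def)

lemma nt_ftr:
  assumes "nt_between F G \<alpha>" "ftr_between C D F"
  shows "ftr_between C D G"
  using assms by (auto simp: nt_between_def is_nt_def ftr_between_def Let_def)

lemma nt_betweenI:
  assumes "ftr_between C D F" "ftr_between C D G" "NSrc \<alpha> = F" "NTgt \<alpha> = G"
    and "Cmp \<alpha> \<in> extensional (Obj C)"
    and "\<And>a. a \<in> Obj C \<Longrightarrow> Cmp \<alpha> a \<in> hom D (FOb F a) (FOb G a)"
    and "\<And>a b f. f \<in> hom C a b \<Longrightarrow> Comp D (Cmp \<alpha> b) (FAr F f) = Comp D (FAr G f) (Cmp \<alpha> a)"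
  shows "nt_between F G \<alpha>"
  using assms by (auto simp: nt_between_def is_nt_def ftr_between_def Let_def hom_def)

lemma id_nt:
  assumes F: "ftr_between C D F"
  shows "nt_between F F (id_nt F)"
proof (rule nt_betweenI[OF F F])
  note FC = ftr_betweenD[OF F]
  show "Cmp (id_nt F) \<in> extensional (Obj C)" using FC by (simp add: id_nt_def)
  show "Cmp (id_nt F) a \<in> hom D (FOb F a) (FOb F a)" if "a \<in> Obj C" for a
    using that FC id_in_hom[OF FC(2) ftr_ob[OF F that]] by (simp add: id_nt_def)
  show "Comp D (Cmp (id_nt F) b) (FAr F f) = Comp D (FAr F f) (Cmp (id_nt F) a)"
    if f: "f \<in> hom C a b" for a b f
    using FC hom_dom_in[OF FC(1) f] hom_cod_in[OF FC(1) f] comp_id_left[OF FC(2) ftr_hom[OF F f]]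
      comp_id_right[OF FC(2) ftr_hom[OF F f]] by (simp add: id_nt_def)
qed (simp_all add: id_nt_def)

lemma id_nt_cmp:
  assumes "ftr_between C D F" "a \<in> Obj C"
  shows "Cmp (id_nt F) a = Ident D (FOb F a)"
  using assms by (auto simp: id_nt_def ftr_between_def)

lemma vcomp_cmp:
  assumes "nt_between F G \<alpha>" "ftr_between C D F" "a \<in> Obj C"
  shows "Cmp (\<beta> \<circ>\<^sub>v \<alpha>) a = Comp D (Cmp \<beta> a) (Cmp \<alpha> a)"
  using assms by (auto simp: vcomp_def nt_between_def ftr_between_def)

lemma vcomp:
  assumes \<alpha>: "nt_between F G \<alpha>" and \<beta>: "nt_between G H \<beta>" and F: "ftr_between C D F"
  shows "nt_between F H (\<beta> \<circ>\<^sub>v \<alpha>)"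
proof -
  note G = nt_ftr[OF \<alpha> F]
  note H = nt_ftr[OF \<beta> G]
  note FC = ftr_betweenD[OF F]
  show ?thesis
  proof (rule nt_betweenI[OF F H])
    show "NSrc (\<beta> \<circ>\<^sub>v \<alpha>) = F" "NTgt (\<beta> \<circ>\<^sub>v \<alpha>) = H" "Cmp (\<beta> \<circ>\<^sub>v \<alpha>) \<in> extensional (Obj C)"
      using \<alpha> \<beta> FC by (auto simp: vcomp_def nt_between_def)
    show "Cmp (\<beta> \<circ>\<^sub>v \<alpha>) a \<in> hom D (FOb F a) (FOb H a)" if a: "a \<in> Obj C" for a
      using comp_in_hom[OF FC(2) nt_hom[OF \<beta> G a] nt_hom[OF \<alpha> F a]]
      by (simp add: vcomp_cmp[OF \<alpha> F a])
    show "Comp D (Cmp (\<beta> \<circ>\<^sub>v \<alpha>) b) (FAr F f) = Comp D (FAr H f) (Cmp (\<beta> \<circ>\<^sub>v \<alpha>) a)"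
      if f: "f \<in> hom C a b" for a b f
    proof -
      note a = hom_dom_in[OF FC(1) f] and b = hom_cod_in[OF FC(1) f]
      show ?thesis
        unfolding vcomp_cmp[OF \<alpha> F a] vcomp_cmp[OF \<alpha> F b]
        by (rule paste_squares[OF FC(2) nt_hom[OF \<alpha> F a] nt_hom[OF \<alpha> F b] nt_hom[OF \<beta> G a]
              nt_hom[OF \<beta> G b] ftr_hom[OF F f] ftr_hom[OF G f] ftr_hom[OF H f]
              nt_natural[OF \<alpha> F f] nt_natural[OF \<beta> G f]])
    qed
  qed
qed

lemma whisker_left_cmp:
  assumes \<alpha>: "nt_between F F' \<alpha>" and F: "ftr_between A B F" and G: "ftr_between B C G"
    and a: "a \<in> Obj A"
  shows "Cmp (G \<star>\<^sub>l \<alpha>) a = FAr G (Cmp \<alpha> a)"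
proof -
  note GC = ftr_betweenD[OF G] and FC = ftr_betweenD[OF F] and h = nt_hom[OF \<alpha> F a]
  have "Cmp (G \<star>\<^sub>l \<alpha>) a = Comp C (FAr G (Cmp \<alpha> a)) (Ident C (FOb G (FOb F a)))"
    using \<alpha> GC FC a ftr_ob[OF F a] by (auto simp: hcomp_def id_nt_def nt_between_def)
  then show ?thesis using comp_id_right[OF GC(2) ftr_hom[OF G h]] by simp
qed

lemma whisker_right_cmp:
  assumes \<alpha>: "nt_between G G' \<alpha>" and F: "ftr_between A B F" and G: "ftr_between B C G"
    and a: "a \<in> Obj A"
  shows "Cmp (\<alpha> \<star>\<^sub>r F) a = Cmp \<alpha> (FOb F a)"
proof -
  note G' = nt_ftr[OF \<alpha> G]
  note GC = ftr_betweenD[OF G] and FC = ftr_betweenD[OF F]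
  note b = ftr_ob[OF F a]
  note h = nt_hom[OF \<alpha> G b]
  have "Cmp (\<alpha> \<star>\<^sub>r F) a = Comp C (FAr G' (Ident B (FOb F a))) (Cmp \<alpha> (FOb F a))"
    using \<alpha> GC FC a by (auto simp: hcomp_def id_nt_def nt_between_def)
  then show ?thesis using comp_id_left[OF GC(2) h] ftr_ident[OF G' b] by simp
qed

lemma whisker_left:
  assumes \<alpha>: "nt_between F F' \<alpha>" and F: "ftr_between A B F" and G: "ftr_between B C G"
  shows "nt_between (G \<circ>\<^sub>F F) (G \<circ>\<^sub>F F') (G \<star>\<^sub>l \<alpha>)"
proof -
  note F' = nt_ftr[OF \<alpha> F]
  note FC = ftr_betweenD[OF F]
  show ?thesis
  proof (rule nt_betweenI[OF fcomp[OF F G] fcomp[OF F' G]])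
    show "NSrc (G \<star>\<^sub>l \<alpha>) = G \<circ>\<^sub>F F" "NTgt (G \<star>\<^sub>l \<alpha>) = G \<circ>\<^sub>F F'"
      "Cmp (G \<star>\<^sub>l \<alpha>) \<in> extensional (Obj A)"
      using \<alpha> FC by (auto simp: hcomp_def id_nt_def nt_between_def)
    show "Cmp (G \<star>\<^sub>l \<alpha>) a \<in> hom C (FOb (G \<circ>\<^sub>F F) a) (FOb (G \<circ>\<^sub>F F') a)" if a: "a \<in> Obj A" for a
      using ftr_hom[OF G nt_hom[OF \<alpha> F a]]
      by (simp add: whisker_left_cmp[OF \<alpha> F G a] fcomp_ob[OF F a] fcomp_ob[OF F' a])
    show "Comp C (Cmp (G \<star>\<^sub>l \<alpha>) b) (FAr (G \<circ>\<^sub>F F) f) = Comp C (FAr (G \<circ>\<^sub>F F') f) (Cmp (G \<star>\<^sub>l \<alpha>) a)"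
      if f: "f \<in> hom A a b" for a b f
    proof -
      note a = hom_dom_in[OF FC(1) f] and b = hom_cod_in[OF FC(1) f]
      show ?thesis
        unfolding whisker_left_cmp[OF \<alpha> F G a] whisker_left_cmp[OF \<alpha> F G b]
          fcomp_hom[OF F f] fcomp_hom[OF F' f]
          ftr_comp[OF G nt_hom[OF \<alpha> F b] ftr_hom[OF F f], symmetric]
          ftr_comp[OF G ftr_hom[OF F' f] nt_hom[OF \<alpha> F a], symmetric]
        by (simp add: nt_natural[OF \<alpha> F f])
    qed
  qed
qed

lemma whisker_right:
  assumes \<alpha>: "nt_between G G' \<alpha>" and F: "ftr_between A B F" and G: "ftr_between B C G"
  shows "nt_between (G \<circ>\<^sub>F F) (G' \<circ>\<^sub>F F) (\<alpha> \<star>\<^sub>r F)"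
proof -
  note G' = nt_ftr[OF \<alpha> G]
  note FC = ftr_betweenD[OF F]
  show ?thesis
  proof (rule nt_betweenI[OF fcomp[OF F G] fcomp[OF F G']])
    show "NSrc (\<alpha> \<star>\<^sub>r F) = G \<circ>\<^sub>F F" "NTgt (\<alpha> \<star>\<^sub>r F) = G' \<circ>\<^sub>F F"
      "Cmp (\<alpha> \<star>\<^sub>r F) \<in> extensional (Obj A)"
      using \<alpha> FC by (auto simp: hcomp_def id_nt_def nt_between_def)
    show "Cmp (\<alpha> \<star>\<^sub>r F) a \<in> hom C (FOb (G \<circ>\<^sub>F F) a) (FOb (G' \<circ>\<^sub>F F) a)" if a: "a \<in> Obj A" for a
      using nt_hom[OF \<alpha> G ftr_ob[OF F a]]
      by (simp add: whisker_right_cmp[OF \<alpha> F G a] fcomp_ob[OF F a])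
    show "Comp C (Cmp (\<alpha> \<star>\<^sub>r F) b) (FAr (G \<circ>\<^sub>F F) f) = Comp C (FAr (G' \<circ>\<^sub>F F) f) (Cmp (\<alpha> \<star>\<^sub>r F) a)"
      if f: "f \<in> hom A a b" for a b f
    proof -
      note a = hom_dom_in[OF FC(1) f] and b = hom_cod_in[OF FC(1) f]
      show ?thesis
        unfolding whisker_right_cmp[OF \<alpha> F G a] whisker_right_cmp[OF \<alpha> F G b] fcomp_hom[OF F f]
        by (rule nt_natural[OF \<alpha> G ftr_hom[OF F f]])
    qed
  qed
qed

lemma nat_iso_cmp:
  assumes "nat_iso \<alpha>" "nt_between F G \<alpha>" "ftr_between C D F" "a \<in> Obj C"
  shows "iso D (Cmp \<alpha> a)"
  using assms by (auto simp: nat_iso_def nt_between_def ftr_between_def)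

lemma inv_nt_cmp:
  assumes "nt_between F G \<alpha>" "ftr_between C D F" "a \<in> Obj C"
  shows "Cmp (inv_nt \<alpha>) a = inv_arr D (Cmp \<alpha> a)"
  using assms by (auto simp: inv_nt_def nt_between_def ftr_between_def)

lemma inv_nt:
  assumes i: "nat_iso \<alpha>" and \<alpha>: "nt_between F G \<alpha>" and F: "ftr_between C D F"
  shows "nt_between G F (inv_nt \<alpha>)"
proof -
  note G = nt_ftr[OF \<alpha> F]
  note FC = ftr_betweenD[OF F]
  note inv = inv_arr[OF FC(2) nat_iso_cmp[OF i \<alpha> F] nt_hom[OF \<alpha> F]]
  show ?thesis
  proof (rule nt_betweenI[OF G F])
    show "NSrc (inv_nt \<alpha>) = G" "NTgt (inv_nt \<alpha>) = F" "Cmp (inv_nt \<alpha>) \<in> extensional (Obj C)"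
      using \<alpha> FC by (auto simp: inv_nt_def nt_between_def)
    show "Cmp (inv_nt \<alpha>) a \<in> hom D (FOb G a) (FOb F a)" if a: "a \<in> Obj C" for a
      using inv(1)[OF a a] by (simp add: inv_nt_cmp[OF \<alpha> F a])
    show "Comp D (Cmp (inv_nt \<alpha>) b) (FAr G f) = Comp D (FAr F f) (Cmp (inv_nt \<alpha>) a)"
      if f: "f \<in> hom C a b" for a b f
    proof -
      note a = hom_dom_in[OF FC(1) f] and b = hom_cod_in[OF FC(1) f]
      let ?m = "Cmp \<alpha>" and ?n = "\<lambda>x. inv_arr D (Cmp \<alpha> x)"
      note ha = nt_hom[OF \<alpha> F a] and hb = nt_hom[OF \<alpha> F b]
      have "Comp D (?n b) (FAr G f) = Comp D (?n b) (Comp D (FAr G f) (Comp D (?m a) (?n a)))"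
        using inv(3)[OF a a] comp_id_right[OF FC(2) ftr_hom[OF G f]] by simp
      also have "\<dots> = Comp D (?n b) (Comp D (Comp D (FAr G f) (?m a)) (?n a))"
        using comp_assoc[OF FC(2) ftr_hom[OF G f] ha inv(1)[OF a a]] by simp
      also have "\<dots> = Comp D (?n b) (Comp D (Comp D (?m b) (FAr F f)) (?n a))"
        using nt_natural[OF \<alpha> F f] by simp
      also have "\<dots> = Comp D (?n b) (Comp D (?m b) (Comp D (FAr F f) (?n a)))"
        using comp_assoc[OF FC(2) hb ftr_hom[OF F f] inv(1)[OF a a]] by simp
      also have "\<dots> = Comp D (Comp D (?n b) (?m b)) (Comp D (FAr F f) (?n a))"
        using comp_assoc[OF FC(2) inv(1)[OF b b] hb comp_in_hom[OF FC(2) ftr_hom[OF F f] inv(1)[OF a a]]]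
        by simp
      also have "\<dots> = Comp D (FAr F f) (?n a)"
        using inv(2)[OF b b] comp_id_left[OF FC(2) comp_in_hom[OF FC(2) ftr_hom[OF F f] inv(1)[OF a a]]]
        by simp
      finally show ?thesis by (simp add: inv_nt_cmp[OF \<alpha> F a] inv_nt_cmp[OF \<alpha> F b])
    qed
  qed
qed

section \<open>Universal cocones\<close>

text \<open>
  Coproducts are the case in which all \<open>R i\<close> are the identity, universal arrows the case of a
  one-element index set. Treating both at once lets one comparison argument serve for both.
\<close>

definition universal ::
  "('o1, 'm1) cat \<Rightarrow> 'i set \<Rightarrow> ('i \<Rightarrow> ('o2, 'm2) cat) \<Rightarrow> ('i \<Rightarrow> ('o1, 'm1, 'o2, 'm2) ftr) \<Rightarrow>
   ('i \<Rightarrow> 'o2) \<Rightarrow> 'o1 \<Rightarrow> ('i \<Rightarrow> 'm2) \<Rightarrow> bool" where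
  "universal C I D R y c e \<longleftrightarrow>
     c \<in> Obj C \<and> (\<forall>i\<in>I. e i \<in> hom (D i) (y i) (FOb (R i) c)) \<and>
     (\<forall>d\<in>Obj C. \<forall>f. (\<forall>i\<in>I. f i \<in> hom (D i) (y i) (FOb (R i) d)) \<longrightarrow>
        (\<exists>!h. h \<in> hom C c d \<and> (\<forall>i\<in>I. Comp (D i) (FAr (R i) h) (e i) = f i)))"

abbreviation universal_arrow ::
  "('o1, 'm1) cat \<Rightarrow> ('o2, 'm2) cat \<Rightarrow> ('o1, 'm1, 'o2, 'm2) ftr \<Rightarrow> 'o2 \<Rightarrow> 'o1 \<Rightarrow> 'm2 \<Rightarrow> bool" where
  "universal_arrow C D R y c e \<equiv> universal C {()} (\<lambda>_. D) (\<lambda>_. R) (\<lambda>_. y) c (\<lambda>_. e)"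

lemma universalI:
  assumes "c \<in> Obj C" "\<And>i. i \<in> I \<Longrightarrow> e i \<in> hom (D i) (y i) (FOb (R i) c)"
    and "\<And>d f. d \<in> Obj C \<Longrightarrow> (\<And>i. i \<in> I \<Longrightarrow> f i \<in> hom (D i) (y i) (FOb (R i) d)) \<Longrightarrow>
      \<exists>h\<in>hom C c d. \<forall>i\<in>I. Comp (D i) (FAr (R i) h) (e i) = f i"
    and "\<And>d h h'. d \<in> Obj C \<Longrightarrow> h \<in> hom C c d \<Longrightarrow> h' \<in> hom C c d \<Longrightarrow>
      (\<And>i. i \<in> I \<Longrightarrow> Comp (D i) (FAr (R i) h) (e i) = Comp (D i) (FAr (R i) h') (e i)) \<Longrightarrow> h = h'"
  shows "universal C I D R y c e"
  unfolding universal_def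
proof (intro conjI ballI allI impI)
  fix d f assume d: "d \<in> Obj C" and f: "\<forall>i\<in>I. f i \<in> hom (D i) (y i) (FOb (R i) d)"
  obtain h where h: "h \<in> hom C c d" "\<forall>i\<in>I. Comp (D i) (FAr (R i) h) (e i) = f i"
    using assms(3)[OF d, of f] f by blast
  show "\<exists>!h. h \<in> hom C c d \<and> (\<forall>i\<in>I. Comp (D i) (FAr (R i) h) (e i) = f i)"
  proof (rule ex1I[of _ h])
    fix h' assume "h' \<in> hom C c d \<and> (\<forall>i\<in>I. Comp (D i) (FAr (R i) h') (e i) = f i)"
    then show "h' = h" using assms(4)[OF d, of h' h] h by simp
  qed (use h in simp)
qed (use assms in auto)

lemma universal_ob: "universal C I D R y c e \<Longrightarrow> c \<in> Obj C"
  and universal_hom: "universal C I D R y c e \<Longrightarrow> i \<in> I \<Longrightarrow> e i \<in> hom (D i) (y i) (FOb (R i) c)"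
  by (auto simp: universal_def)

lemma universal_ex1:
  assumes U: "universal C I D R y c e" and d: "d \<in> Obj C"
    and f: "\<And>i. i \<in> I \<Longrightarrow> f i \<in> hom (D i) (y i) (FOb (R i) d)"
  shows "\<exists>!h. h \<in> hom C c d \<and> (\<forall>i\<in>I. Comp (D i) (FAr (R i) h) (e i) = f i)"
proof -
  have "\<forall>f. (\<forall>i\<in>I. f i \<in> hom (D i) (y i) (FOb (R i) d)) \<longrightarrow>
      (\<exists>!h. h \<in> hom C c d \<and> (\<forall>i\<in>I. Comp (D i) (FAr (R i) h) (e i) = f i))"
    using U d unfolding universal_def by (elim conjE) (erule bspec)
  from spec[OF this, of f] f show ?thesis by simp
qed

lemma universal_factor:
  assumes "universal C I D R y c e" "d \<in> Obj C" "\<And>i. i \<in> I \<Longrightarrow> f i \<in> hom (D i) (y i) (FOb (R i) d)"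
  obtains h where "h \<in> hom C c d" "\<And>i. i \<in> I \<Longrightarrow> Comp (D i) (FAr (R i) h) (e i) = f i"
  using universal_ex1[OF assms] by (auto elim!: ex1E)

lemma universal_eq:
  assumes U: "universal C I D R y c e" and R: "\<And>i. i \<in> I \<Longrightarrow> ftr_between C (D i) (R i)"
    and C: "category C"
    and h: "h \<in> hom C c d" and h': "h' \<in> hom C c d"
    and eq: "\<And>i. i \<in> I \<Longrightarrow> Comp (D i) (FAr (R i) h) (e i) = Comp (D i) (FAr (R i) h') (e i)"
  shows "h = h'"
proof -
  have "Comp (D i) (FAr (R i) h) (e i) \<in> hom (D i) (y i) (FOb (R i) d)" if "i \<in> I" for i
    using comp_in_hom[OF ftr_betweenD(2)[OF R] ftr_hom[OF R h] universal_hom[OF U]] that by blast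
  then have "\<exists>!k. k \<in> hom C c d \<and>
      (\<forall>i\<in>I. Comp (D i) (FAr (R i) k) (e i) = Comp (D i) (FAr (R i) h) (e i))"
    using universal_ex1[OF U hom_cod_in[OF C h], of "\<lambda>i. Comp (D i) (FAr (R i) h) (e i)"] by simp
  then obtain k where k: "\<forall>h'. h' \<in> hom C c d \<and>
      (\<forall>i\<in>I. Comp (D i) (FAr (R i) h') (e i) = Comp (D i) (FAr (R i) h) (e i)) \<longrightarrow> h' = k"
    by (elim ex1E) blast
  have "h = k" using h by (intro k[rule_format]) simp
  moreover have "h' = k" using h' eq by (intro k[rule_format]) simp
  ultimately show ?thesis by simp
qed

lemma universal_cong:
  assumes "universal C I D R y c e" "\<And>i. i \<in> I \<Longrightarrow> e i = e' i"
  shows "universal C I D R y c e'"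
  using assms unfolding universal_def by simp

lemma is_coproduct_iff_universal:
  assumes C: "category C"
  shows "is_coproduct C I x c \<iota> \<longleftrightarrow> universal C I (\<lambda>_. C) (\<lambda>_. id_ftr C) x c \<iota>"
proof -
  have "x i \<in> Obj C" if "\<iota> i \<in> hom C (x i) c" for i using hom_dom_in[OF C that] .
  then show ?thesis
    unfolding is_coproduct_def universal_def
    by (auto cong: conj_cong)
qed

lemma universal_comparison_iso:
  assumes C: "category C" and R: "\<And>i. i \<in> I \<Longrightarrow> ftr_between C (D i) (R i)"
    and U: "universal C I D R y c e" and U': "universal C I D R y c' e'"
    and b: "b \<in> hom C c c'" and be: "\<And>i. i \<in> I \<Longrightarrow> Comp (D i) (FAr (R i) b) (e i) = e' i"
  shows "iso C b"
proof -
  note c = universal_ob[OF U] and c' = universal_ob[OF U']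
  obtain b' where b': "b' \<in> hom C c' c" "\<And>i. i \<in> I \<Longrightarrow> Comp (D i) (FAr (R i) b') (e' i) = e i"
    using universal_factor[OF U' c, of e] universal_hom[OF U] by metis
  have step: "Comp (D i) (FAr (R i) (Comp C q p)) (m i) = m i"
    if p: "p \<in> hom C a a'" and q: "q \<in> hom C a' a"
      and m: "\<And>i. i \<in> I \<Longrightarrow> m i \<in> hom (D i) (y i) (FOb (R i) a)"
      and pm: "\<And>i. i \<in> I \<Longrightarrow> Comp (D i) (FAr (R i) p) (m i) = n i"
      and qn: "\<And>i. i \<in> I \<Longrightarrow> Comp (D i) (FAr (R i) q) (n i) = m i" and i: "i \<in> I"
    for a a' p q m n i
    unfolding ftr_comp[OF R[OF i] q p]
    using comp_assoc[OF ftr_betweenD(2)[OF R[OF i]] ftr_hom[OF R[OF i] q] ftr_hom[OF R[OF i] p] m[OF i]]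
      pm[OF i] qn[OF i] by simp
  have idl: "Comp (D i) (FAr (R i) (Ident C a)) m = m"
    if "a \<in> Obj C" "m \<in> hom (D i) (y i) (FOb (R i) a)" "i \<in> I" for a m i
    using comp_id_left[OF ftr_betweenD(2)[OF R[OF that(3)]] that(2)] ftr_ident[OF R[OF that(3)] that(1)]
    by simp
  show ?thesis
  proof (rule isoI[OF b b'(1)])
    show "Comp C b' b = Ident C c"
    proof (rule universal_eq[OF U R C comp_in_hom[OF C b'(1) b] id_in_hom[OF C c]])
      fix i assume i: "i \<in> I"
      show "Comp (D i) (FAr (R i) (Comp C b' b)) (e i) = Comp (D i) (FAr (R i) (Ident C c)) (e i)"
        using step[OF b b'(1) universal_hom[OF U] be b'(2) i] idl[OF c universal_hom[OF U i] i] by simp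
    qed
    show "Comp C b b' = Ident C c'"
    proof (rule universal_eq[OF U' R C comp_in_hom[OF C b b'(1)] id_in_hom[OF C c']])
      fix i assume i: "i \<in> I"
      show "Comp (D i) (FAr (R i) (Comp C b b')) (e' i) = Comp (D i) (FAr (R i) (Ident C c')) (e' i)"
        using step[OF b'(1) b universal_hom[OF U'] b'(2) be i] idl[OF c' universal_hom[OF U' i] i] by simp
    qed
  qed
qed

lemma universal_precomp_iso:
  assumes C: "category C" and R: "\<And>i. i \<in> I \<Longrightarrow> ftr_between C (D i) (R i)"
    and U: "universal C I D R x c e"
    and a: "\<And>i. i \<in> I \<Longrightarrow> a i \<in> hom (D i) (y i) (x i)" "\<And>i. i \<in> I \<Longrightarrow> iso (D i) (a i)"
  shows "universal C I D R y c (\<lambda>i. Comp (D i) (e i) (a i))"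
proof (rule universalI)
  note D = ftr_betweenD(2)[OF R]
  note e = universal_hom[OF U]
  show "c \<in> Obj C" by (rule universal_ob[OF U])
  show "Comp (D i) (e i) (a i) \<in> hom (D i) (y i) (FOb (R i) c)" if i: "i \<in> I" for i
    by (rule comp_in_hom[OF D[OF i] e[OF i] a(1)[OF i]])
  have assoc: "Comp (D i) (FAr (R i) h) (Comp (D i) (e i) (a i)) =
      Comp (D i) (Comp (D i) (FAr (R i) h) (e i)) (a i)" if "i \<in> I" "h \<in> hom C c d" for i h d
    by (rule comp_assoc[OF D[OF that(1)] ftr_hom[OF R[OF that(1)] that(2)] e[OF that(1)] a(1)[OF that(1)]])
  fix d assume d: "d \<in> Obj C"
  define a' where "a' i = inv_arr (D i) (a i)" for i
  note a' = inv_arr[OF D a(2) a(1), folded a'_def]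
  show "\<exists>h\<in>hom C c d. \<forall>i\<in>I. Comp (D i) (FAr (R i) h) (Comp (D i) (e i) (a i)) = f i"
    if f: "\<And>i. i \<in> I \<Longrightarrow> f i \<in> hom (D i) (y i) (FOb (R i) d)" for f
  proof -
    obtain h where h: "h \<in> hom C c d"
      "\<And>i. i \<in> I \<Longrightarrow> Comp (D i) (FAr (R i) h) (e i) = Comp (D i) (f i) (a' i)"
      using universal_factor[OF U d, of "\<lambda>i. Comp (D i) (f i) (a' i)"] comp_in_hom[OF D f a'(1)]
      by metis
    have "Comp (D i) (FAr (R i) h) (Comp (D i) (e i) (a i)) = f i" if i: "i \<in> I" for i
      using assoc[OF i h(1)] h(2)[OF i] comp_assoc[OF D[OF i] f[OF i] a'(1)[OF i i i] a(1)[OF i]]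
        a'(2)[OF i i i] comp_id_right[OF D[OF i] f[OF i]] by simp
    then show ?thesis using h(1) by blast
  qed
  show "h = h'" if h: "h \<in> hom C c d" and h': "h' \<in> hom C c d"
    and eq: "\<And>i. i \<in> I \<Longrightarrow> Comp (D i) (FAr (R i) h) (Comp (D i) (e i) (a i)) =
      Comp (D i) (FAr (R i) h') (Comp (D i) (e i) (a i))" for h h'
  proof (rule universal_eq[OF U R C h h'])
    fix i assume i: "i \<in> I"
    have "Comp (D i) (FAr (R i) k) (e i) =
        Comp (D i) (Comp (D i) (Comp (D i) (FAr (R i) k) (e i)) (a i)) (a' i)"
      if k: "k \<in> hom C c d" for k
    proof -
      note ke = comp_in_hom[OF D[OF i] ftr_hom[OF R[OF i] k] e[OF i]]
      show ?thesis
        using comp_assoc[OF D[OF i] ke a(1)[OF i] a'(1)[OF i i i]] a'(3)[OF i i i]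
          comp_id_right[OF D[OF i] ke] by simp
    qed
    then show "Comp (D i) (FAr (R i) h) (e i) = Comp (D i) (FAr (R i) h') (e i)"
      using assoc[OF i h] assoc[OF i h'] eq[OF i] h h' by metis
  qed
qed

lemma universal_postcomp_iso:
  assumes C: "category C" and R: "\<And>i. i \<in> I \<Longrightarrow> ftr_between C (D i) (R i)"
    and U: "universal C I D R y c e" and b: "b \<in> hom C c c'" "iso C b"
  shows "universal C I D R y c' (\<lambda>i. Comp (D i) (FAr (R i) b) (e i))"
proof (rule universalI)
  note D = ftr_betweenD(2)[OF R]
  note e = universal_hom[OF U]
  obtain b' where b': "b' \<in> hom C c' c" "Comp C b' b = Ident C c" "Comp C b b' = Ident C c'"
    using isoE[OF b(2,1)] by metis
  show "c' \<in> Obj C" by (rule hom_cod_in[OF C b(1)])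
  show "Comp (D i) (FAr (R i) b) (e i) \<in> hom (D i) (y i) (FOb (R i) c')" if i: "i \<in> I" for i
    by (rule comp_in_hom[OF D[OF i] ftr_hom[OF R[OF i] b(1)] e[OF i]])
  have assoc: "Comp (D i) (FAr (R i) h) (Comp (D i) (FAr (R i) b) (e i)) =
      Comp (D i) (FAr (R i) (Comp C h b)) (e i)" if i: "i \<in> I" and h: "h \<in> hom C c' d" for i h d
    using comp_assoc[OF D[OF i] ftr_hom[OF R[OF i] h] ftr_hom[OF R[OF i] b(1)] e[OF i]]
      ftr_comp[OF R[OF i] h b(1)] by simp
  fix d assume d: "d \<in> Obj C"
  show "\<exists>h\<in>hom C c' d. \<forall>i\<in>I. Comp (D i) (FAr (R i) h) (Comp (D i) (FAr (R i) b) (e i)) = f i"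
    if f: "\<And>i. i \<in> I \<Longrightarrow> f i \<in> hom (D i) (y i) (FOb (R i) d)" for f
  proof -
    obtain h where h: "h \<in> hom C c d" "\<And>i. i \<in> I \<Longrightarrow> Comp (D i) (FAr (R i) h) (e i) = f i"
      using universal_factor[OF U d f] by metis
    have "Comp C (Comp C h b') b = h"
      using comp_assoc[OF C h(1) b'(1) b(1)] b'(2) comp_id_right[OF C h(1)] by simp
    then show ?thesis
      using comp_in_hom[OF C h(1) b'(1)] h(2) assoc[OF _ comp_in_hom[OF C h(1) b'(1)]]
      by (intro bexI[of _ "Comp C h b'"]) simp_all
  qed
  show "h = h'" if h: "h \<in> hom C c' d" and h': "h' \<in> hom C c' d"
    and eq: "\<And>i. i \<in> I \<Longrightarrow> Comp (D i) (FAr (R i) h) (Comp (D i) (FAr (R i) b) (e i)) =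
      Comp (D i) (FAr (R i) h') (Comp (D i) (FAr (R i) b) (e i))" for h h'
  proof -
    have "Comp C h b = Comp C h' b"
      by (rule universal_eq[OF U R C comp_in_hom[OF C h b(1)] comp_in_hom[OF C h' b(1)]])
        (use assoc h h' eq in simp_all)
    then show ?thesis
      using comp_assoc[OF C h b(1) b'(1)] comp_assoc[OF C h' b(1) b'(1)] b'(3)
        comp_id_right[OF C h] comp_id_right[OF C h'] by simp
  qed
qed

text \<open>
  Universality depends only on the isomorphism class of a cocone, and a morphism from a universal
  cocone that is invertible on the sources detects universality by its invertibility on the vertex.
  This is how cocones are compared below, in different values of a derivator as well as before and
  after a morphism is applied.
\<close>

lemma universal_square_source:
  assumes C: "category C" and R: "\<And>i. i \<in> I \<Longrightarrow> ftr_between C (D i) (R i)"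
    and U: "universal C I D R y c e"
    and a: "\<And>i. i \<in> I \<Longrightarrow> a i \<in> hom (D i) (y i) (x i)" "\<And>i. i \<in> I \<Longrightarrow> iso (D i) (a i)"
    and b: "b \<in> hom C c c'" and k: "\<And>i. i \<in> I \<Longrightarrow> k i \<in> hom (D i) (x i) (FOb (R i) c')"
    and sq: "\<And>i. i \<in> I \<Longrightarrow> Comp (D i) (FAr (R i) b) (e i) = Comp (D i) (k i) (a i)"
  shows "universal C I D R x c' k \<longleftrightarrow> iso C b"
proof
  note D = ftr_betweenD(2)[OF R]
  assume "universal C I D R x c' k"
  from universal_precomp_iso[OF C R this a]
  have "universal C I D R y c' (\<lambda>i. Comp (D i) (k i) (a i))" by blast
  from universal_comparison_iso[OF C R U this b sq] show "iso C b" by blast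
next
  note D = ftr_betweenD(2)[OF R]
  assume i: "iso C b"
  define a' where "a' i = inv_arr (D i) (a i)" for i
  note a' = inv_arr[OF D a(2) a(1), folded a'_def]
  from universal_postcomp_iso[OF C R U b i]
  have "universal C I D R y c' (\<lambda>i. Comp (D i) (FAr (R i) b) (e i))" by blast
  from universal_precomp_iso[OF C R this a'(1) iso_inv_arr[OF D a(2) a(1), folded a'_def]]
  have "universal C I D R x c' (\<lambda>i. Comp (D i) (Comp (D i) (FAr (R i) b) (e i)) (a' i))" by blast
  moreover have "Comp (D i) (Comp (D i) (FAr (R i) b) (e i)) (a' i) = k i" if i: "i \<in> I" for i
    unfolding sq[OF i]
    using comp_assoc[OF D[OF i] k[OF i] a(1)[OF i] a'(1)[OF i i i]] a'(3)[OF i i i]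
      comp_id_right[OF D[OF i] k[OF i]] by simp
  ultimately show "universal C I D R x c' k" by (rule universal_cong)
qed

lemma coproduct_hom: "is_coproduct C I x c \<iota> \<Longrightarrow> i \<in> I \<Longrightarrow> \<iota> i \<in> hom C (x i) c"
  and coproduct_ob: "is_coproduct C I x c \<iota> \<Longrightarrow> c \<in> Obj C"
  by (auto simp: is_coproduct_def)

lemma coproduct_cong:
  assumes "is_coproduct C I x c \<iota>" "\<And>i. i \<in> I \<Longrightarrow> x i = x' i" "\<And>i. i \<in> I \<Longrightarrow> \<iota> i = \<iota>' i"
  shows "is_coproduct C I x' c \<iota>'"
  using assms unfolding is_coproduct_def by simp

lemma coproduct_square_source:
  assumes C: "category C" and U: "is_coproduct C I y c e"
    and a: "\<And>i. i \<in> I \<Longrightarrow> a i \<in> hom C (y i) (x i)" "\<And>i. i \<in> I \<Longrightarrow> iso C (a i)"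
    and b: "b \<in> hom C c c'" and k: "\<And>i. i \<in> I \<Longrightarrow> k i \<in> hom C (x i) c'"
    and sq: "\<And>i. i \<in> I \<Longrightarrow> Comp C b (e i) = Comp C (k i) (a i)"
  shows "is_coproduct C I x c' k \<longleftrightarrow> iso C b"
  using universal_square_source[OF C id_ftr[OF C] U[unfolded is_coproduct_iff_universal[OF C]] a b, of k]
    k sq hom_cod_in[OF C b] b by (simp add: is_coproduct_iff_universal[OF C])

lemma coproduct_iso_square:
  assumes C: "category C"
    and a: "\<And>i. i \<in> I \<Longrightarrow> a i \<in> hom C (y i) (x i)" "\<And>i. i \<in> I \<Longrightarrow> iso C (a i)"
    and b: "b \<in> hom C c c'" "iso C b"
    and e: "\<And>i. i \<in> I \<Longrightarrow> e i \<in> hom C (y i) c" and k: "\<And>i. i \<in> I \<Longrightarrow> k i \<in> hom C (x i) c'"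
    and sq: "\<And>i. i \<in> I \<Longrightarrow> Comp C b (e i) = Comp C (k i) (a i)"
  shows "is_coproduct C I y c e \<longleftrightarrow> is_coproduct C I x c' k"
proof
  assume "is_coproduct C I y c e"
  then show "is_coproduct C I x c' k"
    using coproduct_square_source[where I = I and x = x and y = y and k = k, OF C _ a b(1) k sq] b(2) by blast
next
  assume U: "is_coproduct C I x c' k"
  obtain b' where b': "b' \<in> hom C c' c" "Comp C b' b = Ident C c" "Comp C b b' = Ident C c'"
    using isoE[OF b(2,1)] by metis
  note a' = inv_arr[OF C a(2) a(1)]
  have sq': "Comp C b' (k i) = Comp C (e i) (inv_arr C (a i))" if i: "i \<in> I" for i
  proof (rule iso_comp_cancel[OF C b])
    show "Comp C b' (k i) \<in> hom C (x i) c" by (rule comp_in_hom[OF C b'(1) k[OF i]])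
    show "Comp C (e i) (inv_arr C (a i)) \<in> hom C (x i) c"
      by (rule comp_in_hom[OF C e[OF i] a'(1)[OF i i]])
    show "Comp C b (Comp C b' (k i)) = Comp C b (Comp C (e i) (inv_arr C (a i)))"
      using comp_assoc[OF C b(1) b'(1) k[OF i]] b'(3) comp_id_left[OF C k[OF i]]
        comp_assoc[OF C b(1) e[OF i] a'(1)[OF i i]] sq[OF i]
        comp_assoc[OF C k[OF i] a(1)[OF i] a'(1)[OF i i]] a'(3)[OF i i] comp_id_right[OF C k[OF i]]
      by simp
  qed
  show "is_coproduct C I y c e"
    by (rule iffD2[OF coproduct_square_source[OF C U a'(1) iso_inv_arr[OF C a(2) a(1)] b'(1) e sq']])
      (rule isoI[OF b'(1) b(1) b'(3,2)] | assumption)+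
qed

lemma coproduct_factor:
  assumes "is_coproduct C I x c \<iota>" "d \<in> Obj C" "\<And>i. i \<in> I \<Longrightarrow> f i \<in> hom C (x i) d"
  obtains h where "h \<in> hom C c d" "\<And>i. i \<in> I \<Longrightarrow> Comp C h (\<iota> i) = f i"
proof -
  have "\<exists>!h. h \<in> hom C c d \<and> (\<forall>i\<in>I. Comp C h (\<iota> i) = f i)"
    using assms unfolding is_coproduct_def by simp
  then show thesis using that by (auto elim!: ex1E)
qed

text \<open>
  A functor preserves isomorphisms of cocones, and any two coproducts of isomorphic families are
  isomorphic as cocones. So one coproduct for each family, taken up to isomorphism, decides
  preservation; the coproducts built from left Kan extensions will do.
\<close>

lemma preserves_coproductsI:
  assumes F: "ftr_between C D F"
    and enough: "\<And>x. (\<And>i. i \<in> I \<Longrightarrow> x i \<in> Obj C) \<Longrightarrow>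
      \<exists>y a c e. (\<forall>i\<in>I. a i \<in> hom C (y i) (x i) \<and> iso C (a i)) \<and> is_coproduct C I y c e \<and>
        is_coproduct D I (\<lambda>i. FOb F (y i)) (FOb F c) (\<lambda>i. FAr F (e i))"
  shows "preserves_coproducts I F"
  unfolding preserves_coproducts_def ftr_betweenD(3,4)[OF F]
proof (intro allI impI)
  note C = ftr_betweenD(1)[OF F] and D = ftr_betweenD(2)[OF F]
  fix x c' k assume cop: "is_coproduct C I x c' k"
  then have "\<And>i. i \<in> I \<Longrightarrow> x i \<in> Obj C" by (simp add: is_coproduct_def)
  from enough[of x, OF this] obtain y a c e where
    a': "\<forall>i\<in>I. a i \<in> hom C (y i) (x i) \<and> iso C (a i)"
    and y: "is_coproduct C I y c e"
    and Fy: "is_coproduct D I (\<lambda>i. FOb F (y i)) (FOb F c) (\<lambda>i. FAr F (e i))"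
    by blast
  have a: "\<And>i. i \<in> I \<Longrightarrow> a i \<in> hom C (y i) (x i)" "\<And>i. i \<in> I \<Longrightarrow> iso C (a i)"
    using a' by blast+
  obtain b where b: "b \<in> hom C c c'" "\<And>i. i \<in> I \<Longrightarrow> Comp C b (e i) = Comp C (k i) (a i)"
    using coproduct_factor[OF y coproduct_ob[OF cop], of "\<lambda>i. Comp C (k i) (a i)"]
      comp_in_hom[OF C coproduct_hom[OF cop] a(1)] by metis
  have ib: "iso C b"
    using coproduct_square_source[OF C y a b(1) coproduct_hom[OF cop] b(2)] cop by blast
  have sq: "Comp D (FAr F b) (FAr F (e i)) = Comp D (FAr F (k i)) (FAr F (a i))" if i: "i \<in> I" for i
    using ftr_comp[OF F b(1) coproduct_hom[OF y i]] ftr_comp[OF F coproduct_hom[OF cop i] a(1)[OF i]]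
      b(2)[OF i] by simp
  have "is_coproduct D I (\<lambda>i. FOb F (y i)) (FOb F c) (\<lambda>i. FAr F (e i)) \<longleftrightarrow>
      is_coproduct D I (\<lambda>i. FOb F (x i)) (FOb F c') (\<lambda>i. FAr F (k i))"
    by (rule coproduct_iso_square[where a = "\<lambda>i. FAr F (a i)" and b = "FAr F b"])
      (use D ftr_hom[OF F] ftr_iso[OF F] a b ib sq coproduct_hom[OF y] coproduct_hom[OF cop] in blast)+
  then show "is_coproduct D I (\<lambda>i. FOb F (x i)) (FOb F c') (\<lambda>i. FAr F (k i))" using Fy by simp
qed

text \<open>
  Read universal arrows as values of left adjoints: the left adjoint of \<open>R \<circ> T\<close> at \<open>y\<close> is that of
  \<open>T\<close> at the value \<open>c\<close> of that of \<open>R\<close>.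
\<close>

lemma universal_arrow_compose:
  assumes R: "ftr_between B A R" and T: "ftr_between C B T"
    and U: "universal_arrow B A R y c e" and V: "universal_arrow C B T c d k"
  shows "universal_arrow C A (R \<circ>\<^sub>F T) y d (Comp A (FAr R k) e)"
proof -
  note A = ftr_betweenD(2)[OF R] and B = ftr_betweenD(1)[OF R] and C = ftr_betweenD(1)[OF T]
  note RT = fcomp[OF T R]
  note d = universal_ob[OF V]
  have k: "k \<in> hom B c (FOb T d)" using universal_hom[OF V] by simp
  have e: "e \<in> hom A y (FOb R c)" using universal_hom[OF U] by simp
  have comp: "Comp A (FAr (R \<circ>\<^sub>F T) h) (Comp A (FAr R k) e) = Comp A (FAr R (Comp B (FAr T h) k)) e"
    if h: "h \<in> hom C d d'" for h d'
    unfolding fcomp_hom[OF T h] ftr_comp[OF R ftr_hom[OF T h] k]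
    by (rule comp_assoc[OF A ftr_hom[OF R ftr_hom[OF T h]] ftr_hom[OF R k] e])
  show ?thesis
  proof (rule universalI)
    show "d \<in> Obj C" by (rule d)
    show "Comp A (FAr R k) e \<in> hom A y (FOb (R \<circ>\<^sub>F T) d)"
      using comp_in_hom[OF A ftr_hom[OF R k] e] by (simp add: fcomp_ob[OF T d])
    fix d' assume d': "d' \<in> Obj C"
    show "\<exists>h\<in>hom C d d'. \<forall>i\<in>{()}. Comp A (FAr (R \<circ>\<^sub>F T) h) (Comp A (FAr R k) e) = f i"
      if f: "\<And>i. i \<in> {()} \<Longrightarrow> f i \<in> hom A y (FOb (R \<circ>\<^sub>F T) d')" for f
    proof -
      have "f () \<in> hom A y (FOb R (FOb T d'))" using f by (simp add: fcomp_ob[OF T d'])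
      then obtain g where g: "g \<in> hom B c (FOb T d')" "Comp A (FAr R g) e = f ()"
        using universal_factor[OF U ftr_ob[OF T d'], of "\<lambda>_. f ()"] by auto
      obtain h where h: "h \<in> hom C d d'" "Comp B (FAr T h) k = g"
        using universal_factor[OF V d', of "\<lambda>_. g"] g(1) by auto
      show ?thesis using comp[OF h(1)] h g(2) by auto
    qed
    show "h = h'" if h: "h \<in> hom C d d'" and h': "h' \<in> hom C d d'"
      and eq: "\<And>i. i \<in> {()} \<Longrightarrow> Comp A (FAr (R \<circ>\<^sub>F T) h) (Comp A (FAr R k) e) =
        Comp A (FAr (R \<circ>\<^sub>F T) h') (Comp A (FAr R k) e)" for h h'
    proof -
      have "Comp B (FAr T h) k = Comp B (FAr T h') k"
        by (rule universal_eq[OF U R B comp_in_hom[OF B ftr_hom[OF T h] k]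
              comp_in_hom[OF B ftr_hom[OF T h'] k]]) (use eq comp[OF h] comp[OF h'] in simp)
      then show ?thesis using universal_eq[OF V T C h h'] by simp
    qed
  qed
qed

section \<open>Adjunctions and mates\<close>

lemma adjunction_ftr:
  assumes "adjunction L R \<eta> \<epsilon>" "ftr_between D C R"
  shows "ftr_between C D L"
  using assms by (auto simp: adjunction_def ftr_between_def)

lemma adjunction_unit:
  assumes adj: "adjunction L R \<eta> \<epsilon>" and R: "ftr_between D C R"
  shows "nt_between (id_ftr C) (R \<circ>\<^sub>F L) \<eta>"
    and "y \<in> Obj C \<Longrightarrow> Cmp \<eta> y \<in> hom C y (FOb R (FOb L y))"
    and "f \<in> hom C y y' \<Longrightarrow> Comp C (Cmp \<eta> y') f = Comp C (FAr R (FAr L f)) (Cmp \<eta> y)"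
proof -
  note L = adjunction_ftr[OF adj R]
  note C = ftr_betweenD(1)[OF L]
  show n: "nt_between (id_ftr C) (R \<circ>\<^sub>F L) \<eta>"
    using adj R by (auto simp: adjunction_def ftr_between_def)
  show "Cmp \<eta> y \<in> hom C y (FOb R (FOb L y))" if "y \<in> Obj C"
    using nt_hom[OF n id_ftr[OF C] that] that by (simp add: fcomp_ob[OF L])
  show "Comp C (Cmp \<eta> y') f = Comp C (FAr R (FAr L f)) (Cmp \<eta> y)" if "f \<in> hom C y y'"
    using nt_natural[OF n id_ftr[OF C] that] that by (simp add: fcomp_hom[OF L that])
qed

lemma adjunction_counit:
  assumes adj: "adjunction L R \<eta> \<epsilon>" and R: "ftr_between D C R"
  shows "nt_between (L \<circ>\<^sub>F R) (id_ftr D) \<epsilon>"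
    and "d \<in> Obj D \<Longrightarrow> Cmp \<epsilon> d \<in> hom D (FOb L (FOb R d)) d"
    and "f \<in> hom D d d' \<Longrightarrow> Comp D (Cmp \<epsilon> d') (FAr L (FAr R f)) = Comp D f (Cmp \<epsilon> d)"
proof -
  note L = adjunction_ftr[OF adj R]
  show n: "nt_between (L \<circ>\<^sub>F R) (id_ftr D) \<epsilon>"
    using adj R by (auto simp: adjunction_def ftr_between_def)
  show "Cmp \<epsilon> d \<in> hom D (FOb L (FOb R d)) d" if "d \<in> Obj D"
    using nt_hom[OF n fcomp[OF R L] that] that by (simp add: fcomp_ob[OF R])
  show "Comp D (Cmp \<epsilon> d') (FAr L (FAr R f)) = Comp D f (Cmp \<epsilon> d)" if "f \<in> hom D d d'"
    using nt_natural[OF n fcomp[OF R L] that] that by (simp add: fcomp_hom[OF R that])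
qed

lemma adjunction_triangles:
  assumes adj: "adjunction L R \<eta> \<epsilon>" and R: "ftr_between D C R"
  shows "y \<in> Obj C \<Longrightarrow> Comp D (Cmp \<epsilon> (FOb L y)) (FAr L (Cmp \<eta> y)) = Ident D (FOb L y)"
    and "d \<in> Obj D \<Longrightarrow> Comp C (FAr R (Cmp \<epsilon> d)) (Cmp \<eta> (FOb R d)) = Ident C (FOb R d)"
proof -
  note L = adjunction_ftr[OF adj R]
  note C = ftr_betweenD(1)[OF L] and D = ftr_betweenD(2)[OF L]
  note \<eta> = adjunction_unit(1)[OF adj R] and \<epsilon> = adjunction_counit(1)[OF adj R]
  show "Comp D (Cmp \<epsilon> (FOb L y)) (FAr L (Cmp \<eta> y)) = Ident D (FOb L y)" if y: "y \<in> Obj C"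
  proof -
    have "Cmp ((\<epsilon> \<star>\<^sub>r L) \<circ>\<^sub>v (L \<star>\<^sub>l \<eta>)) y = Cmp (id_nt L) y" using adj by (simp add: adjunction_def)
    then show ?thesis
      by (simp add: vcomp_cmp[OF whisker_left[OF \<eta> id_ftr[OF C] L] fcomp[OF id_ftr[OF C] L] y]
          whisker_left_cmp[OF \<eta> id_ftr[OF C] L y] whisker_right_cmp[OF \<epsilon> L fcomp[OF R L] y]
          id_nt_cmp[OF L y])
  qed
  show "Comp C (FAr R (Cmp \<epsilon> d)) (Cmp \<eta> (FOb R d)) = Ident C (FOb R d)" if d: "d \<in> Obj D"
  proof -
    have "Cmp ((R \<star>\<^sub>l \<epsilon>) \<circ>\<^sub>v (\<eta> \<star>\<^sub>r R)) d = Cmp (id_nt R) d" using adj by (simp add: adjunction_def)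
    then show ?thesis
      by (simp add: vcomp_cmp[OF whisker_right[OF \<eta> R id_ftr[OF C]] fcomp[OF R id_ftr[OF C]] d]
          whisker_left_cmp[OF \<epsilon> fcomp[OF R L] R d] whisker_right_cmp[OF \<eta> R id_ftr[OF C] d]
          id_nt_cmp[OF R d])
  qed
qed

lemma adjunct_right_left:
  assumes adj: "adjunction L R \<eta> \<epsilon>" and R: "ftr_between D C R"
    and y: "y \<in> Obj C" and h: "h \<in> hom D (FOb L y) d"
  shows "Comp D (Cmp \<epsilon> d) (FAr L (Comp C (FAr R h) (Cmp \<eta> y))) = h"
proof -
  note L = adjunction_ftr[OF adj R]
  note D = ftr_betweenD(2)[OF L]
  note d = hom_cod_in[OF D h]
  note \<eta> = adjunction_unit(2)[OF adj R y]
  have "Comp D (Cmp \<epsilon> d) (FAr L (Comp C (FAr R h) (Cmp \<eta> y))) =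
      Comp D (Comp D (Cmp \<epsilon> d) (FAr L (FAr R h))) (FAr L (Cmp \<eta> y))"
    using ftr_comp[OF L ftr_hom[OF R h] \<eta>]
      comp_assoc[OF D adjunction_counit(2)[OF adj R d] ftr_hom[OF L ftr_hom[OF R h]] ftr_hom[OF L \<eta>]] by simp
  also have "\<dots> = Comp D h (Comp D (Cmp \<epsilon> (FOb L y)) (FAr L (Cmp \<eta> y)))"
    using adjunction_counit(3)[OF adj R h]
      comp_assoc[OF D h adjunction_counit(2)[OF adj R ftr_ob[OF L y]] ftr_hom[OF L \<eta>]] by simp
  also have "\<dots> = h"
    using adjunction_triangles(1)[OF adj R y] comp_id_right[OF D h] by simp
  finally show ?thesis .
qed

lemma adjunct_left_right:
  assumes adj: "adjunction L R \<eta> \<epsilon>" and R: "ftr_between D C R"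
    and d: "d \<in> Obj D" and g: "g \<in> hom C y (FOb R d)"
  shows "Comp D (Cmp \<epsilon> d) (FAr L g) \<in> hom D (FOb L y) d"
    and "Comp C (FAr R (Comp D (Cmp \<epsilon> d) (FAr L g))) (Cmp \<eta> y) = g"
proof -
  note L = adjunction_ftr[OF adj R]
  note C = ftr_betweenD(1)[OF L] and D = ftr_betweenD(2)[OF L]
  note y = hom_dom_in[OF C g]
  note \<epsilon> = adjunction_counit(2)[OF adj R d]
  show "Comp D (Cmp \<epsilon> d) (FAr L g) \<in> hom D (FOb L y) d"
    by (rule comp_in_hom[OF D \<epsilon> ftr_hom[OF L g]])
  have "Comp C (FAr R (Comp D (Cmp \<epsilon> d) (FAr L g))) (Cmp \<eta> y) =
      Comp C (FAr R (Cmp \<epsilon> d)) (Comp C (FAr R (FAr L g)) (Cmp \<eta> y))"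
    using ftr_comp[OF R \<epsilon> ftr_hom[OF L g]]
      comp_assoc[OF C ftr_hom[OF R \<epsilon>] ftr_hom[OF R ftr_hom[OF L g]] adjunction_unit(2)[OF adj R y]] by simp
  also have "\<dots> = Comp C (Comp C (FAr R (Cmp \<epsilon> d)) (Cmp \<eta> (FOb R d))) g"
    using adjunction_unit(3)[OF adj R g]
      comp_assoc[OF C ftr_hom[OF R \<epsilon>] adjunction_unit(2)[OF adj R ftr_ob[OF R d]] g] by simp
  also have "\<dots> = g"
    using adjunction_triangles(2)[OF adj R d] comp_id_left[OF C g] by simp
  finally show "Comp C (FAr R (Comp D (Cmp \<epsilon> d) (FAr L g))) (Cmp \<eta> y) = g" .
qed

lemma adjunction_unit_universal:
  assumes adj: "adjunction L R \<eta> \<epsilon>" and R: "ftr_between D C R" and y: "y \<in> Obj C"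
  shows "universal_arrow D C R y (FOb L y) (Cmp \<eta> y)"
proof (rule universalI)
  note L = adjunction_ftr[OF adj R]
  note D = ftr_betweenD(2)[OF L]
  show "FOb L y \<in> Obj D" by (rule ftr_ob[OF L y])
  show "Cmp \<eta> y \<in> hom C y (FOb R (FOb L y))" by (rule adjunction_unit(2)[OF adj R y])
  fix d assume d: "d \<in> Obj D"
  show "\<exists>h\<in>hom D (FOb L y) d. \<forall>i\<in>{()}. Comp C (FAr R h) (Cmp \<eta> y) = f i"
    if f: "\<And>i. i \<in> {()} \<Longrightarrow> f i \<in> hom C y (FOb R d)" for f
    using adjunct_left_right[OF adj R d f[of "()"]] by auto
  show "h = h'" if h: "h \<in> hom D (FOb L y) d" and h': "h' \<in> hom D (FOb L y) d"
    and eq: "\<And>i. i \<in> {()} \<Longrightarrow> Comp C (FAr R h) (Cmp \<eta> y) = Comp C (FAr R h') (Cmp \<eta> y)" for h h'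
    by (rule trans[OF sym[OF adjunct_right_left[OF adj R y h, unfolded eq[OF singletonI]]]
          adjunct_right_left[OF adj R y h']])
qed

text \<open>
  The unit at \<open>y\<close> is universal, and the adjunct of \<open>g\<close> is the comparison from it to \<open>g\<close>.
\<close>

lemma universal_arrow_iff_adjunct_iso:
  assumes adj: "adjunction L R \<eta> \<epsilon>" and R: "ftr_between D C R"
    and d: "d \<in> Obj D" and g: "g \<in> hom C y (FOb R d)"
  shows "universal_arrow D C R y d g \<longleftrightarrow> iso D (Comp D (Cmp \<epsilon> d) (FAr L g))"
proof -
  note C = ftr_betweenD(2)[OF R] and D = ftr_betweenD(1)[OF R]
  note y = hom_dom_in[OF C g]
  show ?thesis
  proof (rule universal_square_source[OF D R adjunction_unit_universal[OF adj R y]])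
    show "Ident C y \<in> hom C y y" "iso C (Ident C y)"
      by (rule id_in_hom[OF C y], rule iso_ident[OF C y])
    show "Comp D (Cmp \<epsilon> d) (FAr L g) \<in> hom D (FOb L y) d"
      by (rule adjunct_left_right(1)[OF adj R d g])
    show "Comp C (FAr R (Comp D (Cmp \<epsilon> d) (FAr L g))) (Cmp \<eta> y) = Comp C g (Ident C y)"
      unfolding comp_id_right[OF C g] by (rule adjunct_left_right(2)[OF adj R d g])
  qed (rule g)
qed

lemma left_adjoint_preserves_coproducts:
  assumes adj: "adjunction L R \<eta> \<epsilon>" and R: "ftr_between D C R"
    and cop: "is_coproduct C I x c \<iota>"
  shows "is_coproduct D I (\<lambda>i. FOb L (x i)) (FOb L c) (\<lambda>i. FAr L (\<iota> i))"
proof -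
  note L = adjunction_ftr[OF adj R]
  note C = ftr_betweenD(1)[OF L] and D = ftr_betweenD(2)[OF L]
  note c = coproduct_ob[OF cop]
  note \<iota> = coproduct_hom[OF cop]
  have x: "x i \<in> Obj C" if "i \<in> I" for i using hom_dom_in[OF C \<iota>[OF that]] .
  note unit = adjunction_unit[OF adj R]
  have tr: "Comp C (FAr R (Comp D h (FAr L (\<iota> i)))) (Cmp \<eta> (x i)) =
      Comp C (Comp C (FAr R h) (Cmp \<eta> c)) (\<iota> i)"
    if h: "h \<in> hom D (FOb L c) d" and i: "i \<in> I" for h d i
  proof -
    note Li = ftr_hom[OF L \<iota>[OF i]]
    have "Comp C (FAr R (Comp D h (FAr L (\<iota> i)))) (Cmp \<eta> (x i)) =
        Comp C (FAr R h) (Comp C (FAr R (FAr L (\<iota> i))) (Cmp \<eta> (x i)))"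
      using ftr_comp[OF R h Li]
        comp_assoc[OF C ftr_hom[OF R h] ftr_hom[OF R Li] unit(2)[OF x[OF i]]] by simp
    also have "\<dots> = Comp C (Comp C (FAr R h) (Cmp \<eta> c)) (\<iota> i)"
      using unit(3)[OF \<iota>[OF i]] comp_assoc[OF C ftr_hom[OF R h] unit(2)[OF c] \<iota>[OF i]] by simp
    finally show ?thesis .
  qed
  show ?thesis
    unfolding is_coproduct_iff_universal[OF D]
  proof (rule universalI)
    show "FOb L c \<in> Obj D" by (rule ftr_ob[OF L c])
    show "FAr L (\<iota> i) \<in> hom D (FOb L (x i)) (FOb (id_ftr D) (FOb L c))" if "i \<in> I" for i
      using ftr_hom[OF L \<iota>[OF that]] ftr_ob[OF L c] by simp
    fix d assume d: "d \<in> Obj D"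
    show "\<exists>h\<in>hom D (FOb L c) d. \<forall>i\<in>I. Comp D (FAr (id_ftr D) h) (FAr L (\<iota> i)) = f i"
      if f': "\<And>i. i \<in> I \<Longrightarrow> f i \<in> hom D (FOb L (x i)) (FOb (id_ftr D) d)" for f
    proof -
      have f: "f i \<in> hom D (FOb L (x i)) d" if "i \<in> I" for i using f'[OF that] d by simp
      obtain k where k: "k \<in> hom C c (FOb R d)"
        "\<And>i. i \<in> I \<Longrightarrow> Comp C k (\<iota> i) = Comp C (FAr R (f i)) (Cmp \<eta> (x i))"
        using coproduct_factor[OF cop ftr_ob[OF R d], of "\<lambda>i. Comp C (FAr R (f i)) (Cmp \<eta> (x i))"]
          comp_in_hom[OF C ftr_hom[OF R f] unit(2)[OF x]] by blast
      define h where "h = Comp D (Cmp \<epsilon> d) (FAr L k)"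
      have h: "h \<in> hom D (FOb L c) d" "Comp C (FAr R h) (Cmp \<eta> c) = k"
        using adjunct_left_right[OF adj R d k(1)] by (simp_all add: h_def)
      have "Comp D h (FAr L (\<iota> i)) = f i" if i: "i \<in> I" for i
      proof -
        have "Comp D h (FAr L (\<iota> i)) =
            Comp D (Cmp \<epsilon> d) (FAr L (Comp C (FAr R (Comp D h (FAr L (\<iota> i)))) (Cmp \<eta> (x i))))"
          by (rule adjunct_right_left[OF adj R x[OF i] comp_in_hom[OF D h(1) ftr_hom[OF L \<iota>[OF i]]],
                symmetric])
        also have "\<dots> = Comp D (Cmp \<epsilon> d) (FAr L (Comp C (FAr R (f i)) (Cmp \<eta> (x i))))"
          unfolding tr[OF h(1) i] h(2) k(2)[OF i] ..
        also have "\<dots> = f i" by (rule adjunct_right_left[OF adj R x[OF i] f[OF i]])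
        finally show ?thesis .
      qed
      then show ?thesis using h(1) by auto
    qed
    show "h = h'" if h: "h \<in> hom D (FOb L c) d" and h': "h' \<in> hom D (FOb L c) d"
      and eq': "\<And>i. i \<in> I \<Longrightarrow> Comp D (FAr (id_ftr D) h) (FAr L (\<iota> i)) =
        Comp D (FAr (id_ftr D) h') (FAr L (\<iota> i))" for h h'
    proof -
      have eq: "Comp D h (FAr L (\<iota> i)) = Comp D h' (FAr L (\<iota> i))" if "i \<in> I" for i
        using eq'[OF that] h h' by simp
      have e: "Comp C (FAr R h) (Cmp \<eta> c) = Comp C (FAr R h') (Cmp \<eta> c)"
      proof (rule universal_eq[OF cop[unfolded is_coproduct_iff_universal[OF C]] id_ftr[OF C] C])
        show a: "Comp C (FAr R h) (Cmp \<eta> c) \<in> hom C c (FOb R d)"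
          by (rule comp_in_hom[OF C ftr_hom[OF R h] unit(2)[OF c]])
        show b: "Comp C (FAr R h') (Cmp \<eta> c) \<in> hom C c (FOb R d)"
          by (rule comp_in_hom[OF C ftr_hom[OF R h'] unit(2)[OF c]])
        show "Comp C (FAr (id_ftr C) (Comp C (FAr R h) (Cmp \<eta> c))) (\<iota> i) =
            Comp C (FAr (id_ftr C) (Comp C (FAr R h') (Cmp \<eta> c))) (\<iota> i)" if i: "i \<in> I" for i
          using tr[OF h i] tr[OF h' i] eq[OF i] id_ftr_simps(5)[OF a] id_ftr_simps(5)[OF b] by simp
      qed
      show ?thesis
        by (rule trans[OF sym[OF adjunct_right_left[OF adj R c h, unfolded e]]
              adjunct_right_left[OF adj R c h']])
    qed
  qed
qed

text \<open>
  The component of the mate at \<open>y\<close> is the adjunct of \<open>\<delta> \<circ> P \<eta>\<close>, so invertibility of the mate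
  says that these arrows are universal, a condition in which the chosen left adjoint \<open>L2\<close> no longer
  occurs. The mates of (Der4) and the mates that define preservation of Kan extensions both have this
  shape.
\<close>

lemma nat_iso_mate_iff:
  assumes adj1: "adjunction L1 R1 \<eta>1 \<epsilon>1" and R1: "ftr_between B1 A1 R1"
    and adj2: "adjunction L2 R2 \<eta>2 \<epsilon>2" and R2: "ftr_between B2 A2 R2"
    and P: "ftr_between A1 A2 P" and Q: "ftr_between B1 B2 Q"
    and \<delta>: "nt_between (P \<circ>\<^sub>F R1) (R2 \<circ>\<^sub>F Q) \<delta>"
  shows "nat_iso ((\<epsilon>2 \<star>\<^sub>r (Q \<circ>\<^sub>F L1)) \<circ>\<^sub>v (L2 \<star>\<^sub>l (\<delta> \<star>\<^sub>r L1)) \<circ>\<^sub>v ((L2 \<circ>\<^sub>F P) \<star>\<^sub>l \<eta>1)) \<longleftrightarrow>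
    (\<forall>y\<in>Obj A1. universal_arrow B2 A2 R2 (FOb P y) (FOb Q (FOb L1 y))
      (Comp A2 (Cmp \<delta> (FOb L1 y)) (FAr P (Cmp \<eta>1 y))))"
    (is "nat_iso (?e \<circ>\<^sub>v ?d \<circ>\<^sub>v ?n) \<longleftrightarrow> (\<forall>y\<in>Obj A1. ?U y)")
proof -
  note L1 = adjunction_ftr[OF adj1 R1] and L2 = adjunction_ftr[OF adj2 R2]
  note A1 = ftr_betweenD(1)[OF L1] and A2 = ftr_betweenD(1)[OF L2] and B2 = ftr_betweenD(2)[OF L2]
  note \<eta> = adjunction_unit(1)[OF adj1 R1] and \<epsilon> = adjunction_counit(1)[OF adj2 R2]
  note L2P = fcomp[OF P L2]
  have n: "nt_between (L2 \<circ>\<^sub>F P) ((L2 \<circ>\<^sub>F P) \<circ>\<^sub>F (R1 \<circ>\<^sub>F L1)) ?n"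
    using whisker_left[OF \<eta> id_ftr[OF A1] L2P] fcomp_id(2)[OF L2P] by simp
  have d: "nt_between ((L2 \<circ>\<^sub>F P) \<circ>\<^sub>F (R1 \<circ>\<^sub>F L1)) ((L2 \<circ>\<^sub>F R2) \<circ>\<^sub>F (Q \<circ>\<^sub>F L1)) ?d"
    using whisker_left[OF whisker_right[OF \<delta> L1 fcomp[OF R1 P]] fcomp[OF L1 fcomp[OF R1 P]] L2]
    by (simp add: fcomp_assoc[OF L1 R1 P] fcomp_assoc[OF L1 R1 L2P] fcomp_assoc[OF R1 P L2]
        fcomp_assoc[OF fcomp[OF L1 Q] R2 L2] fcomp_assoc[OF L1 Q R2]
        fcomp_assoc[OF L1 fcomp[OF R1 P] L2] fcomp_assoc[OF L1 fcomp[OF Q R2] L2]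
        fcomp_assoc[OF L1 Q fcomp[OF R2 L2]] fcomp_assoc[OF Q R2 L2])
  have e: "nt_between ((L2 \<circ>\<^sub>F R2) \<circ>\<^sub>F (Q \<circ>\<^sub>F L1)) (Q \<circ>\<^sub>F L1) ?e"
    using whisker_right[OF \<epsilon> fcomp[OF L1 Q] fcomp[OF R2 L2]] fcomp_id(1)[OF fcomp[OF L1 Q]] by simp
  note ed = vcomp[OF d e nt_ftr[OF n L2P]]
  note edn = vcomp[OF n ed L2P]
  have cmp: "Cmp (?e \<circ>\<^sub>v ?d \<circ>\<^sub>v ?n) y =
      Comp B2 (Cmp \<epsilon>2 (FOb Q (FOb L1 y))) (FAr L2 (Comp A2 (Cmp \<delta> (FOb L1 y)) (FAr P (Cmp \<eta>1 y))))"
    and g: "Comp A2 (Cmp \<delta> (FOb L1 y)) (FAr P (Cmp \<eta>1 y)) \<in> hom A2 (FOb P y) (FOb R2 (FOb Q (FOb L1 y)))"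
    if y: "y \<in> Obj A1" for y
  proof -
    note L1y = ftr_ob[OF L1 y]
    note hn = adjunction_unit(2)[OF adj1 R1 y]
    have hd: "Cmp \<delta> (FOb L1 y) \<in> hom A2 (FOb P (FOb R1 (FOb L1 y))) (FOb R2 (FOb Q (FOb L1 y)))"
      using nt_hom[OF \<delta> fcomp[OF R1 P] L1y] by (simp add: fcomp_ob[OF R1 L1y] fcomp_ob[OF Q L1y])
    show "Comp A2 (Cmp \<delta> (FOb L1 y)) (FAr P (Cmp \<eta>1 y)) \<in> hom A2 (FOb P y) (FOb R2 (FOb Q (FOb L1 y)))"
      by (rule comp_in_hom[OF A2 hd ftr_hom[OF P hn]])
    have "Cmp (?e \<circ>\<^sub>v ?d \<circ>\<^sub>v ?n) y = Comp B2 (Comp B2 (Cmp ?e y) (Cmp ?d y)) (Cmp ?n y)"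
      by (simp add: vcomp_cmp[OF n L2P y] vcomp_cmp[OF d nt_ftr[OF n L2P] y])
    also have "\<dots> = Comp B2 (Comp B2 (Cmp \<epsilon>2 (FOb Q (FOb L1 y))) (FAr L2 (Cmp \<delta> (FOb L1 y))))
        (FAr L2 (FAr P (Cmp \<eta>1 y)))"
      by (simp add: whisker_right_cmp[OF \<epsilon> fcomp[OF L1 Q] fcomp[OF R2 L2] y] fcomp_ob[OF L1 y]
          whisker_left_cmp[OF whisker_right[OF \<delta> L1 fcomp[OF R1 P]] fcomp[OF L1 fcomp[OF R1 P]] L2 y]
          whisker_right_cmp[OF \<delta> L1 fcomp[OF R1 P] y]
          whisker_left_cmp[OF \<eta> id_ftr[OF A1] L2P y] fcomp_hom[OF P hn])
    also have "\<dots> = Comp B2 (Cmp \<epsilon>2 (FOb Q (FOb L1 y)))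
        (FAr L2 (Comp A2 (Cmp \<delta> (FOb L1 y)) (FAr P (Cmp \<eta>1 y))))"
      using comp_assoc[OF B2 adjunction_counit(2)[OF adj2 R2 ftr_ob[OF Q L1y]] ftr_hom[OF L2 hd]
          ftr_hom[OF L2 ftr_hom[OF P hn]]] ftr_comp[OF L2 hd ftr_hom[OF P hn]] by simp
    finally show "Cmp (?e \<circ>\<^sub>v ?d \<circ>\<^sub>v ?n) y = Comp B2 (Cmp \<epsilon>2 (FOb Q (FOb L1 y)))
        (FAr L2 (Comp A2 (Cmp \<delta> (FOb L1 y)) (FAr P (Cmp \<eta>1 y))))" .
  qed
  have "nat_iso (?e \<circ>\<^sub>v ?d \<circ>\<^sub>v ?n) \<longleftrightarrow> (\<forall>y\<in>Obj A1. iso B2 (Cmp (?e \<circ>\<^sub>v ?d \<circ>\<^sub>v ?n) y))"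
    using edn L2P by (auto simp: nat_iso_def nt_between_def ftr_between_def)
  also have "\<dots> \<longleftrightarrow> (\<forall>y\<in>Obj A1. ?U y)"
    using cmp universal_arrow_iff_adjunct_iso[OF adj2 R2 ftr_ob[OF Q ftr_ob[OF L1]] g] by simp
  finally show ?thesis .
qed

section \<open>Equivalences of categories\<close>

lemma faithful_if_retraction:
  assumes K: "ftr_between C D K" and H: "ftr_between D C H"
    and \<alpha>: "nat_iso \<alpha>" "nt_between (id_ftr C) (H \<circ>\<^sub>F K) \<alpha>"
    and f: "f \<in> hom C x y" and g: "g \<in> hom C x y" and eq: "FAr K f = FAr K g"
  shows "f = g"
proof -
  note C = ftr_betweenD(1)[OF K]
  note y = hom_cod_in[OF C f]
  have *: "Comp C (Cmp \<alpha> y) h = Comp C (FAr H (FAr K h)) (Cmp \<alpha> x)" if "h \<in> hom C x y" for h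
    using nt_natural[OF \<alpha>(2) id_ftr[OF C] that] that by (simp add: fcomp_hom[OF K that])
  have "Cmp \<alpha> y \<in> hom C y (FOb H (FOb K y))"
    using nt_hom[OF \<alpha>(2) id_ftr[OF C] y] y by (simp add: fcomp_ob[OF K y])
  from iso_comp_cancel[OF C this nat_iso_cmp[OF \<alpha> id_ftr[OF C] y] f g] *[OF f] *[OF g] eq
  show ?thesis by simp
qed

lemma inv_nt_nat_iso:
  assumes i: "nat_iso \<alpha>" and \<alpha>: "nt_between F G \<alpha>" and F: "ftr_between C D F"
  shows "nat_iso (inv_nt \<alpha>)"
proof -
  note D = ftr_betweenD(2)[OF F] and G = nt_ftr[OF \<alpha> F]
  note n = inv_nt[OF i \<alpha> F]
  have "iso D (Cmp (inv_nt \<alpha>) a)" if a: "a \<in> Obj C" for a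
    using iso_inv_arr[OF D nat_iso_cmp[OF i \<alpha> F a] nt_hom[OF \<alpha> F a]]
    by (simp add: inv_nt_cmp[OF \<alpha> F a])
  then show ?thesis using n G by (auto simp: nat_iso_def nt_between_def ftr_between_def)
qed

lemma equivalence_ftr_properties:
  assumes eq: "equivalence_ftr K" and K: "ftr_between C D K"
  shows equivalence_faithful:
      "f \<in> hom C x y \<Longrightarrow> g \<in> hom C x y \<Longrightarrow> FAr K f = FAr K g \<Longrightarrow> f = g"
    and equivalence_full:
      "x \<in> Obj C \<Longrightarrow> y \<in> Obj C \<Longrightarrow> k \<in> hom D (FOb K x) (FOb K y) \<Longrightarrow> \<exists>f\<in>hom C x y. FAr K f = k"
    and equivalence_surj: "d \<in> Obj D \<Longrightarrow> \<exists>x\<in>Obj C. \<exists>a\<in>hom D (FOb K x) d. iso D a"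
proof -
  note C = ftr_betweenD(1)[OF K] and D = ftr_betweenD(2)[OF K]
  obtain H \<alpha> \<beta> where H: "ftr_between D C H" and \<alpha>: "nat_iso \<alpha>" "nt_between (id_ftr C) (H \<circ>\<^sub>F K) \<alpha>"
    and \<beta>: "nat_iso \<beta>" "nt_between (K \<circ>\<^sub>F H) (id_ftr D) \<beta>"
    using eq K unfolding equivalence_ftr_def nt_between_def nat_iso_def ftr_between_def by auto
  have \<beta>': "nat_iso (inv_nt \<beta>)" "nt_between (id_ftr D) (K \<circ>\<^sub>F H) (inv_nt \<beta>)"
    using inv_nt[OF \<beta> fcomp[OF H K]] inv_nt_nat_iso[OF \<beta> fcomp[OF H K]] by simp_all
  show "f = g" if "f \<in> hom C x y" "g \<in> hom C x y" "FAr K f = FAr K g" for f g x y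
    by (rule faithful_if_retraction[OF K H \<alpha> that])
  show "\<exists>f\<in>hom C x y. FAr K f = k"
    if x: "x \<in> Obj C" and y: "y \<in> Obj C" and k: "k \<in> hom D (FOb K x) (FOb K y)" for x y k
  proof -
    have ax: "Cmp \<alpha> x \<in> hom C x (FOb H (FOb K x))" and ay: "Cmp \<alpha> y \<in> hom C y (FOb H (FOb K y))"
      using nt_hom[OF \<alpha>(2) id_ftr[OF C]] x y by (simp_all add: fcomp_ob[OF K])
    note ix = nat_iso_cmp[OF \<alpha> id_ftr[OF C] x] and iy = nat_iso_cmp[OF \<alpha> id_ftr[OF C] y]
    note ay' = inv_arr[OF C iy ay]
    note Hk = ftr_hom[OF H k]
    note Hka = comp_in_hom[OF C Hk ax]
    define f where "f = Comp C (inv_arr C (Cmp \<alpha> y)) (Comp C (FAr H k) (Cmp \<alpha> x))"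
    have f: "f \<in> hom C x y" unfolding f_def by (rule comp_in_hom[OF C ay'(1) Hka])
    have "Comp C (Cmp \<alpha> y) f = Comp C (FAr H k) (Cmp \<alpha> x)"
      unfolding f_def comp_assoc[OF C ay ay'(1) Hka] ay'(3) by (rule comp_id_left[OF C Hka])
    moreover have "Comp C (Cmp \<alpha> y) f = Comp C (FAr H (FAr K f)) (Cmp \<alpha> x)"
      using nt_natural[OF \<alpha>(2) id_ftr[OF C] f] f by (simp add: fcomp_hom[OF K f])
    ultimately have e: "Comp C (FAr H k) (Cmp \<alpha> x) = Comp C (FAr H (FAr K f)) (Cmp \<alpha> x)" by simp
    note HKf = ftr_hom[OF H ftr_hom[OF K f]]
    obtain a' where a': "a' \<in> hom C (FOb H (FOb K x)) x" "Comp C (Cmp \<alpha> x) a' = Ident C (FOb H (FOb K x))"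
      using isoE[OF ix ax] by metis
    have "FAr H k = FAr H (FAr K f)"
      using comp_assoc[OF C Hk ax a'(1)] comp_assoc[OF C HKf ax a'(1)] e a'(2)
        comp_id_right[OF C Hk] comp_id_right[OF C HKf] by simp
    then have "k = FAr K f"
      by (rule faithful_if_retraction[OF H K \<beta>' k ftr_hom[OF K f]])
    then show ?thesis using f by auto
  qed
  show "\<exists>x\<in>Obj C. \<exists>a\<in>hom D (FOb K x) d. iso D a" if d: "d \<in> Obj D" for d
    using nt_hom[OF \<beta>(2) fcomp[OF H K] d] nat_iso_cmp[OF \<beta> fcomp[OF H K] d] ftr_ob[OF H d] d
    by (auto simp: fcomp_ob[OF H d])
qed

section \<open>Small sets and codes\<close>

lemma card_of_finite_less_infinite:
  assumes "infinite (UNIV :: 'u set)" "finite X"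
  shows "|X| <o |UNIV :: 'u set|"
proof -
  have "\<not> |UNIV :: 'u set| \<le>o |X|"
    using assms card_of_ordLeq_finite by blast
  then show ?thesis
    using not_ordLeq_iff_ordLess[OF card_of_Well_order card_of_Well_order] by blast
qed

lemma card_of_image_less: "|X| <o r \<Longrightarrow> |f ` X| <o r"
  using card_of_image ordLeq_ordLess_trans by blast

lemma card_of_times_less:
  assumes U: "infinite (UNIV :: 'u set)" and X: "|X| <o |UNIV :: 'u set|" and Y: "|Y| <o |UNIV :: 'u set|"
  shows "|X \<times> Y| <o |UNIV :: 'u set|"
proof (cases "finite (X <+> Y)")
  case True
  then show ?thesis using card_of_finite_less_infinite[OF U, of "X \<times> Y"] finite_PlusD by blast
next
  case False
  have "|X \<times> Y| \<le>o |X <+> Y|"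
    by (rule card_of_Times_ordLeq_infinite_Field)
      (use False card_of_Plus1[of X Y] card_of_Plus2[of Y X] in \<open>auto simp: Field_card_of card_of_card_order_on\<close>)
  then show ?thesis
    using card_of_Plus_ordLess_infinite[OF U X Y] ordLeq_ordLess_trans by blast
qed

text \<open>
  An infinite set absorbs finite sums, products and added points, so the types on which slices,
  cocones and coproducts live really do embed into \<open>'u\<close>.
\<close>

lemma inj_code:
  assumes "infinite (UNIV :: 'u set)"
  shows "inj (code :: 'u \<times> 'u \<Rightarrow> 'u)" "inj (code :: 'u option \<Rightarrow> 'u)"
    "inj (code :: 'u + 'u option \<Rightarrow> 'u)"
proof -
  have "|UNIV :: ('u \<times> 'u) set| \<le>o |UNIV :: 'u set|"
    using ordIso_imp_ordLeq[OF card_of_Times_same_infinite[OF assms]] by simp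
  then obtain p :: "'u \<times> 'u \<Rightarrow> 'u" where p: "inj p"
    using card_of_ordLeq[of "UNIV :: ('u \<times> 'u) set" "UNIV :: 'u set"] by auto
  obtain a b :: 'u where ab: "a \<noteq> b"
    using ex_new_if_finite[OF assms, of "{undefined}"] by auto
  have px: "p x = p y \<longleftrightarrow> x = y" for x y using p by (simp add: inj_eq)
  define o' where "o' x = (case x of None \<Rightarrow> p (a, a) | Some y \<Rightarrow> p (b, y))" for x
  have o: "inj o'" using ab by (auto intro!: injI simp: o'_def px split: option.splits)
  define s where "s x = (case x of Inl y \<Rightarrow> p (a, y) | Inr z \<Rightarrow> p (b, o' z))" for x
  have s: "inj s" using ab o by (auto intro!: injI simp: s_def px inj_eq split: sum.splits)
  show "inj (code :: 'u \<times> 'u \<Rightarrow> 'u)" unfolding code_def by (rule someI[of inj, OF p])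
  show "inj (code :: 'u option \<Rightarrow> 'u)" unfolding code_def by (rule someI[of inj, OF o])
  show "inj (code :: 'u + 'u option \<Rightarrow> 'u)" unfolding code_def by (rule someI[of inj, OF s])
qed

lemma encode_simps:
  assumes "inj (code :: 'x \<Rightarrow> 'u)" "inj (code :: 'y \<Rightarrow> 'u)"
  shows "Obj (encode C :: ('u, 'u) cat) = code ` Obj (C :: ('x, 'y) cat)"
    and "Arr (encode C :: ('u, 'u) cat) = code ` Arr C"
    and "f \<in> Arr C \<Longrightarrow> Dom (encode C :: ('u, 'u) cat) (code f) = code (Dom C f)"
    and "f \<in> Arr C \<Longrightarrow> Cod (encode C :: ('u, 'u) cat) (code f) = code (Cod C f)"
    and "a \<in> Obj C \<Longrightarrow> Ident (encode C :: ('u, 'u) cat) (code a) = code (Ident C a)"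
    and "f \<in> Arr C \<Longrightarrow> g \<in> Arr C \<Longrightarrow> Dom C g = Cod C f \<Longrightarrow>
      Comp (encode C :: ('u, 'u) cat) (code g) (code f) = code (Comp C g f)"
  using assms by (auto simp: encode_def inj_image_mem_iff)

lemma category_encode:
  assumes x: "inj (code :: 'x \<Rightarrow> 'u)" and y: "inj (code :: 'y \<Rightarrow> 'u)"
    and C: "category (C :: ('x, 'y) cat)"
  shows "category (encode C :: ('u, 'u) cat)"
proof -
  note S = encode_simps[OF x y]
  have cx: "code a = (code b :: 'u) \<longleftrightarrow> a = b" for a b :: 'x using x by (simp add: inj_eq)
  note F = category_arr[OF C]
  show ?thesis
    unfolding category_def
  proof (intro conjI)
    show "Dom (encode C) \<in> Arr (encode C) \<rightarrow>\<^sub>E Obj (encode C :: ('u, 'u) cat)"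
      "Cod (encode C) \<in> Arr (encode C) \<rightarrow>\<^sub>E Obj (encode C :: ('u, 'u) cat)"
      using x y F(1,2) by (auto simp: encode_def)
    show "Ident (encode C :: ('u, 'u) cat) \<in> extensional (Obj (encode C :: ('u, 'u) cat))"
      by (simp add: encode_def)
    show "\<forall>g f. \<not> (g \<in> Arr (encode C) \<and> f \<in> Arr (encode C) \<and> Dom (encode C) g = Cod (encode C) f) \<longrightarrow>
        Comp (encode C :: ('u, 'u) cat) g f = undefined"
      using x y by (auto simp: encode_def)
  qed (auto simp: S cx hom_def F)
qed

lemma encode_ftr_ftr:
  assumes x: "inj (code :: 'x \<Rightarrow> 'u)" and y: "inj (code :: 'y \<Rightarrow> 'u)"
    and C: "category (C :: ('x, 'y) cat)"
  shows "ftr_between C (encode C :: ('u, 'u) cat) (encode_ftr C)"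
proof (rule ftr_betweenI[OF C category_encode[OF x y C]])
  note S = encode_simps[OF x y]
  show "FAr (encode_ftr C) f \<in> hom (encode C :: ('u, 'u) cat) (FOb (encode_ftr C) a) (FOb (encode_ftr C) b)"
    if "f \<in> hom C a b" for a b f
    using that hom_dom_in[OF C that] hom_cod_in[OF C that] by (auto simp: encode_ftr_def S hom_def)
  show "FAr (encode_ftr C) (Ident C a) = Ident (encode C :: ('u, 'u) cat) (FOb (encode_ftr C) a)"
    if "a \<in> Obj C" for a
    using that id_in_hom[OF C that] by (auto simp: encode_ftr_def S hom_def)
  show "FAr (encode_ftr C) (Comp C g f) =
      Comp (encode C :: ('u, 'u) cat) (FAr (encode_ftr C) g) (FAr (encode_ftr C) f)"
    if "g \<in> hom C b c" "f \<in> hom C a b" for a b c f g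
    using that comp_in_hom[OF C that] by (auto simp: encode_ftr_def S hom_def)
qed (auto simp: encode_ftr_def encode_simps[OF x y])

lemma decode_ftr_ftr:
  assumes x: "inj (code :: 'x \<Rightarrow> 'u)" and y: "inj (code :: 'y \<Rightarrow> 'u)"
    and C: "category (C :: ('x, 'y) cat)"
  shows "ftr_between (encode C :: ('u, 'u) cat) C (decode_ftr C)"
    and "decode_ftr C \<circ>\<^sub>F (encode_ftr C :: ('x, 'y, 'u, 'u) ftr) = id_ftr C"
proof -
  note S = encode_simps[OF x y]
  have cx: "code a = (code b :: 'u) \<longleftrightarrow> a = b" for a b :: 'x using x by (simp add: inj_eq)
  have e: "\<exists>f'\<in>hom C a' b'. f = code f'" if "f \<in> hom (encode C :: ('u, 'u) cat) a b"
    "a = code a'" "b = code b'" for f a b a' b'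
    using that by (auto simp: S hom_def cx)
  have ob: "\<exists>a'\<in>Obj C. a = code a'" if "a \<in> Obj (encode C :: ('u, 'u) cat)" for a
    using that by (auto simp: S)
  note E = category_encode[OF x y C]
  have D: "FAr (decode_ftr C) (code f :: 'u) = f" if "f \<in> hom C a b" for f a b
    using that y by (simp add: decode_ftr_def hom_def)
  have DO: "FOb (decode_ftr C) (code a :: 'u) = a" if "a \<in> Obj C" for a
    using that x by (simp add: decode_ftr_def)
  show dec: "ftr_between (encode C :: ('u, 'u) cat) C (decode_ftr C)"
  proof (rule ftr_betweenI[OF E C])
    show "FAr (decode_ftr C) f \<in> hom C (FOb (decode_ftr C) a) (FOb (decode_ftr C) b)"
      if f: "f \<in> hom (encode C :: ('u, 'u) cat) a b" for a b f
    proof -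
      obtain a' b' where a': "a' \<in> Obj C" "a = code a'" and b': "b' \<in> Obj C" "b = code b'"
        using ob hom_dom_in[OF E f] hom_cod_in[OF E f] by metis
      obtain f' where f': "f' \<in> hom C a' b'" "f = code f'" using e[OF f a'(2) b'(2)] by auto
      show ?thesis unfolding a'(2) b'(2) f'(2) D[OF f'(1)] DO[OF a'(1)] DO[OF b'(1)] by (rule f'(1))
    qed
    show "FAr (decode_ftr C) (Ident (encode C :: ('u, 'u) cat) a) = Ident C (FOb (decode_ftr C) a)"
      if a: "a \<in> Obj (encode C :: ('u, 'u) cat)" for a
    proof -
      obtain a' where a': "a' \<in> Obj C" "a = code a'" using ob a by metis
      show ?thesis unfolding a'(2) S(5)[OF a'(1)] D[OF id_in_hom[OF C a'(1)]] DO[OF a'(1)] ..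
    qed
    show "FAr (decode_ftr C) (Comp (encode C :: ('u, 'u) cat) g f) =
        Comp C (FAr (decode_ftr C) g) (FAr (decode_ftr C) f)"
      if g: "g \<in> hom (encode C :: ('u, 'u) cat) b c" and f: "f \<in> hom (encode C :: ('u, 'u) cat) a b"
      for a b c f g
    proof -
      obtain a' b' c' where a': "a' \<in> Obj C" "a = code a'" and b': "b' \<in> Obj C" "b = code b'"
        and c': "c' \<in> Obj C" "c = code c'"
        using ob hom_dom_in[OF E f] hom_cod_in[OF E f] hom_cod_in[OF E g] by metis
      obtain f' where f': "f' \<in> hom C a' b'" "f = code f'" using e[OF f a'(2) b'(2)] by auto
      obtain g' where g': "g' \<in> hom C b' c'" "g = code g'" using e[OF g b'(2) c'(2)] by auto
      have "Comp (encode C :: ('u, 'u) cat) g f = code (Comp C g' f')"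
        using S(6)[of f' C g'] f' g' by (simp add: hom_def)
      then show ?thesis
        unfolding f'(2) g'(2) D[OF f'(1)] D[OF g'(1)] by (simp add: D[OF comp_in_hom[OF C g'(1) f'(1)]])
    qed
  qed (use x y in \<open>auto simp: decode_ftr_def S\<close>)
  note enc = encode_ftr_ftr[OF x y C]
  show "decode_ftr C \<circ>\<^sub>F (encode_ftr C :: ('x, 'y, 'u, 'u) ftr) = id_ftr C"
    by (rule ftr_eqI[OF fcomp[OF enc dec] id_ftr[OF C]])
      (use x y in \<open>auto simp: fcomp_def encode_ftr_def decode_ftr_def compose_def id_ftr_def\<close>)
qed

lemma small_cat_encode:
  fixes C :: "('x, 'y) cat"
  assumes x: "inj (code :: 'x \<Rightarrow> 'u)" and y: "inj (code :: 'y \<Rightarrow> 'u)" and C: "category C"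
    and "|Obj C| <o |UNIV :: 'u set|" "|Arr C| <o |UNIV :: 'u set|"
  shows "small_cat (encode C :: ('u, 'u) cat)"
  using category_encode[OF x y C] assms(4,5)
  by (simp add: small_cat_def small_set_def encode_simps[OF x y] card_of_image_less)

section \<open>The terminal category and terminal objects\<close>

lemma category_one: "category one"
  by (auto simp: category_def one_def hom_def)

lemma small_cat_one: "infinite (UNIV :: 'u set) \<Longrightarrow> small_cat (one :: ('u, 'u) cat)"
  using card_of_finite_less_infinite[of "{undefined} :: 'u set"]
  by (simp add: small_cat_def small_set_def category_one) (simp add: one_def)

lemma one_simps: "Obj one = {undefined}" "Arr one = {undefined}"
  "Dom one f = undefined" "Cod one f = undefined" "Ident one a = undefined" "Comp one g f = undefined"
  by (simp_all add: one_def)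

lemma to_one_ftr: "category A \<Longrightarrow> ftr_between A one (to_one A)"
  by (rule ftr_betweenI) (auto simp: to_one_def category_one one_simps hom_def extensional_def)

lemma to_one_unique:
  assumes F: "ftr_between A one F"
  shows "F = to_one A"
proof (rule ftr_eqI[OF F to_one_ftr[OF ftr_betweenD(1)[OF F]]])
  show "FOb F a = FOb (to_one A) a" if "a \<in> Obj A" for a
    using ftr_ob[OF F that] by (simp add: one_simps to_one_def)
  show "FAr F f = FAr (to_one A) f" if "f \<in> Arr A" for f
    using ftr_hom[OF F arr_in_hom[OF that]] by (simp add: one_simps to_one_def hom_def)
qed

lemma pick_ftr:
  assumes A: "category A" and a: "a \<in> Obj A"
  shows "ftr_between one A (pick A a)"
proof (rule ftr_betweenI[OF category_one A])
  note ida = id_in_hom[OF A a]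
  show "FAr (pick A a) (Comp one g f) = Comp A (FAr (pick A a) g) (FAr (pick A a) f)"
    if "g \<in> hom one y z" "f \<in> hom one x y" for f g x y z
    using that comp_id_left[OF A ida] by (simp add: pick_def one_def hom_def)
qed (use a id_in_hom[OF A a] in \<open>auto simp: pick_def one_simps hom_def\<close>)

lemma pick_ob [simp]: "FOb (pick A a) undefined = a"
  by (simp add: pick_def one_simps)

lemma pick_unique:
  assumes F: "ftr_between one A F"
  shows "F = pick A (FOb F undefined)"
proof -
  have u: "undefined \<in> Obj one" by (simp add: one_simps)
  show ?thesis
    by (rule ftr_eqI[OF F pick_ftr[OF ftr_betweenD(2)[OF F] ftr_ob[OF F u]]])
      (use ftr_ident[OF F u] in \<open>auto simp: one_simps pick_def\<close>)
qed

lemma to_one_fcomp: "ftr_between A B u \<Longrightarrow> to_one B \<circ>\<^sub>F u = to_one A"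
  by (rule to_one_unique) (rule fcomp, assumption, rule to_one_ftr, rule ftr_betweenD(2))

lemma fcomp_pick:
  assumes u: "ftr_between A B u" and a: "a \<in> Obj A"
  shows "u \<circ>\<^sub>F pick A a = (pick B (FOb u a) :: ('u, 'u, 'o, 'm) ftr)"
proof -
  have p: "ftr_between (one :: ('u, 'u) cat) A (pick A a)"
    by (rule pick_ftr[OF ftr_betweenD(1)[OF u] a])
  have "FOb (u \<circ>\<^sub>F pick A a :: ('u, 'u, 'o, 'm) ftr) undefined = FOb u a"
    using fcomp_ob[OF p, of undefined u] by (simp add: one_simps)
  then show ?thesis using pick_unique[OF fcomp[OF p u]] by simp
qed

lemma to_one_pick:
  assumes A: "category A" and a: "a \<in> Obj A"
  shows "to_one A \<circ>\<^sub>F pick A a = (id_ftr one :: ('u, 'u, 'u, 'u) ftr)"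
proof -
  have "ftr_between one one (to_one A \<circ>\<^sub>F pick A a :: ('u, 'u, 'u, 'u) ftr)"
    by (rule fcomp[OF pick_ftr[OF assms] to_one_ftr[OF A]])
  then have "to_one A \<circ>\<^sub>F pick A a = (to_one one :: ('u, 'u, 'u, 'u) ftr)" by (rule to_one_unique)
  also have "\<dots> = id_ftr one" by (rule to_one_unique[OF id_ftr[OF category_one], symmetric])
  finally show ?thesis .
qed

lemma nt_eqI:
  assumes "nt_between F G \<alpha>" "nt_between F G \<beta>" "ftr_between C D F"
    and "\<And>a. a \<in> Obj C \<Longrightarrow> Cmp \<alpha> a = Cmp \<beta> a"
  shows "\<alpha> = \<beta>"
proof -
  have "Cmp \<alpha> = Cmp \<beta>"
    using assms by (intro extensionalityI[of _ "Obj C"])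
      (auto simp: nt_between_def is_nt_def ftr_between_def Let_def)
  then show ?thesis using assms by (auto simp: nt_between_def)
qed

text \<open>
  A terminal object is a right adjoint of the functor to the terminal category. This is the unit of
  that adjunction, whose counit is an identity.
\<close>

definition to_terminal :: "('u, 'u) cat \<Rightarrow> 'u \<Rightarrow> ('u, 'u, 'u, 'u) nt" where
  "to_terminal C z = \<lparr>NSrc = id_ftr C, NTgt = pick C z \<circ>\<^sub>F (to_one C :: ('u, 'u, 'u, 'u) ftr),
     Cmp = (\<lambda>x\<in>Obj C. THE f. f \<in> hom C x z)\<rparr>"

text \<open>
  The second and third statement are the triangle identities. Being equations between
  transformations, they survive the application of a prederivator, which is why evaluation at a
  terminal object becomes left adjoint to restriction along the functor to the point.
\<close>

lemma to_terminal:
  fixes C :: "('u, 'u) cat"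
  assumes C: "category C" and z: "z \<in> Obj C" and fin: "\<And>x. x \<in> Obj C \<Longrightarrow> \<exists>!f. f \<in> hom C x z"
  shows "nt_between (id_ftr C) (pick C z \<circ>\<^sub>F (to_one C :: ('u, 'u, 'u, 'u) ftr)) (to_terminal C z)"
    and "to_one C \<star>\<^sub>l to_terminal C z = id_nt (to_one C :: ('u, 'u, 'u, 'u) ftr)"
    and "to_terminal C z \<star>\<^sub>r pick C z = id_nt (pick C z :: ('u, 'u, 'u, 'u) ftr)"
proof -
  let ?t = "to_one C :: ('u, 'u, 'u, 'u) ftr"
  let ?p = "pick C z :: ('u, 'u, 'u, 'u) ftr"
  have p: "ftr_between (one :: ('u, 'u) cat) C (?p)" by (rule pick_ftr[OF C z])
  have t: "ftr_between C one ?t" by (rule to_one_ftr[OF C])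
  note pt = fcomp[OF t p] and I = id_ftr[OF C]
  have ptO: "FOb (?p \<circ>\<^sub>F ?t) x = z" if "x \<in> Obj C" for x
    using fcomp_ob[OF t that, of "?p"] by (simp add: to_one_def)
  have ptA: "FAr (?p \<circ>\<^sub>F ?t) f = Ident C z" if "f \<in> hom C x y" for x y f
    using fcomp_hom[OF t that, of "?p"] by (simp add: to_one_def pick_def one_simps)
  have T: "Cmp (to_terminal C z) x \<in> hom C x z" if "x \<in> Obj C" for x
    using theI'[OF fin[OF that]] that by (simp add: to_terminal_def)
  have uniq: "f = g" if "f \<in> hom C x z" "g \<in> hom C x z" for f g x
    using fin[OF hom_dom_in[OF C that(1)]] that by blast
  show n: "nt_between (id_ftr C) (?p \<circ>\<^sub>F ?t) (to_terminal C z)"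
  proof (rule nt_betweenI[OF I pt])
    show "Cmp (to_terminal C z) a \<in> hom C (FOb (id_ftr C) a) (FOb (?p \<circ>\<^sub>F ?t) a)"
      if "a \<in> Obj C" for a
      using T[OF that] that by (simp add: ptO)
    show "Comp C (Cmp (to_terminal C z) b) (FAr (id_ftr C) f) =
        Comp C (FAr (?p \<circ>\<^sub>F ?t) f) (Cmp (to_terminal C z) a)" if f: "f \<in> hom C a b" for a b f
    proof (rule uniq)
      show "Comp C (Cmp (to_terminal C z) b) (FAr (id_ftr C) f) \<in> hom C a z"
        using comp_in_hom[OF C T[OF hom_cod_in[OF C f]] f] f by simp
      show "Comp C (FAr (?p \<circ>\<^sub>F ?t) f) (Cmp (to_terminal C z) a) \<in> hom C a z"
        unfolding ptA[OF f] by (rule comp_in_hom[OF C id_in_hom[OF C z] T[OF hom_dom_in[OF C f]]])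
    qed
  qed (auto simp: to_terminal_def)
  have tpt: "?t \<circ>\<^sub>F (?p \<circ>\<^sub>F ?t) = ?t" by (rule to_one_unique[OF fcomp[OF pt t]])
  show "?t \<star>\<^sub>l to_terminal C z = id_nt ?t"
  proof (rule nt_eqI[OF _ id_nt[OF t] t])
    show w: "nt_between ?t ?t (?t \<star>\<^sub>l to_terminal C z)"
      using whisker_left[OF n I t] fcomp_id(2)[OF t] tpt by simp
    show "Cmp (?t \<star>\<^sub>l to_terminal C z) a = Cmp (id_nt ?t) a" if "a \<in> Obj C" for a
      using nt_hom[OF w t that] nt_hom[OF id_nt[OF t] t that] by (simp add: hom_def one_simps)
  qed
  have ptp: "(?p \<circ>\<^sub>F ?t) \<circ>\<^sub>F ?p = ?p"
    using fcomp_pick[OF pt z] ptO[OF z] by simp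
  show "to_terminal C z \<star>\<^sub>r ?p = id_nt ?p"
  proof (rule nt_eqI[OF _ id_nt[OF p] p])
    show w: "nt_between (?p) (?p) (to_terminal C z \<star>\<^sub>r ?p)"
      using whisker_right[OF n p I] fcomp_id(1)[OF p] ptp by simp
    show "Cmp (to_terminal C z \<star>\<^sub>r ?p) a = Cmp (id_nt (?p)) a" if "a \<in> Obj one" for a
      using nt_hom[OF w p that] nt_hom[OF id_nt[OF p] p that] uniq that by (simp add: one_simps)
  qed
qed

section \<open>Cocones\<close>

lemma cocone_simps:
  "Obj (cocone_cat A) = insert None (Some ` Obj A)"
  "Arr (cocone_cat A) = Inl ` Arr A \<union> Inr ` insert None (Some ` Obj A)"
  "f \<in> Arr A \<Longrightarrow> Dom (cocone_cat A) (Inl f) = Some (Dom A f)"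
  "f \<in> Arr A \<Longrightarrow> Cod (cocone_cat A) (Inl f) = Some (Cod A f)"
  "x \<in> insert None (Some ` Obj A) \<Longrightarrow> Dom (cocone_cat A) (Inr x) = x"
  "x \<in> insert None (Some ` Obj A) \<Longrightarrow> Cod (cocone_cat A) (Inr x) = None"
  "a \<in> Obj A \<Longrightarrow> Ident (cocone_cat A) (Some a) = Inl (Ident A a)"
  "Ident (cocone_cat A) None = Inr None"
  "f \<in> Arr A \<Longrightarrow> g \<in> Arr A \<Longrightarrow> Dom A g = Cod A f \<Longrightarrow>
     Comp (cocone_cat A) (Inl g) (Inl f) = Inl (Comp A g f)"
  "f \<in> Arr A \<Longrightarrow> Cod A f \<in> Obj A \<Longrightarrow>
     Comp (cocone_cat A) (Inr (Some (Cod A f))) (Inl f) = Inr (Some (Dom A f))"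
  "x \<in> insert None (Some ` Obj A) \<Longrightarrow> Comp (cocone_cat A) (Inr None) (Inr x) = Inr x"
  by (auto simp: cocone_cat_def Let_def)

lemma category_cocone:
  assumes A: "category A"
  shows "category (cocone_cat A)"
proof -
  note S = cocone_simps
  note F = category_arr[OF A]
  have S10: "Comp (cocone_cat A) (Inr (Some a)) (Inl f) = Inr (Some (Dom A f))"
    if "f \<in> Arr A" "a = Cod A f" for f a
    using S(10)[OF that(1) F(2)[OF that(1)]] that(2) by simp
  show ?thesis
    unfolding category_def
  proof (intro conjI)
    show "Dom (cocone_cat A) \<in> Arr (cocone_cat A) \<rightarrow>\<^sub>E Obj (cocone_cat A)"
      "Cod (cocone_cat A) \<in> Arr (cocone_cat A) \<rightarrow>\<^sub>E Obj (cocone_cat A)"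
      using F(1,2) by (auto simp: cocone_cat_def Let_def)
    show "Ident (cocone_cat A) \<in> extensional (Obj (cocone_cat A))"
      by (simp add: cocone_cat_def Let_def)
    show "\<forall>g f. \<not> (g \<in> Arr (cocone_cat A) \<and> f \<in> Arr (cocone_cat A) \<and>
        Dom (cocone_cat A) g = Cod (cocone_cat A) f) \<longrightarrow> Comp (cocone_cat A) g f = undefined"
      by (auto simp: cocone_cat_def Let_def)
    show "\<forall>a\<in>Obj (cocone_cat A). Ident (cocone_cat A) a \<in> hom (cocone_cat A) a a"
      using F by (auto simp: hom_def S)
  qed (auto simp: S S10 hom_def F)
qed

lemma cocone_incl:
  assumes A: "category A"
  shows "ftr_between A (cocone_cat A) (cocone_incl A)"
proof (rule ftr_betweenI[OF A category_cocone[OF A]])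
  show "FAr (cocone_incl A) f \<in> hom (cocone_cat A) (FOb (cocone_incl A) a) (FOb (cocone_incl A) b)"
    if "f \<in> hom A a b" for a b f
    using that hom_dom_in[OF A that] hom_cod_in[OF A that]
    by (auto simp: cocone_incl_def cocone_simps hom_def)
  show "FAr (cocone_incl A) (Ident A a) = Ident (cocone_cat A) (FOb (cocone_incl A) a)"
    if "a \<in> Obj A" for a
    using that id_in_hom[OF A that] by (auto simp: cocone_incl_def cocone_simps hom_def)
  show "FAr (cocone_incl A) (Comp A g f) =
      Comp (cocone_cat A) (FAr (cocone_incl A) g) (FAr (cocone_incl A) f)"
    if "g \<in> hom A b c" "f \<in> hom A a b" for a b c f g
    using that comp_in_hom[OF A that] by (auto simp: cocone_incl_def cocone_simps hom_def)
qed (auto simp: cocone_incl_def cocone_simps)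

abbreviation tip :: 'u where
  "tip \<equiv> code (None :: 'u option)"

lemma small_cocone_incl_ob: "a \<in> Obj A \<Longrightarrow> FOb (small_cocone_incl A) a = code (Some a)"
  by (simp add: small_cocone_incl_def fcomp_def compose_def encode_ftr_def cocone_incl_def cocone_simps)

text \<open>
  That the added object is terminal makes evaluation there a colimit; that the inclusion is full
  determines the slices over the other objects.
\<close>

lemma small_cocone:
  fixes A :: "('u, 'u) cat"
  assumes U: "infinite (UNIV :: 'u set)" and sA: "small_cat A"
  shows "small_cat (A\<rhd>)" and "ftr_between A (A\<rhd>) (small_cocone_incl A)"
    and "Obj (A\<rhd>) = insert tip (FOb (small_cocone_incl A) ` Obj A)"
    and "x \<in> Obj (A\<rhd>) \<Longrightarrow> \<exists>!f. f \<in> hom (A\<rhd>) x tip"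
    and "a \<in> Obj A \<Longrightarrow> b \<in> Obj A \<Longrightarrow> f \<in> hom (A\<rhd>) (FOb (small_cocone_incl A) a) (FOb (small_cocone_incl A) b) \<Longrightarrow>
      \<exists>g\<in>hom A a b. f = FAr (small_cocone_incl A) g"
proof -
  have A: "category A" using sA by (simp add: small_cat_def)
  note x = inj_code(2)[OF U] and y = inj_code(3)[OF U]
  have cx: "code a = (code b :: 'u) \<longleftrightarrow> a = b" for a b :: "'u option" using x by (simp add: inj_eq)
  have cy: "code a = (code b :: 'u) \<longleftrightarrow> a = b" for a b :: "'u + 'u option" using y by (simp add: inj_eq)
  note C = category_cocone[OF A]
  note S = encode_simps[OF x y, where C = "cocone_cat A"] cocone_simps
  have D: "Dom A f \<in> Obj A" "Cod A f \<in> Obj A" if "f \<in> Arr A" for f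
    using A that unfolding category_def by auto
  have o: "|insert None (Some ` Obj A)| <o |UNIV :: 'u set|"
    using card_of_Un_ordLess_infinite[OF U card_of_finite_less_infinite[OF U, of "{None :: 'u option}"]
        card_of_image_less[of "Obj A" _ Some]] sA by (simp add: small_cat_def small_set_def)
  have a: "|Inl ` Arr A \<union> Inr ` insert None (Some ` Obj A)| <o |UNIV :: 'u set|"
    by (rule card_of_Un_ordLess_infinite[OF U card_of_image_less card_of_image_less[OF o]])
      (use sA in \<open>simp add: small_cat_def small_set_def\<close>)
  show "small_cat (A\<rhd>)"
    unfolding small_cocone_def
    by (rule small_cat_encode[OF x y C]) (use o a in \<open>simp_all add: cocone_simps\<close>)
  show ftr: "ftr_between A (A\<rhd>) (small_cocone_incl A)"
    unfolding small_cocone_def small_cocone_incl_def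
    by (rule fcomp[OF cocone_incl[OF A] encode_ftr_ftr[OF x y C]])
  show "Obj (A\<rhd>) = insert tip (FOb (small_cocone_incl A) ` Obj A)"
    by (auto simp: small_cocone_incl_ob small_cocone_def S image_iff)
  show "\<exists>!f. f \<in> hom (A\<rhd>) x tip" if "x \<in> Obj (A\<rhd>)"
  proof -
    obtain x' where x': "x' \<in> insert None (Some ` Obj A)" "x = code x'"
      using \<open>x \<in> Obj (A\<rhd>)\<close> by (auto simp: small_cocone_def S)
    show ?thesis
      by (rule ex1I[of _ "code (Inr x' :: 'u + 'u option)"])
        (use x' in \<open>auto simp: small_cocone_def hom_def S cx cy\<close>)
  qed
  show "\<exists>g\<in>hom A a b. f = FAr (small_cocone_incl A) g"
    if a: "a \<in> Obj A" and b: "b \<in> Obj A" and f: "f \<in> hom (A\<rhd>) (FOb (small_cocone_incl A) a) (FOb (small_cocone_incl A) b)"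
  proof -
    obtain g where g: "g \<in> hom A a b" "f = code (Inl g :: 'u + 'u option)"
      using f a b by (auto simp: small_cocone_incl_ob small_cocone_def hom_def S cx cy)
    then have "f = FAr (small_cocone_incl A) g"
      by (simp add: small_cocone_incl_def fcomp_def compose_def encode_ftr_def cocone_incl_def cocone_simps hom_def)
    then show ?thesis using g(1) by blast
  qed
qed

section \<open>Slices with a single object\<close>

lemma singleton_ftr_eq:
  assumes F: "ftr_between T C F" and G: "ftr_between T C G"
    and T: "Obj T = {z}" "Arr T = {Ident T z}" and eq: "FOb F z = FOb G z"
  shows "F = G"
proof (rule ftr_eqI[OF F G])
  show "FOb F a = FOb G a" if "a \<in> Obj T" for a using that T eq by simp
  show "FAr F f = FAr G f" if "f \<in> Arr T" for f
    using that T eq ftr_ident[OF F, of z] ftr_ident[OF G, of z] by simp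
qed

lemma id_nt_whisker_right:
  assumes F: "ftr_between A B F" and G: "ftr_between B C G"
  shows "id_nt G \<star>\<^sub>r F = id_nt (G \<circ>\<^sub>F F)"
  by (rule nt_eqI[OF whisker_right[OF id_nt[OF G] F G] id_nt[OF fcomp[OF F G]] fcomp[OF F G]])
    (simp add: whisker_right_cmp[OF id_nt[OF G] F G] id_nt_cmp[OF fcomp[OF F G]]
      id_nt_cmp[OF G ftr_ob[OF F]] fcomp_ob[OF F])

context
  fixes u :: "('u, 'u, 'u, 'u) ftr" and A B :: "('u, 'u) cat" and a :: 'u
  assumes U: "infinite (UNIV :: 'u set)"
    and u: "ftr_between A B u" and a: "a \<in> Obj A" and homA: "hom A a a = {Ident A a}"
    and isolated: "\<forall>a'\<in>Obj A. \<forall>f\<in>hom B (FOb u a') (FOb u a). a' = a \<and> f = Ident B (FOb u a)"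
begin

text \<open>
  The situation is that of an object of a discrete category included into its cocone: no other object
  maps to it there, and it has no endomorphism except its identity.
\<close>

lemma slice_over_singleton:
  "Obj (slice_over_cat u (FOb u a)) = {(a, Ident B (FOb u a))}"
  "Arr (slice_over_cat u (FOb u a)) = {(Ident A a, Ident B (FOb u a))}"
  "Ident (slice_over_cat u (FOb u a)) (a, Ident B (FOb u a)) = (Ident A a, Ident B (FOb u a))"
  "category (slice_over_cat u (FOb u a))"
proof -
  let ?S = "slice_over_cat u (FOb u a)" and ?b = "FOb u a"
  note uC = ftr_betweenD[OF u]
  note b = ftr_ob[OF u a]
  note idb = id_in_hom[OF uC(2) b] and ida = id_in_hom[OF uC(1) a]
  have 1: "{(a', f). a' \<in> Obj A \<and> f \<in> hom B (FOb u a') ?b} = {(a, Ident B ?b)}"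
  proof (intro set_eqI iffI)
    fix x assume "x \<in> {(a', f). a' \<in> Obj A \<and> f \<in> hom B (FOb u a') ?b}"
    then show "x \<in> {(a, Ident B ?b)}" using isolated by blast
  qed (use a idb in simp)
  have 2: "{(h, f). h \<in> Arr A \<and> f \<in> hom B (FOb u (Cod A h)) ?b} = {(Ident A a, Ident B ?b)}"
  proof (intro set_eqI iffI)
    fix k assume "k \<in> {(h, f). h \<in> Arr A \<and> f \<in> hom B (FOb u (Cod A h)) ?b}"
    then obtain h f where k: "k = (h, f)" and h: "h \<in> Arr A" and f: "f \<in> hom B (FOb u (Cod A h)) ?b" by auto
    note hh = arr_in_hom[OF h]
    have c: "Cod A h = a" "f = Ident B ?b"
      using isolated[rule_format, OF hom_cod_in[OF uC(1) hh] f] by auto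
    have "Dom A h = a"
      using isolated[rule_format, OF hom_dom_in[OF uC(1) hh]] ftr_hom[OF u hh] c(1) by auto
    then have "h \<in> hom A a a" using hh c(1) by simp
    then show "k \<in> {(Ident A a, Ident B ?b)}" using homA k c(2) by simp
  next
    fix k assume "k \<in> {(Ident A a, Ident B ?b)}"
    then show "k \<in> {(h, f). h \<in> Arr A \<and> f \<in> hom B (FOb u (Cod A h)) ?b}"
      using ida idb by (auto simp: hom_def)
  qed
  have S: "?S = \<lparr>Obj = {(a, Ident B ?b)}, Arr = {(Ident A a, Ident B ?b)},
      Dom = (\<lambda>(h, f)\<in>{(Ident A a, Ident B ?b)}. (Dom A h, Comp B f (FAr u h))),
      Cod = (\<lambda>(h, f)\<in>{(Ident A a, Ident B ?b)}. (Cod A h, f)),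
      Ident = (\<lambda>(a', f)\<in>{(a, Ident B ?b)}. (Ident A a', f)),
      Comp = (\<lambda>k' k. if k' \<in> {(Ident A a, Ident B ?b)} \<and> k \<in> {(Ident A a, Ident B ?b)} \<and>
          (\<lambda>(h, f)\<in>{(Ident A a, Ident B ?b)}. (Dom A h, Comp B f (FAr u h))) k' =
          (\<lambda>(h, f)\<in>{(Ident A a, Ident B ?b)}. (Cod A h, f)) k
        then (Comp A (fst k') (fst k), snd k') else undefined)\<rparr>"
    unfolding slice_over_cat_def Let_def uC(3,4) 1 2 ..
  show "Obj ?S = {(a, Ident B ?b)}" "Arr ?S = {(Ident A a, Ident B ?b)}"
    "Ident ?S (a, Ident B ?b) = (Ident A a, Ident B ?b)"
    by (simp_all add: S)
  have "Comp B (Ident B ?b) (FAr u (Ident A a)) = Ident B ?b"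
    using ftr_ident[OF u a] comp_id_left[OF uC(2) idb] by simp
  moreover have "Comp A (Ident A a) (Ident A a) = Ident A a" by (rule comp_id_left[OF uC(1) ida])
  ultimately show "category ?S"
    using ida by (auto simp: S category_def hom_def)
qed

lemma slice_over_singleton_nt:
  "ftr_between (slice_over_cat u (FOb u a)) A (slice_over_proj u (FOb u a))"
  "slice_over_nt u (FOb u a) = id_nt (u \<circ>\<^sub>F slice_over_proj u (FOb u a))"
proof -
  let ?S = "slice_over_cat u (FOb u a)" and ?b = "FOb u a"
  note uC = ftr_betweenD[OF u]
  note b = ftr_ob[OF u a]
  note ida = id_in_hom[OF uC(1) a]
  note S = slice_over_singleton
  have comp: "Comp ?S (Ident A a, Ident B ?b) (Ident A a, Ident B ?b) = (Ident A a, Ident B ?b)"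
    using comp_id_left[OF S(4) id_in_hom[OF S(4)], of "(a, Ident B ?b)"] S(1,3) by simp
  show p: "ftr_between ?S A (slice_over_proj u ?b)"
  proof (rule ftr_betweenI[OF S(4) uC(1)])
    show "FAr (slice_over_proj u ?b) f \<in> hom A (FOb (slice_over_proj u ?b) x) (FOb (slice_over_proj u ?b) y)"
      if f: "f \<in> hom ?S x y" for x y f
    proof -
      have "x \<in> Obj ?S" "y \<in> Obj ?S" using hom_dom_in[OF S(4) f] hom_cod_in[OF S(4) f] by auto
      moreover have "f \<in> Arr ?S" using f by (simp add: hom_def)
      ultimately show ?thesis using ida by (simp add: slice_over_proj_def S)
    qed
    show "FAr (slice_over_proj u ?b) (Comp ?S g f) =
        Comp A (FAr (slice_over_proj u ?b) g) (FAr (slice_over_proj u ?b) f)"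
      if "g \<in> hom ?S y z" "f \<in> hom ?S x y" for f g x y z
    proof -
      have "f \<in> Arr ?S" "g \<in> Arr ?S" using that by (simp_all add: hom_def)
      then show ?thesis using comp comp_id_left[OF uC(1) ida] by (simp add: slice_over_proj_def S)
    qed
  qed (use a uC in \<open>auto simp: slice_over_proj_def S\<close>)
  let ?t = "to_one ?S :: ('u \<times> 'u, 'u \<times> 'u, 'u, 'u) ftr"
  have t: "ftr_between ?S one ?t" by (rule to_one_ftr[OF S(4)])
  have q: "ftr_between (one :: ('u, 'u) cat) B (pick B ?b)" by (rule pick_ftr[OF uC(2) b])
  have z: "(a, Ident B ?b) \<in> Obj ?S" by (simp add: S)
  have upo: "FOb (u \<circ>\<^sub>F slice_over_proj u ?b) (a, Ident B ?b) = ?b"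
    using fcomp_ob[OF p z, of u] by (simp add: slice_over_proj_def S)
  have eq: "pick B ?b \<circ>\<^sub>F ?t = u \<circ>\<^sub>F slice_over_proj u ?b"
  proof (rule singleton_ftr_eq[OF fcomp[OF t q] fcomp[OF p u] S(1)])
    show "Arr ?S = {Ident ?S (a, Ident B ?b)}" by (simp add: S)
    show "FOb (pick B ?b \<circ>\<^sub>F ?t) (a, Ident B ?b) = FOb (u \<circ>\<^sub>F slice_over_proj u ?b) (a, Ident B ?b)"
      unfolding upo using fcomp_ob[OF t z, of "pick B ?b"] by (simp add: to_one_def)
  qed
  have "(\<lambda>x\<in>Obj ?S. snd x) = Cmp (id_nt (u \<circ>\<^sub>F slice_over_proj u ?b))"
  proof (rule extensionalityI[of _ "Obj ?S"])
    show "Cmp (id_nt (u \<circ>\<^sub>F slice_over_proj u ?b)) \<in> extensional (Obj ?S)"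
      by (simp add: id_nt_def slice_over_proj_def)
    show "(\<lambda>x\<in>Obj ?S. snd x) x = Cmp (id_nt (u \<circ>\<^sub>F slice_over_proj u ?b)) x" if "x \<in> Obj ?S" for x
      using that upo by (simp add: id_nt_cmp[OF fcomp[OF p u]] S)
  qed simp
  then show "slice_over_nt u ?b = id_nt (u \<circ>\<^sub>F slice_over_proj u ?b)"
    unfolding slice_over_nt_def uC(4) eq by (simp add: id_nt_def)
qed

text \<open>
  If \<open>a\<close> is isolated over \<open>u a\<close>, the comma category \<open>(u / u a)\<close> is terminal, and the square that it
  forms with \<open>u\<close> is the identity of \<open>u \<circ> a\<close>.
\<close>

lemma small_slice_over_singleton:
  "\<exists>z. Obj (small_slice_over u (FOb u a)) = {z} \<and>
     pick (small_slice_over u (FOb u a)) z \<circ>\<^sub>F (to_one (small_slice_over u (FOb u a)) :: ('u, 'u, 'u, 'u) ftr) =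
       id_ftr (small_slice_over u (FOb u a))"
  "small_cat (small_slice_over u (FOb u a))"
  "small_slice_over_proj u (FOb u a) = pick A a \<circ>\<^sub>F (to_one (small_slice_over u (FOb u a)) :: ('u, 'u, 'u, 'u) ftr)"
  "small_slice_over_nt u (FOb u a) = id_nt (u \<circ>\<^sub>F small_slice_over_proj u (FOb u a))"
proof -
  let ?S = "slice_over_cat u (FOb u a)" and ?b = "FOb u a"
  let ?T = "small_slice_over u ?b"
  note uC = ftr_betweenD[OF u]
  note S = slice_over_singleton
  note p = slice_over_singleton_nt(1)
  note x = inj_code(1)[OF U]
  note d = decode_ftr_ftr(1)[OF x x S(4)]
  show T: "small_cat ?T"
    unfolding small_slice_over_def
    by (rule small_cat_encode[OF x x S(4)]) (simp_all add: S card_of_finite_less_infinite[OF U])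
  then have Tc: "category ?T" by (simp add: small_cat_def)
  define z :: 'u where "z = code (a, Ident B ?b)"
  have ob: "Obj ?T = {z}" and ar: "Arr ?T = {Ident ?T z}"
    using encode_simps(5)[OF x x, of "(a, Ident B ?b)" ?S]
    by (simp_all add: small_slice_over_def encode_simps[OF x x] S z_def)
  have zT: "z \<in> Obj ?T" by (simp add: ob)
  let ?t = "to_one ?T :: ('u, 'u, 'u, 'u) ftr"
  have t: "ftr_between ?T one ?t" by (rule to_one_ftr[OF Tc])
  have q: "ftr_between (one :: ('u, 'u) cat) ?T (pick ?T z)" by (rule pick_ftr[OF Tc zT])
  have r: "ftr_between (one :: ('u, 'u) cat) A (pick A a)" by (rule pick_ftr[OF uC(1) a])
  have "pick ?T z \<circ>\<^sub>F ?t = id_ftr ?T"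
    by (rule singleton_ftr_eq[OF fcomp[OF t q] id_ftr[OF Tc] ob ar])
      (use fcomp_ob[OF t zT, of "pick ?T z"] zT in \<open>simp add: to_one_def\<close>)
  then show "\<exists>z. Obj ?T = {z} \<and> pick ?T z \<circ>\<^sub>F ?t = id_ftr ?T"
    using ob by auto
  have proj: "ftr_between ?T A (small_slice_over_proj u ?b)"
    unfolding small_slice_over_proj_def small_slice_over_def by (rule fcomp[OF d p])
  show "small_slice_over_proj u ?b = pick A a \<circ>\<^sub>F ?t"
  proof (rule singleton_ftr_eq[OF proj fcomp[OF t r] ob ar])
    have "FOb (decode_ftr ?S) z = (a, Ident B ?b)"
      using x by (simp add: decode_ftr_def z_def S)
    then show "FOb (small_slice_over_proj u ?b) z = FOb (pick A a \<circ>\<^sub>F ?t) z"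
      using fcomp_ob[OF t zT, of "pick A a"] fcomp_ob[OF d, of z "slice_over_proj u ?b"] zT
      by (simp add: small_slice_over_proj_def small_slice_over_def to_one_def slice_over_proj_def S)
  qed
  show "small_slice_over_nt u ?b = id_nt (u \<circ>\<^sub>F small_slice_over_proj u ?b)"
    unfolding small_slice_over_nt_def slice_over_singleton_nt(2) small_slice_over_proj_def
    using id_nt_whisker_right[OF d fcomp[OF p u]] fcomp_assoc[OF d p u] by simp
qed

end

section \<open>Coproducts of categories\<close>

lemma coprod_simps:
  "Obj (coprod_cat I A) = (SIGMA i:I. Obj (A i))"
  "Arr (coprod_cat I A) = (SIGMA i:I. Arr (A i))"
  "i \<in> I \<Longrightarrow> f \<in> Arr (A i) \<Longrightarrow> Dom (coprod_cat I A) (i, f) = (i, Dom (A i) f)"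
  "i \<in> I \<Longrightarrow> f \<in> Arr (A i) \<Longrightarrow> Cod (coprod_cat I A) (i, f) = (i, Cod (A i) f)"
  "i \<in> I \<Longrightarrow> a \<in> Obj (A i) \<Longrightarrow> Ident (coprod_cat I A) (i, a) = (i, Ident (A i) a)"
  "i \<in> I \<Longrightarrow> f \<in> Arr (A i) \<Longrightarrow> g \<in> Arr (A i) \<Longrightarrow> Dom (A i) g = Cod (A i) f \<Longrightarrow>
     Comp (coprod_cat I A) (i, g) (i, f) = (i, Comp (A i) g f)"
  by (auto simp: coprod_cat_def)

lemma category_coprod:
  assumes "\<And>i. i \<in> I \<Longrightarrow> category (A i)"
  shows "category (coprod_cat I A)"
proof -
  note S = coprod_simps
  note F = category_arr[OF assms]
  show ?thesis
    unfolding category_def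
  proof (intro conjI)
    show "Dom (coprod_cat I A) \<in> Arr (coprod_cat I A) \<rightarrow>\<^sub>E Obj (coprod_cat I A)"
      "Cod (coprod_cat I A) \<in> Arr (coprod_cat I A) \<rightarrow>\<^sub>E Obj (coprod_cat I A)"
      using F(1,2) by (auto simp: coprod_cat_def)
    show "Ident (coprod_cat I A) \<in> extensional (Obj (coprod_cat I A))"
      by (simp add: coprod_cat_def)
    show "\<forall>g f. \<not> (g \<in> Arr (coprod_cat I A) \<and> f \<in> Arr (coprod_cat I A) \<and>
        Dom (coprod_cat I A) g = Cod (coprod_cat I A) f) \<longrightarrow> Comp (coprod_cat I A) g f = undefined"
      by (auto simp: coprod_cat_def)
  qed (auto simp: S hom_def F)
qed

lemma coprod_inj_ftr:
  assumes A: "\<And>i. i \<in> I \<Longrightarrow> category (A i)" and i: "i \<in> I"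
  shows "ftr_between (A i) (coprod_cat I A) (coprod_inj I A i)"
proof (rule ftr_betweenI[OF A[OF i] category_coprod[OF A]])
  show "FAr (coprod_inj I A i) f \<in> hom (coprod_cat I A) (FOb (coprod_inj I A i) a) (FOb (coprod_inj I A i) b)"
    if "f \<in> hom (A i) a b" for a b f
    using that i hom_dom_in[OF A[OF i] that] hom_cod_in[OF A[OF i] that]
    by (auto simp: coprod_inj_def coprod_simps hom_def)
  show "FAr (coprod_inj I A i) (Ident (A i) a) = Ident (coprod_cat I A) (FOb (coprod_inj I A i) a)"
    if "a \<in> Obj (A i)" for a
    using that i id_in_hom[OF A[OF i] that] by (auto simp: coprod_inj_def coprod_simps hom_def)
  show "FAr (coprod_inj I A i) (Comp (A i) g f) =
      Comp (coprod_cat I A) (FAr (coprod_inj I A i) g) (FAr (coprod_inj I A i) f)"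
    if "g \<in> hom (A i) b c" "f \<in> hom (A i) a b" for a b c f g
    using that i comp_in_hom[OF A[OF i] that] by (auto simp: coprod_inj_def coprod_simps hom_def)
qed (use i in \<open>auto simp: coprod_inj_def coprod_simps\<close>)

definition coprod_desc ::
  "'i set \<Rightarrow> ('i \<Rightarrow> ('o1, 'm1) cat) \<Rightarrow> ('o2, 'm2) cat \<Rightarrow> ('i \<Rightarrow> ('o1, 'm1, 'o2, 'm2) ftr) \<Rightarrow>
   ('i \<times> 'o1, 'i \<times> 'm1, 'o2, 'm2) ftr" where
  "coprod_desc I A B u = \<lparr>Src = coprod_cat I A, Tgt = B,
     FOb = (\<lambda>(i, a)\<in>(SIGMA i:I. Obj (A i)). FOb (u i) a),
     FAr = (\<lambda>(i, f)\<in>(SIGMA i:I. Arr (A i)). FAr (u i) f)\<rparr>"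

lemma coprod_desc:
  assumes A: "\<And>i. i \<in> I \<Longrightarrow> category (A i)" and B: "category B"
    and u: "\<And>i. i \<in> I \<Longrightarrow> ftr_between (A i) B (u i)"
  shows "ftr_between (coprod_cat I A) B (coprod_desc I A B u)"
    and "i \<in> I \<Longrightarrow> coprod_desc I A B u \<circ>\<^sub>F coprod_inj I A i = u i"
proof -
  note S = coprod_simps
  note F = category_arr[OF A]
  have uh: "FAr (u i) f \<in> hom B (FOb (u i) (Dom (A i) f)) (FOb (u i) (Cod (A i) f))"
    if "i \<in> I" "f \<in> Arr (A i)" for i f
    by (rule ftr_hom[OF u[OF that(1)] arr_in_hom[OF that(2)]])
  have uc: "FAr (u i) (Comp (A i) g f) = Comp B (FAr (u i) g) (FAr (u i) f)"
    if "i \<in> I" "g \<in> Arr (A i)" "f \<in> Arr (A i)" "Dom (A i) g = Cod (A i) f" for i f g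
    using ftr_comp[OF u[OF that(1)], of g "Dom (A i) g" "Cod (A i) g" f "Dom (A i) f"] that by (simp add: hom_def)
  show d: "ftr_between (coprod_cat I A) B (coprod_desc I A B u)"
  proof (rule ftr_betweenI[OF category_coprod[OF A] B])
    show "FAr (coprod_desc I A B u) f \<in> hom B (FOb (coprod_desc I A B u) x) (FOb (coprod_desc I A B u) y)"
      if "f \<in> hom (coprod_cat I A) x y" for x y f
      using that uh F(1,2) by (auto simp: coprod_desc_def S hom_def)
    show "FAr (coprod_desc I A B u) (Ident (coprod_cat I A) x) = Ident B (FOb (coprod_desc I A B u) x)"
      if "x \<in> Obj (coprod_cat I A)" for x
      using that F(3) ftr_ident[OF u] by (auto simp: coprod_desc_def S)
    show "FAr (coprod_desc I A B u) (Comp (coprod_cat I A) g f) =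
        Comp B (FAr (coprod_desc I A B u) g) (FAr (coprod_desc I A B u) f)"
      if "g \<in> hom (coprod_cat I A) y z" "f \<in> hom (coprod_cat I A) x y" for x y z f g
      using that uc F(6) by (auto simp: coprod_desc_def S hom_def)
  qed (use u in \<open>auto simp: coprod_desc_def S intro: ftr_ob\<close>)
  show "coprod_desc I A B u \<circ>\<^sub>F coprod_inj I A i = u i" if i: "i \<in> I"
  proof -
    have j: "ftr_between (A i) (coprod_cat I A) (coprod_inj I A i)" by (rule coprod_inj_ftr[OF A i])
    show ?thesis
    proof (rule ftr_eqI[OF fcomp[OF j d] u[OF i]])
      show "FOb (coprod_desc I A B u \<circ>\<^sub>F coprod_inj I A i) a = FOb (u i) a" if "a \<in> Obj (A i)" for a
        using that i by (simp add: fcomp_ob[OF j that]) (simp add: coprod_desc_def coprod_inj_def)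
      show "FAr (coprod_desc I A B u \<circ>\<^sub>F coprod_inj I A i) f = FAr (u i) f" if "f \<in> Arr (A i)" for f
        using that i by (simp add: fcomp_hom[OF j arr_in_hom[OF that]]) (simp add: coprod_desc_def coprod_inj_def)
    qed
  qed
qed

section \<open>Derivators pointwise\<close>

text \<open>
  Fixing source and target spares the projections out of a functor record in the statements below.
\<close>

definition small_ftr_between :: "('u, 'u) cat \<Rightarrow> ('u, 'u) cat \<Rightarrow> ('u, 'u, 'u, 'u) ftr \<Rightarrow> bool" where
  "small_ftr_between A B u \<longleftrightarrow> ftr_between A B u \<and> small_cat A \<and> small_cat B"

lemma small_ftr_betweenD:
  assumes "small_ftr_between A B u"
  shows "ftr_between A B u" "small_cat A" "small_cat B" "small_ftr u" "Src u = A" "Tgt u = B"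
  using assms by (auto simp: small_ftr_between_def small_ftr_def ftr_between_def)

lemma small_ftr_between_comp:
  "small_ftr_between A B u \<Longrightarrow> small_ftr_between B C v \<Longrightarrow> small_ftr_between A C (v \<circ>\<^sub>F u)"
  by (auto simp: small_ftr_between_def intro: fcomp)

lemma small_ftr_between_id: "small_cat A \<Longrightarrow> small_ftr_between A A (id_ftr A)"
  by (auto simp: small_ftr_between_def small_cat_def intro: id_ftr)

lemma small_catD: "small_cat A \<Longrightarrow> category A"
  by (simp add: small_cat_def)

locale derivator =
  fixes \<D> :: "('u, 'o, 'm) prederivator"
  assumes universe: "infinite (UNIV :: 'u set)" and derivator: "is_derivator \<D>"
begin

abbreviation cat :: "('u, 'u) cat \<Rightarrow> ('o, 'm) cat" where
  "cat \<equiv> On_cat \<D>"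

abbreviation ob :: "('u, 'u, 'u, 'u) ftr \<Rightarrow> 'o \<Rightarrow> 'o" where
  "ob u \<equiv> FOb (On_ftr \<D> u)"

abbreviation ar :: "('u, 'u, 'u, 'u) ftr \<Rightarrow> 'm \<Rightarrow> 'm" where
  "ar u \<equiv> FAr (On_ftr \<D> u)"

abbreviation tr :: "('u, 'u, 'u, 'u) nt \<Rightarrow> 'o \<Rightarrow> 'm" where
  "tr \<alpha> \<equiv> Cmp (On_nt \<D> \<alpha>)"

lemma prederivator: "is_prederivator \<D>"
  using derivator by (simp add: is_derivator_def)

lemma small_one: "small_cat (one :: ('u, 'u) cat)"
  by (rule small_cat_one[OF universe])

lemma small_to_one: "small_cat (A :: ('u, 'u) cat) \<Longrightarrow> small_ftr_between A one (to_one A)"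
  by (simp add: small_ftr_between_def to_one_ftr small_one small_catD)

lemma small_pick: "small_cat (A :: ('u, 'u) cat) \<Longrightarrow> a \<in> Obj A \<Longrightarrow> small_ftr_between one A (pick A a)"
  by (simp add: small_ftr_between_def pick_ftr small_one small_catD)

lemma category_cat: "small_cat A \<Longrightarrow> category (cat A)"
  using prederivator by (simp add: is_prederivator_def)

lemma pull_ftr: "small_ftr_between A B u \<Longrightarrow> ftr_between (cat B) (cat A) (On_ftr \<D> u)"
  using prederivator small_ftr_betweenD[of A B u] by (auto simp: is_prederivator_def)

lemma pull_ob: "small_ftr_between A B u \<Longrightarrow> X \<in> Obj (cat B) \<Longrightarrow> ob u X \<in> Obj (cat A)"
  using ftr_ob[OF pull_ftr] .

lemma pull_hom: "small_ftr_between A B u \<Longrightarrow> f \<in> hom (cat B) X Y \<Longrightarrow> ar u f \<in> hom (cat A) (ob u X) (ob u Y)"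
  using ftr_hom[OF pull_ftr] .

lemma pull_iso:
  "small_ftr_between A B u \<Longrightarrow> f \<in> hom (cat B) X Y \<Longrightarrow> iso (cat B) f \<Longrightarrow> iso (cat A) (ar u f)"
  using ftr_iso[OF pull_ftr] .

lemma pull_fcomp:
  "small_ftr_between A B u \<Longrightarrow> small_ftr_between B C v \<Longrightarrow>
    On_ftr \<D> (v \<circ>\<^sub>F u) = On_ftr \<D> u \<circ>\<^sub>F On_ftr \<D> v"
  using prederivator small_ftr_betweenD[of A B u] small_ftr_betweenD[of B C v]
  by (auto simp: is_prederivator_def)

lemma pull_fcomp_ob:
  assumes "small_ftr_between A B u" "small_ftr_between B C v" "X \<in> Obj (cat C)"
  shows "ob (v \<circ>\<^sub>F u) X = ob u (ob v X)"
  using pull_fcomp[OF assms(1,2)] fcomp_ob[OF pull_ftr[OF assms(2)] assms(3)] by simp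

lemma pull_fcomp_hom:
  assumes "small_ftr_between A B u" "small_ftr_between B C v" "f \<in> hom (cat C) X Y"
  shows "ar (v \<circ>\<^sub>F u) f = ar u (ar v f)"
  using pull_fcomp[OF assms(1,2)] fcomp_hom[OF pull_ftr[OF assms(2)] assms(3)] by simp

lemma pull_id: "small_cat A \<Longrightarrow> On_ftr \<D> (id_ftr A) = id_ftr (cat A)"
  using prederivator by (simp add: is_prederivator_def)

lemma small_nt_between:
  assumes \<alpha>: "nt_between u v \<alpha>" and u: "small_ftr_between A B u"
  shows "small_nt \<alpha>" "NSrc \<alpha> = u" "NTgt \<alpha> = v" "small_ftr_between A B v"
proof -
  show v: "small_ftr_between A B v"
    using nt_ftr[OF \<alpha> small_ftr_betweenD(1)[OF u]] u by (simp add: small_ftr_between_def)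
  show "small_nt \<alpha>" "NSrc \<alpha> = u" "NTgt \<alpha> = v"
    using \<alpha> small_ftr_betweenD(4)[OF u] small_ftr_betweenD(4)[OF v] by (simp_all add: small_nt_def nt_between_def)
qed

lemma pull_nt:
  assumes \<alpha>: "nt_between u v \<alpha>" and u: "small_ftr_between A B u"
  shows "nt_between (On_ftr \<D> u) (On_ftr \<D> v) (On_nt \<D> \<alpha>)"
  using prederivator small_nt_between[OF \<alpha> u] by (auto simp: is_prederivator_def)

lemma pull_id_nt: "small_ftr_between A B u \<Longrightarrow> On_nt \<D> (id_nt u) = id_nt (On_ftr \<D> u)"
  using prederivator small_ftr_betweenD[of A B u] by (simp add: is_prederivator_def)

lemma pull_id_nt_cmp:
  assumes "small_ftr_between A B u" "X \<in> Obj (cat B)"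
  shows "tr (id_nt u) X = Ident (cat A) (ob u X)"
  using pull_id_nt[OF assms(1)] id_nt_cmp[OF pull_ftr[OF assms(1)] assms(2)] by simp

lemma pull_hcomp:
  assumes "small_nt \<alpha>" "small_nt \<beta>" "Tgt (NSrc \<alpha>) = Src (NSrc \<beta>)"
  shows "On_nt \<D> (\<beta> \<circ>\<^sub>h \<alpha>) = On_nt \<D> \<alpha> \<circ>\<^sub>h On_nt \<D> \<beta>"
  using prederivator assms by (simp add: is_prederivator_def)

lemma pull_whisker_right:
  assumes \<beta>: "nt_between v w \<beta>" and u: "small_ftr_between A B u" and v: "small_ftr_between B C v"
    and X: "X \<in> Obj (cat C)"
  shows "tr (\<beta> \<star>\<^sub>r u) X = ar u (tr \<beta> X)"
proof -
  note I = id_nt[OF small_ftr_betweenD(1)[OF u]]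
  have "On_nt \<D> (\<beta> \<star>\<^sub>r u) = On_ftr \<D> u \<star>\<^sub>l On_nt \<D> \<beta>"
    using pull_hcomp[OF small_nt_between(1)[OF I u] small_nt_between(1)[OF \<beta> v]]
      small_nt_between(2)[OF I u] small_nt_between(2)[OF \<beta> v]
      small_ftr_betweenD(6)[OF u] small_ftr_betweenD(5)[OF v] pull_id_nt[OF u] by simp
  then show ?thesis
    using whisker_left_cmp[OF pull_nt[OF \<beta> v] pull_ftr[OF v] pull_ftr[OF u] X] by simp
qed

lemma pull_whisker_left:
  assumes \<alpha>: "nt_between u u' \<alpha>" and u: "small_ftr_between A B u" and v: "small_ftr_between B C v"
    and X: "X \<in> Obj (cat C)"
  shows "tr (v \<star>\<^sub>l \<alpha>) X = tr \<alpha> (ob v X)"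
proof -
  note I = id_nt[OF small_ftr_betweenD(1)[OF v]]
  have "On_nt \<D> (v \<star>\<^sub>l \<alpha>) = On_nt \<D> \<alpha> \<star>\<^sub>r On_ftr \<D> v"
    using pull_hcomp[OF small_nt_between(1)[OF \<alpha> u] small_nt_between(1)[OF I v]]
      small_nt_between(2)[OF I v] small_nt_between(2)[OF \<alpha> u]
      small_ftr_betweenD(6)[OF u] small_ftr_betweenD(5)[OF v] pull_id_nt[OF v] by simp
  then show ?thesis
    using whisker_right_cmp[OF pull_nt[OF \<alpha> u] pull_ftr[OF v] pull_ftr[OF u] X] by simp
qed

lemma lkan_adjunction:
  assumes u: "small_ftr_between A B u"
  shows "adjunction (lkan \<D> u) (On_ftr \<D> u) (lkan_unit \<D> u) (lkan_counit \<D> u)"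
proof -
  have "\<exists>x. case x of (L, \<eta>, \<epsilon>) \<Rightarrow> adjunction L (On_ftr \<D> u) \<eta> \<epsilon>"
    using derivator small_ftr_betweenD(4)[OF u] by (auto simp: is_derivator_def Der3_def)
  from someI_ex[OF this] show ?thesis
    by (simp add: lkan_def lkan_unit_def lkan_counit_def left_adj_data_def split: prod.splits)
qed

text \<open>
  Restriction has a right adjoint as well, the right Kan extension, and so preserves all coproducts.
\<close>

lemma pull_preserves_coproducts:
  assumes u: "small_ftr_between A B u" and cop: "is_coproduct (cat B) I x c \<iota>"
  shows "is_coproduct (cat A) I (\<lambda>i. ob u (x i)) (ob u c) (\<lambda>i. ar u (\<iota> i))"
proof -
  obtain R \<eta> \<epsilon> where adj: "adjunction (On_ftr \<D> u) R \<eta> \<epsilon>"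
    using derivator small_ftr_betweenD(4)[OF u] unfolding is_derivator_def Der3_def by blast
  then have "ftr_between (cat A) (cat B) R"
    using pull_ftr[OF u] by (auto simp: adjunction_def ftr_between_def)
  from left_adjoint_preserves_coproducts[OF adj this cop] show ?thesis .
qed

lemma iso_pointwise:
  assumes A: "small_cat A" and f: "f \<in> hom (cat A) X Y"
  shows "iso (cat A) f \<longleftrightarrow> (\<forall>a\<in>Obj A. iso (cat one) (ar (pick A a) f))"
  using derivator A f unfolding is_derivator_def Der2_def hom_def by blast

section \<open>Diagrams on coproducts\<close>

text \<open>
  The functor from the value at \<open>B\<close> to the \<open>I\<close>-fold power of the value at \<open>A\<close>, with components the
  restrictions along \<open>w k\<close>, is full, faithful and essentially surjective: for the derivator, \<open>w\<close>
  exhibits \<open>B\<close> as a coproduct of copies of \<open>A\<close>. Spelling this out with families keeps product categories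
  and chosen inverses out of what follows.
\<close>

definition splits ::
  "'i set \<Rightarrow> ('u, 'u) cat \<Rightarrow> ('u, 'u) cat \<Rightarrow> ('i \<Rightarrow> ('u, 'u, 'u, 'u) ftr) \<Rightarrow> bool" where
  "splits I A B w \<longleftrightarrow> (\<forall>k\<in>I. small_ftr_between A B (w k)) \<and> small_cat B \<and>
     (\<forall>X\<in>Obj (cat B). \<forall>Y\<in>Obj (cat B). \<forall>f. (\<forall>k\<in>I. f k \<in> hom (cat A) (ob (w k) X) (ob (w k) Y)) \<longrightarrow>
        (\<exists>h\<in>hom (cat B) X Y. \<forall>k\<in>I. ar (w k) h = f k)) \<and>
     (\<forall>X Y. \<forall>h\<in>hom (cat B) X Y. \<forall>h'\<in>hom (cat B) X Y. (\<forall>k\<in>I. ar (w k) h = ar (w k) h') \<longrightarrow> h = h') \<and>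
     (\<forall>x. (\<forall>k\<in>I. x k \<in> Obj (cat A)) \<longrightarrow>
        (\<exists>X\<in>Obj (cat B). \<exists>a. \<forall>k\<in>I. a k \<in> hom (cat A) (ob (w k) X) (x k) \<and> iso (cat A) (a k)))"

lemma splitsD:
  assumes "splits I A B w"
  shows splits_ftr: "k \<in> I \<Longrightarrow> small_ftr_between A B (w k)"
    and splits_small: "small_cat B"
    and splits_full: "X \<in> Obj (cat B) \<Longrightarrow> Y \<in> Obj (cat B) \<Longrightarrow>
      (\<And>k. k \<in> I \<Longrightarrow> f k \<in> hom (cat A) (ob (w k) X) (ob (w k) Y)) \<Longrightarrow>
      \<exists>h\<in>hom (cat B) X Y. \<forall>k\<in>I. ar (w k) h = f k"
    and splits_faithful: "h \<in> hom (cat B) X Y \<Longrightarrow> h' \<in> hom (cat B) X Y \<Longrightarrow>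
      (\<And>k. k \<in> I \<Longrightarrow> ar (w k) h = ar (w k) h') \<Longrightarrow> h = h'"
    and splits_surj: "(\<And>k. k \<in> I \<Longrightarrow> x k \<in> Obj (cat A)) \<Longrightarrow>
      \<exists>X\<in>Obj (cat B). \<exists>a. \<forall>k\<in>I. a k \<in> hom (cat A) (ob (w k) X) (x k) \<and> iso (cat A) (a k)"
  using assms unfolding splits_def by simp_all

lemma small_coprod_simps:
  fixes I :: "'u set" and A :: "'u \<Rightarrow> ('u, 'u) cat"
  assumes I: "small_set I" and A: "small_cat A'" "\<And>i. A i = A'"
  shows "small_cat (small_coprod I A)"
    and "i \<in> I \<Longrightarrow> small_ftr_between (A i) (small_coprod I A) (small_coprod_inj I A i)"
proof -
  note x = inj_code(1)[OF universe]
  have c: "category (A i)" for i using A small_catD by simp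
  note C = category_coprod[of I A, OF c]
  have eq: "(SIGMA i:I. Obj (A i)) = I \<times> Obj A'" "(SIGMA i:I. Arr (A i)) = I \<times> Arr A'"
    using A(2) by auto
  show s: "small_cat (small_coprod I A)"
    unfolding small_coprod_def
  proof (rule small_cat_encode[OF x x C])
    show "|Obj (coprod_cat I A)| <o |UNIV :: 'u set|" "|Arr (coprod_cat I A)| <o |UNIV :: 'u set|"
      unfolding coprod_simps eq
      using I A(1) by (auto simp: small_cat_def small_set_def intro!: card_of_times_less[OF universe])
  qed
  show "small_ftr_between (A i) (small_coprod I A) (small_coprod_inj I A i)" if i: "i \<in> I"
    using s fcomp[OF coprod_inj_ftr[of I A, OF c i] encode_ftr_ftr[OF x x C]] A
    by (simp add: small_ftr_between_def small_coprod_def small_coprod_inj_def)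
qed

text \<open>
  This is (Der1) for a constant family, with the equivalence read componentwise.
\<close>

lemma splits_small_coprod:
  fixes I :: "'u set"
  assumes I: "small_set I" and A: "small_cat A"
  shows "splits I A (small_coprod I (\<lambda>_. A)) (small_coprod_inj I (\<lambda>_. A))"
proof -
  let ?C = "small_coprod I (\<lambda>_. A)" and ?j = "small_coprod_inj I (\<lambda>_. A)"
  note S = small_coprod_simps[OF I A, of "\<lambda>_. A", OF refl]
  let ?P = "prod_cat I (\<lambda>_. cat A)"
  let ?K = "tuple_ftr I (cat ?C) (\<lambda>_. cat A) (\<lambda>i. On_ftr \<D> (?j i))"
  note catA = category_cat[OF A]
  have eqv: "equivalence_ftr ?K"
    using derivator I A by (auto simp: is_derivator_def Der1_def)
  have K: "ftr_between (cat ?C) ?P ?K"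
    using eqv by (simp add: equivalence_ftr_def ftr_between_def tuple_ftr_def)
  have Kob: "FOb ?K X = (\<lambda>i\<in>I. ob (?j i) X)" if "X \<in> Obj (cat ?C)" for X
    using that by (simp add: tuple_ftr_def)
  have Kar: "FAr ?K f = (\<lambda>i\<in>I. ar (?j i) f)" if "f \<in> hom (cat ?C) X Y" for f X Y
    using that by (simp add: tuple_ftr_def hom_def)
  note P = ftr_betweenD(2)[OF K] and C = ftr_betweenD(1)[OF K]
  show ?thesis
    unfolding splits_def
  proof (intro conjI ballI allI impI)
    show "small_ftr_between A ?C (?j k)" if "k \<in> I" for k by (rule S(2)[OF that])
    show "small_cat ?C" by (rule S(1))
    show "\<exists>h\<in>hom (cat ?C) X Y. \<forall>k\<in>I. ar (?j k) h = f k"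
      if X: "X \<in> Obj (cat ?C)" and Y: "Y \<in> Obj (cat ?C)"
        and f: "\<forall>k\<in>I. f k \<in> hom (cat A) (ob (?j k) X) (ob (?j k) Y)" for X Y f
    proof -
      have "(\<lambda>k\<in>I. f k) \<in> hom ?P (FOb ?K X) (FOb ?K Y)"
        unfolding Kob[OF X] Kob[OF Y] using f
        by (auto simp: hom_def prod_cat_def intro!: restrict_ext)
      from equivalence_full[OF eqv K X Y this]
      obtain h where h: "h \<in> hom (cat ?C) X Y" "FAr ?K h = (\<lambda>k\<in>I. f k)" by blast
      have "ar (?j k) h = f k" if "k \<in> I" for k
        using fun_cong[OF h(2), of k] that by (simp add: Kar[OF h(1)])
      then show ?thesis using h(1) by blast
    qed
    show "h = h'" if "h \<in> hom (cat ?C) X Y" "h' \<in> hom (cat ?C) X Y"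
      "\<forall>k\<in>I. ar (?j k) h = ar (?j k) h'" for X Y h h'
      by (rule equivalence_faithful[OF eqv K that(1,2)])
        (use that(3) in \<open>auto simp: Kar[OF that(1)] Kar[OF that(2)] intro!: restrict_ext\<close>)
    show "\<exists>X\<in>Obj (cat ?C). \<exists>a. \<forall>k\<in>I. a k \<in> hom (cat A) (ob (?j k) X) (x k) \<and> iso (cat A) (a k)"
      if x: "\<forall>k\<in>I. x k \<in> Obj (cat A)" for x
    proof -
      have "(\<lambda>k\<in>I. x k) \<in> Obj ?P" using x by (simp add: prod_cat_def)
      from equivalence_surj[OF eqv K this]
      obtain X a where X: "X \<in> Obj (cat ?C)" and a: "a \<in> hom ?P (FOb ?K X) (\<lambda>k\<in>I. x k)" "iso ?P a"
        by blast
      obtain b where b: "b \<in> hom ?P (\<lambda>k\<in>I. x k) (FOb ?K X)" "Comp ?P b a = Ident ?P (FOb ?K X)"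
        "Comp ?P a b = Ident ?P (\<lambda>k\<in>I. x k)" using isoE[OF a(2,1)] by metis
      have comp: "f k \<in> hom (cat A) (y k) (z k)" if f: "f \<in> hom ?P y z" and k: "k \<in> I" for f y z k
        using f k by (auto simp: hom_def prod_cat_def)
      have Pc: "Comp ?P g f k = Comp (cat A) (g k) (f k)" if g: "g \<in> hom ?P y z" and f: "f \<in> hom ?P x y"
        and k: "k \<in> I" for f g x y z k
      proof -
        have "\<forall>i\<in>I. Dom (cat A) (g i) = Cod (cat A) (f i)"
          using comp[OF g] comp[OF f] by (simp add: hom_def)
        moreover have "g \<in> (\<Pi>\<^sub>E i\<in>I. Arr (cat A))" "f \<in> (\<Pi>\<^sub>E i\<in>I. Arr (cat A))"
          using f g by (simp_all add: hom_def prod_cat_def)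
        ultimately show ?thesis using k by (simp add: prod_cat_def)
      qed
      have Pi: "Ident ?P y k = Ident (cat A) (y k)" if "y \<in> Obj ?P" "k \<in> I" for y k
        using that by (simp add: prod_cat_def)
      have "a k \<in> hom (cat A) (ob (?j k) X) (x k) \<and> iso (cat A) (a k)" if k: "k \<in> I" for k
      proof
        have ak: "a k \<in> hom (cat A) (FOb ?K X k) ((\<lambda>k\<in>I. x k) k)" by (rule comp[OF a(1) k])
        have bk: "b k \<in> hom (cat A) ((\<lambda>k\<in>I. x k) k) (FOb ?K X k)" by (rule comp[OF b(1) k])
        show "a k \<in> hom (cat A) (ob (?j k) X) (x k)" using ak k by (simp add: Kob[OF X])
        show "iso (cat A) (a k)"
        proof (rule isoI[OF ak bk])
          show "Comp (cat A) (b k) (a k) = Ident (cat A) (FOb ?K X k)"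
            using Pc[OF b(1) a(1) k] b(2) Pi[OF hom_dom_in[OF P a(1)] k] by simp
          show "Comp (cat A) (a k) (b k) = Ident (cat A) ((\<lambda>k\<in>I. x k) k)"
            using Pc[OF a(1) b(1) k] b(3) Pi[OF hom_cod_in[OF P a(1)] k] by simp
        qed
      qed
      then show ?thesis using X by blast
    qed
  qed
qed

text \<open>
  An arbitrary discrete category is isomorphic, but need not be equal, to a coproduct of points
  as built above. Retracts suffice for the transport.
\<close>

lemma splits_retract:
  assumes spl: "splits I A C j" and \<phi>: "small_ftr_between C B \<phi>" and \<psi>: "small_ftr_between B C \<psi>"
    and \<phi>\<psi>: "\<phi> \<circ>\<^sub>F \<psi> = id_ftr B" and j: "\<And>k. k \<in> I \<Longrightarrow> \<phi> \<circ>\<^sub>F j k = w k" and w: "\<And>k. k \<in> I \<Longrightarrow> \<psi> \<circ>\<^sub>F w k = j k"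
  shows "splits I A B w"
proof -
  note S = splitsD[OF spl]
  have wf: "small_ftr_between A B (w k)" if "k \<in> I" for k
    using small_ftr_between_comp[OF S(1)[OF that] \<phi>] j[OF that] by simp
  note B = small_ftr_betweenD(2)[OF \<psi>]
  have ob\<phi>: "ob (j k) (ob \<phi> X) = ob (w k) X" if "k \<in> I" "X \<in> Obj (cat B)" for k X
    using pull_fcomp_ob[OF S(1)[OF that(1)] \<phi> that(2)] j[OF that(1)] by simp
  have ar\<phi>: "ar (j k) (ar \<phi> f) = ar (w k) f" if "k \<in> I" "f \<in> hom (cat B) X Y" for k f X Y
    using pull_fcomp_hom[OF S(1)[OF that(1)] \<phi> that(2)] j[OF that(1)] by simp
  have ob\<psi>: "ob (w k) (ob \<psi> X) = ob (j k) X" if "k \<in> I" "X \<in> Obj (cat C)" for k X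
    using pull_fcomp_ob[OF wf[OF that(1)] \<psi> that(2)] w[OF that(1)] by simp
  have ar\<psi>: "ar (w k) (ar \<psi> f) = ar (j k) f" if "k \<in> I" "f \<in> hom (cat C) X Y" for k f X Y
    using pull_fcomp_hom[OF wf[OF that(1)] \<psi> that(2)] w[OF that(1)] by simp
  have ob1: "ob \<psi> (ob \<phi> X) = X" if "X \<in> Obj (cat B)" for X
    using pull_fcomp_ob[OF \<psi> \<phi> that] \<phi>\<psi> pull_id[OF B] that by simp
  have ar1: "ar \<psi> (ar \<phi> f) = f" if "f \<in> hom (cat B) X Y" for f X Y
    using pull_fcomp_hom[OF \<psi> \<phi> that] \<phi>\<psi> pull_id[OF B] that by simp
  show ?thesis
    unfolding splits_def
  proof (intro conjI ballI allI impI)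
    show "small_cat B" by (rule B)
    show "small_ftr_between A B (w k)" if "k \<in> I" for k by (rule wf[OF that])
    show "\<exists>h\<in>hom (cat B) X Y. \<forall>k\<in>I. ar (w k) h = f k"
      if X: "X \<in> Obj (cat B)" and Y: "Y \<in> Obj (cat B)"
        and f: "\<forall>k\<in>I. f k \<in> hom (cat A) (ob (w k) X) (ob (w k) Y)" for X Y f
    proof -
      have "f k \<in> hom (cat A) (ob (j k) (ob \<phi> X)) (ob (j k) (ob \<phi> Y))" if "k \<in> I" for k
        using f that by (simp add: ob\<phi>[OF that X] ob\<phi>[OF that Y])
      from S(3)[of "ob \<phi> X" "ob \<phi> Y" f, OF pull_ob[OF \<phi> X] pull_ob[OF \<phi> Y] this]
      obtain g where g: "g \<in> hom (cat C) (ob \<phi> X) (ob \<phi> Y)" "\<forall>k\<in>I. ar (j k) g = f k" by blast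
      have "ar \<psi> g \<in> hom (cat B) X Y" using pull_hom[OF \<psi> g(1)] ob1[OF X] ob1[OF Y] by simp
      then show ?thesis using ar\<psi>[OF _ g(1)] g(2) by (intro bexI[of _ "ar \<psi> g"]) simp_all
    qed
    show "h = h'" if h: "h \<in> hom (cat B) X Y" and h': "h' \<in> hom (cat B) X Y"
      and eq: "\<forall>k\<in>I. ar (w k) h = ar (w k) h'" for X Y h h'
    proof -
      have e: "ar \<phi> h = ar \<phi> h'"
        by (rule S(4)[OF pull_hom[OF \<phi> h] pull_hom[OF \<phi> h']])
          (use eq ar\<phi>[OF _ h] ar\<phi>[OF _ h'] in simp)
      show ?thesis using arg_cong[OF e, of "ar \<psi>"] unfolding ar1[OF h] ar1[OF h'] .
    qed
    show "\<exists>X\<in>Obj (cat B). \<exists>a. \<forall>k\<in>I. a k \<in> hom (cat A) (ob (w k) X) (x k) \<and> iso (cat A) (a k)"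
      if x: "\<forall>k\<in>I. x k \<in> Obj (cat A)" for x
    proof -
      obtain X a where X: "X \<in> Obj (cat C)"
        and a: "\<forall>k\<in>I. a k \<in> hom (cat A) (ob (j k) X) (x k) \<and> iso (cat A) (a k)"
        using bspec[OF x] S(5)[of x] by auto
      show ?thesis
        by (rule bexI[OF _ pull_ob[OF \<psi> X]], rule exI[of _ a]) (use a in \<open>simp add: ob\<psi>[OF _ X]\<close>)
    qed
  qed
qed

text \<open>
  Across the splitting, restriction along \<open>t\<close> is the diagonal, because it becomes the identity on every
  copy of \<open>A\<close>: arrows from \<open>Y\<close> to the restriction of \<open>d\<close> are families of arrows from the components
  of \<open>Y\<close> to \<open>d\<close>. So its universal arrows are coproduct cocones.
\<close>

lemma universal_arrow_iff_coproduct: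
  assumes spl: "splits I A B w" and t: "small_ftr_between B A t"
    and tw: "\<And>k. k \<in> I \<Longrightarrow> t \<circ>\<^sub>F w k = id_ftr A"
    and Y: "Y \<in> Obj (cat B)" and c: "c \<in> Obj (cat A)" and e: "e \<in> hom (cat B) Y (ob t c)"
  shows "universal_arrow (cat A) (cat B) (On_ftr \<D> t) Y c e \<longleftrightarrow>
    is_coproduct (cat A) I (\<lambda>k. ob (w k) Y) c (\<lambda>k. ar (w k) e)"
proof -
  note S = splitsD[OF spl]
  note A = small_ftr_betweenD(3)[OF t] and B = small_ftr_betweenD(2)[OF t]
  note CA = category_cat[OF A] and CB = category_cat[OF B]
  have obt: "ob (w k) (ob t d) = d" if "k \<in> I" "d \<in> Obj (cat A)" for k d
    using pull_fcomp_ob[OF S(1)[OF that(1)] t that(2)] tw[OF that(1)] pull_id[OF A] that(2) by simp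
  have art: "ar (w k) (ar t f) = f" if "k \<in> I" "f \<in> hom (cat A) d d'" for k f d d'
    using pull_fcomp_hom[OF S(1)[OF that(1)] t that(2)] tw[OF that(1)] pull_id[OF A] that(2) by simp
  have comp: "ar (w k) (Comp (cat B) (ar t h) e) = Comp (cat A) h (ar (w k) e)"
    if k: "k \<in> I" and h: "h \<in> hom (cat A) c d" for k h d
    using ftr_comp[OF pull_ftr[OF S(1)[OF k]] pull_hom[OF t h] e] art[OF k h] by simp
  have we: "ar (w k) e \<in> hom (cat A) (ob (w k) Y) c" if k: "k \<in> I" for k
    using pull_hom[OF S(1)[OF k] e] obt[OF k c] by simp
  show ?thesis
    unfolding is_coproduct_iff_universal[OF CA]
  proof
    assume U: "universal_arrow (cat A) (cat B) (On_ftr \<D> t) Y c e"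
    show "universal (cat A) I (\<lambda>_. cat A) (\<lambda>_. id_ftr (cat A)) (\<lambda>k. ob (w k) Y) c (\<lambda>k. ar (w k) e)"
    proof (rule universalI)
      show "c \<in> Obj (cat A)" by (rule c)
      show "ar (w k) e \<in> hom (cat A) (ob (w k) Y) (FOb (id_ftr (cat A)) c)" if "k \<in> I" for k
        using we[OF that] c by simp
      fix d assume d: "d \<in> Obj (cat A)"
      show "\<exists>h\<in>hom (cat A) c d. \<forall>k\<in>I. Comp (cat A) (FAr (id_ftr (cat A)) h) (ar (w k) e) = f k"
        if f: "\<And>k. k \<in> I \<Longrightarrow> f k \<in> hom (cat A) (ob (w k) Y) (FOb (id_ftr (cat A)) d)" for f
      proof -
        have "f k \<in> hom (cat A) (ob (w k) Y) (ob (w k) (ob t d))" if "k \<in> I" for k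
          using f[OF that] d obt[OF that d] by simp
        from S(3)[of Y "ob t d" f, OF Y pull_ob[OF t d] this]
        obtain F where F: "F \<in> hom (cat B) Y (ob t d)" "\<forall>k\<in>I. ar (w k) F = f k" by blast
        obtain h where h: "h \<in> hom (cat A) c d" "Comp (cat B) (ar t h) e = F"
          using universal_factor[OF U d, of "\<lambda>_. F"] F(1) by auto
        show ?thesis
          using comp[OF _ h(1)] h F(2) by (intro bexI[of _ h]) simp_all
      qed
      show "h = h'" if h: "h \<in> hom (cat A) c d" and h': "h' \<in> hom (cat A) c d"
        and eq: "\<And>k. k \<in> I \<Longrightarrow> Comp (cat A) (FAr (id_ftr (cat A)) h) (ar (w k) e) =
          Comp (cat A) (FAr (id_ftr (cat A)) h') (ar (w k) e)" for h h'
      proof (rule universal_eq[OF U pull_ftr[OF t] CA h h'])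
        show "Comp (cat B) (ar t h) e = Comp (cat B) (ar t h') e"
        proof (rule S(4)[OF comp_in_hom[OF CB pull_hom[OF t h] e] comp_in_hom[OF CB pull_hom[OF t h'] e]])
          show "ar (w k) (Comp (cat B) (ar t h) e) = ar (w k) (Comp (cat B) (ar t h') e)" if k: "k \<in> I" for k
            unfolding comp[OF k h] comp[OF k h'] using eq[OF k] h h' by simp
        qed
      qed
    qed
  next
    assume U: "universal (cat A) I (\<lambda>_. cat A) (\<lambda>_. id_ftr (cat A)) (\<lambda>k. ob (w k) Y) c (\<lambda>k. ar (w k) e)"
    show "universal_arrow (cat A) (cat B) (On_ftr \<D> t) Y c e"
    proof (rule universalI)
      show "c \<in> Obj (cat A)" by (rule c)
      show "e \<in> hom (cat B) Y (ob t c)" by (rule e)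
      fix d assume d: "d \<in> Obj (cat A)"
      show "\<exists>h\<in>hom (cat A) c d. \<forall>i\<in>{()}. Comp (cat B) (ar t h) e = f i"
        if f: "\<And>i. i \<in> {()} \<Longrightarrow> f i \<in> hom (cat B) Y (ob t d)" for f
      proof -
        have f: "f () \<in> hom (cat B) Y (ob t d)" using f by simp
        have "ar (w k) (f ()) \<in> hom (cat A) (ob (w k) Y) (FOb (id_ftr (cat A)) d)" if "k \<in> I" for k
          using pull_hom[OF S(1)[OF that] f] obt[OF that d] d by simp
        from universal_factor[OF U d, of "\<lambda>k. ar (w k) (f ())", OF this]
        obtain h where h: "h \<in> hom (cat A) c d"
          "\<And>k. k \<in> I \<Longrightarrow> Comp (cat A) (FAr (id_ftr (cat A)) h) (ar (w k) e) = ar (w k) (f ())"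
          by blast
        have "Comp (cat B) (ar t h) e = f ()"
          by (rule S(4)[OF comp_in_hom[OF CB pull_hom[OF t h(1)] e] f])
            (use h comp[OF _ h(1)] in simp)
        then show ?thesis using h(1) by auto
      qed
      show "h = h'" if h: "h \<in> hom (cat A) c d" and h': "h' \<in> hom (cat A) c d"
        and eq: "\<And>i. i \<in> {()} \<Longrightarrow> Comp (cat B) (ar t h) e = Comp (cat B) (ar t h') e" for h h'
      proof (rule universal_eq[OF U id_ftr[OF CA] CA h h'])
        fix k assume k: "k \<in> I"
        show "Comp (cat A) (FAr (id_ftr (cat A)) h) (ar (w k) e) =
            Comp (cat A) (FAr (id_ftr (cat A)) h') (ar (w k) e)"
          using comp[OF k h] comp[OF k h'] eq h h' by simp
      qed
    qed
  qed
qed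

lemma small_coprod_desc:
  fixes I :: "'u set" and A B :: "('u, 'u) cat"
  assumes I: "small_set I" and A: "small_cat A" and B: "small_cat B"
    and u: "\<And>i. i \<in> I \<Longrightarrow> ftr_between A B (u i)"
  shows "\<exists>t. small_ftr_between (small_coprod I (\<lambda>_. A)) B t \<and>
    (\<forall>i\<in>I. t \<circ>\<^sub>F small_coprod_inj I (\<lambda>_. A) i = u i) \<and>
    (\<forall>i\<in>I. \<forall>a\<in>Obj A. FOb t (code (i, a)) = FOb (u i) a)"
proof -
  let ?A = "\<lambda>_::'u. A"
  let ?C = "small_coprod I ?A" and ?j = "small_coprod_inj I ?A"
  note xx = inj_code(1)[OF universe]
  note c = small_catD[OF A]
  note C = category_coprod[of I ?A, OF c]
  define d where "d = coprod_desc I ?A B u"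
  have d: "ftr_between (coprod_cat I ?A) B d" "\<And>i. i \<in> I \<Longrightarrow> d \<circ>\<^sub>F coprod_inj I ?A i = u i"
    using coprod_desc[of I ?A B u, OF c small_catD[OF B] u] by (simp_all add: d_def)
  note dec = decode_ftr_ftr[OF xx xx C]
  note enc = encode_ftr_ftr[OF xx xx C]
  define t :: "('u, 'u, 'u, 'u) ftr" where "t = d \<circ>\<^sub>F decode_ftr (coprod_cat I ?A)"
  have tf: "ftr_between ?C B t" unfolding t_def small_coprod_def by (rule fcomp[OF dec(1) d(1)])
  have tj: "t \<circ>\<^sub>F ?j i = u i" if i: "i \<in> I" for i
  proof -
    have ji: "ftr_between A (coprod_cat I ?A) (coprod_inj I ?A i)"
      by (rule coprod_inj_ftr[of I ?A, OF c i])
    have "t \<circ>\<^sub>F ?j i = d \<circ>\<^sub>F (decode_ftr (coprod_cat I ?A) \<circ>\<^sub>F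
        ((encode_ftr (coprod_cat I ?A) :: ('u \<times> 'u, 'u \<times> 'u, 'u, 'u) ftr) \<circ>\<^sub>F coprod_inj I ?A i))"
      unfolding t_def small_coprod_inj_def
      using fcomp_assoc[OF fcomp[OF ji enc] dec(1) d(1)] by simp
    also have "\<dots> = d \<circ>\<^sub>F coprod_inj I ?A i"
      using fcomp_assoc[OF ji enc dec(1)] dec(2) fcomp_id(1)[OF ji] by simp
    finally show ?thesis using d(2)[OF i] by simp
  qed
  have tob: "FOb t (code (i, a)) = FOb (u i) a" if "i \<in> I" "a \<in> Obj A" for i a
    using that xx fcomp_ob[OF dec(1), of "code (i, a)" d]
    by (simp add: t_def encode_simps[OF xx xx] coprod_simps) (simp add: decode_ftr_def d_def coprod_desc_def coprod_simps)
  have ts: "small_ftr_between ?C B t"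
    using tf B small_coprod_simps(1)[OF I A, of ?A, OF refl] by (simp add: small_ftr_between_def)
  show ?thesis by (intro exI[of _ t] conjI ballI ts tj tob)
qed

text \<open>
  The left Kan extension along the fold functor, which is the identity on each copy of \<open>A\<close>, supplies
  the coproduct.
\<close>

lemma coproducts_exist:
  fixes I :: "'u set"
  assumes I: "small_set I" and A: "small_cat A" and x: "\<And>i. i \<in> I \<Longrightarrow> x i \<in> Obj (cat A)"
  shows "\<exists>c \<iota>. is_coproduct (cat A) I x c \<iota>"
proof -
  let ?C = "small_coprod I (\<lambda>_. A)" and ?j = "small_coprod_inj I (\<lambda>_. A)"
  note spl = splits_small_coprod[OF I A]
  note S = splitsD[OF spl] and cA = category_cat[OF A]
  obtain t where t: "small_ftr_between ?C A t" and tj': "\<forall>i\<in>I. t \<circ>\<^sub>F ?j i = id_ftr A"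
    using small_coprod_desc[OF I A A, of "\<lambda>_. id_ftr A", OF id_ftr[OF small_catD[OF A]]]
    by (elim exE conjE)
  note tj = bspec[OF tj']
  obtain Y a where Y: "Y \<in> Obj (cat ?C)"
    and a: "\<forall>i\<in>I. a i \<in> hom (cat A) (ob (?j i) Y) (x i) \<and> iso (cat A) (a i)"
    using S(5)[of x] x by blast
  note adj = lkan_adjunction[OF t]
  note L = adjunction_ftr[OF adj pull_ftr[OF t]]
  let ?c = "FOb (lkan \<D> t) Y" and ?e = "Cmp (lkan_unit \<D> t) Y"
  have cop: "is_coproduct (cat A) I (\<lambda>i. ob (?j i) Y) ?c (\<lambda>i. ar (?j i) ?e)"
    using universal_arrow_iff_coproduct[OF spl t tj Y ftr_ob[OF L Y] adjunction_unit(2)[OF adj pull_ftr[OF t] Y]]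
      adjunction_unit_universal[OF adj pull_ftr[OF t] Y] by simp
  have a1: "\<And>i. i \<in> I \<Longrightarrow> inv_arr (cat A) (a i) \<in> hom (cat A) (x i) (ob (?j i) Y)"
    "\<And>i. i \<in> I \<Longrightarrow> iso (cat A) (inv_arr (cat A) (a i))"
    using inv_arr(1)[OF cA] iso_inv_arr[OF cA] a by blast+
  have "universal (cat A) I (\<lambda>_. cat A) (\<lambda>_. id_ftr (cat A)) x ?c
      (\<lambda>i. Comp (cat A) (ar (?j i) ?e) (inv_arr (cat A) (a i)))"
    by (rule universal_precomp_iso[OF cA id_ftr[OF cA] cop[unfolded is_coproduct_iff_universal[OF cA]] a1])
  then show ?thesis using is_coproduct_iff_universal[OF cA, of I x] by blast
qed

end

section \<open>Discrete diagrams and their cocones\<close>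

lemma discrete_hom:
  assumes "discrete S" "f \<in> hom S a b"
  shows "a = b" "f = Ident S a"
proof -
  have S: "category S" and "f \<in> Ident S ` Obj S"
    using assms unfolding discrete_def hom_def by auto
  then obtain c where c: "c \<in> Obj S" "f = Ident S c" by blast
  then show "a = b" "f = Ident S a"
    using id_in_hom[OF S c(1)] assms(2) by (auto simp: hom_def)
qed

lemma discrete_ftr_eq:
  assumes S: "discrete S" and F: "ftr_between S C F" and G: "ftr_between S C G"
    and eq: "\<And>a. a \<in> Obj S \<Longrightarrow> FOb F a = FOb G a"
  shows "F = G"
proof (rule ftr_eqI[OF F G eq])
  fix f assume f: "f \<in> Arr S"
  then obtain a where a: "a \<in> Obj S" "f = Ident S a" using S unfolding discrete_def by auto
  show "FAr F f = FAr G f" using eq[OF a(1)] ftr_ident[OF F a(1)] ftr_ident[OF G a(1)] a(2) by simp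
qed

context derivator
begin

text \<open>
  A discrete category is a coproduct of points, so this is (Der1) transported along an isomorphism of
  small categories.
\<close>

lemma splits_discrete:
  assumes S: "small_cat S" "discrete S"
  shows "splits (Obj S) one S (pick S)"
proof -
  let ?I = "Obj S" and ?A = "\<lambda>_::'u. one :: ('u, 'u) cat"
  let ?C = "small_coprod ?I ?A" and ?j = "small_coprod_inj ?I ?A"
  have I: "small_set ?I" using S by (simp add: small_cat_def)
  note xx = inj_code(1)[OF universe] and Sc = small_catD[OF S(1)]
  note cs = small_coprod_simps[OF I small_one, of ?A, OF refl]
  have p: "ftr_between one S (pick S s :: ('u, 'u, 'u, 'u) ftr)" if "s \<in> ?I" for s
    by (rule pick_ftr[OF Sc that])
  have "\<exists>\<phi>. small_ftr_between ?C S \<phi> \<and> (\<forall>s\<in>?I. \<phi> \<circ>\<^sub>F ?j s = pick S s) \<and>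
      (\<forall>s\<in>?I. \<forall>a\<in>Obj (one :: ('u, 'u) cat). FOb \<phi> (code (s, a)) = FOb (pick S s) a)"
    by (rule small_coprod_desc[OF I small_one S(1) p])
  then obtain \<phi> where \<phi>1: "small_ftr_between ?C S \<phi>" and \<phi>2: "\<forall>s\<in>?I. \<phi> \<circ>\<^sub>F ?j s = pick S s"
    and \<phi>3: "\<forall>s\<in>?I. \<forall>a\<in>Obj (one :: ('u, 'u) cat). FOb \<phi> (code (s, a)) = FOb (pick S s) a"
    by (elim exE conjE)
  note \<phi> = \<phi>1 bspec[OF \<phi>2] and \<phi>ob = bspec[OF bspec[OF \<phi>3]]
  note C = category_coprod[of ?I ?A, OF category_one]
  define \<psi>0 :: "('u, 'u, 'u \<times> 'u, 'u \<times> 'u) ftr" where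
    "\<psi>0 = \<lparr>Src = S, Tgt = coprod_cat ?I ?A, FOb = (\<lambda>s\<in>?I. (s, undefined)),
      FAr = (\<lambda>f\<in>Arr S. (Dom S f, undefined))\<rparr>"
  have \<psi>0: "ftr_between S (coprod_cat ?I ?A) \<psi>0"
  proof (rule ftr_betweenI[OF Sc C])
    show "FAr \<psi>0 f \<in> hom (coprod_cat ?I ?A) (FOb \<psi>0 a) (FOb \<psi>0 b)" if "f \<in> hom S a b" for a b f
      using that hom_dom_in[OF Sc that] discrete_hom[OF S(2) that]
      by (auto simp: \<psi>0_def hom_def coprod_simps one_simps)
    show "FAr \<psi>0 (Ident S a) = Ident (coprod_cat ?I ?A) (FOb \<psi>0 a)" if "a \<in> ?I" for a
      using that id_in_hom[OF Sc that] by (simp add: \<psi>0_def hom_def coprod_simps one_simps)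
    show "FAr \<psi>0 (Comp S g f) = Comp (coprod_cat ?I ?A) (FAr \<psi>0 g) (FAr \<psi>0 f)"
      if g: "g \<in> hom S b c" and f: "f \<in> hom S a b" for a b c f g
    proof -
      have "Dom S f = Dom S g" using discrete_hom(1)[OF S(2) f] f g by (simp add: hom_def)
      moreover have "Dom S f \<in> ?I" using hom_dom_in[OF Sc f] f by (simp add: hom_def)
      ultimately show ?thesis
        using comp_in_hom[OF Sc g f] f g by (simp add: \<psi>0_def hom_def coprod_simps one_simps)
    qed
  qed (auto simp: \<psi>0_def coprod_simps one_simps)
  define \<psi> :: "('u, 'u, 'u, 'u) ftr" where "\<psi> = encode_ftr (coprod_cat ?I ?A) \<circ>\<^sub>F \<psi>0"
  have \<psi>f: "ftr_between S ?C \<psi>"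
    unfolding \<psi>_def small_coprod_def by (rule fcomp[OF \<psi>0 encode_ftr_ftr[OF xx xx C]])
  then have \<psi>: "small_ftr_between S ?C \<psi>" using S(1) cs(1) by (simp add: small_ftr_between_def)
  have \<psi>ob: "FOb \<psi> s = code (s, undefined :: 'u)" if "s \<in> ?I" for s
    using that fcomp_ob[OF \<psi>0 that] by (simp add: \<psi>_def \<psi>0_def encode_ftr_def coprod_simps one_simps)
  show ?thesis
  proof (rule splits_retract[OF splits_small_coprod[OF I small_one] \<phi>(1) \<psi>])
    show "\<phi> \<circ>\<^sub>F \<psi> = id_ftr S"
    proof (rule discrete_ftr_eq[OF S(2) fcomp[OF \<psi>f small_ftr_betweenD(1)[OF \<phi>(1)]] id_ftr[OF Sc]])
      show "FOb (\<phi> \<circ>\<^sub>F \<psi>) a = FOb (id_ftr S) a" if "a \<in> ?I" for a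
        using that fcomp_ob[OF \<psi>f that, of \<phi>] \<psi>ob \<phi>ob[OF that, of undefined] by (simp add: one_simps)
    qed
    show "\<phi> \<circ>\<^sub>F ?j s = pick S s" if "s \<in> ?I" for s by (rule \<phi>(2)[OF that])
    show "\<psi> \<circ>\<^sub>F pick S s = ?j s" if s: "s \<in> ?I" for s
    proof -
      have j: "ftr_between one ?C (?j s)" using small_ftr_betweenD(1)[OF cs(2)[OF s]] .
      have "FOb (?j s) undefined = code (s, undefined :: 'u)"
        using s by (simp add: small_coprod_inj_def fcomp_def compose_def coprod_inj_def one_simps
            encode_ftr_def coprod_simps)
      then show ?thesis using pick_unique[OF j] fcomp_pick[OF \<psi>f s] \<psi>ob[OF s] by simp
    qed
  qed
qed

end

locale discrete_diagrams = derivator \<D> for \<D> :: "('u, 'o, 'm) prederivator" +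
  fixes S :: "('u, 'u) cat"
  assumes small_S: "small_cat S" and discrete_S: "discrete S"
begin

abbreviation incl :: "('u, 'u, 'u, 'u) ftr" where
  "incl \<equiv> small_cocone_incl S"

abbreviation apex :: "('u, 'u, 'u, 'u) ftr" where
  "apex \<equiv> pick (S\<rhd>) tip"

abbreviation leg :: "'u \<Rightarrow> ('u, 'u, 'u, 'u) ftr" where
  "leg s \<equiv> pick (S\<rhd>) (FOb incl s)"

abbreviation collapse :: "('u, 'u, 'u, 'u) ftr" where
  "collapse \<equiv> to_one (S\<rhd>)"

abbreviation to_apex :: "('u, 'u, 'u, 'u) nt" where
  "to_apex \<equiv> to_terminal (S\<rhd>) tip"

abbreviation leg_to_apex :: "'u \<Rightarrow> ('u, 'u, 'u, 'u) nt" where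
  "leg_to_apex s \<equiv> to_apex \<star>\<^sub>r leg s"

lemmas cocone = small_cocone[OF universe small_S]

lemma tip_ob: "tip \<in> Obj (S\<rhd>)" and incl_ob: "s \<in> Obj S \<Longrightarrow> FOb incl s \<in> Obj (S\<rhd>)"
  by (auto simp: cocone(3))

lemma small_incl: "small_ftr_between S (S\<rhd>) incl"
  using cocone small_S by (simp add: small_ftr_between_def)

lemma small_apex: "small_ftr_between one (S\<rhd>) apex"
  by (rule small_pick[OF cocone(1) tip_ob])

lemma small_leg: "s \<in> Obj S \<Longrightarrow> small_ftr_between one (S\<rhd>) (leg s)"
  by (rule small_pick[OF cocone(1) incl_ob])

lemma small_collapse: "small_ftr_between (S\<rhd>) one collapse"
  by (rule small_to_one[OF cocone(1)])

lemma small_pick_S: "s \<in> Obj S \<Longrightarrow> small_ftr_between one S (pick S s)"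
  by (rule small_pick[OF small_S])

lemma small_to_one_S: "small_ftr_between S one (to_one S)"
  by (rule small_to_one[OF small_S])

lemma incl_pick: "s \<in> Obj S \<Longrightarrow> incl \<circ>\<^sub>F pick S s = leg s"
  by (rule fcomp_pick[OF cocone(2)])

lemma collapse_incl: "collapse \<circ>\<^sub>F incl = to_one S"
  by (rule to_one_fcomp[OF cocone(2)])

lemma to_one_S_pick: "s \<in> Obj S \<Longrightarrow> to_one S \<circ>\<^sub>F pick S s = (id_ftr one :: ('u, 'u, 'u, 'u) ftr)"
  by (rule to_one_pick[OF small_catD[OF small_S]])

lemma leg_ob: "s \<in> Obj S \<Longrightarrow> X \<in> Obj (cat (S\<rhd>)) \<Longrightarrow> ob (leg s) X = ob (pick S s) (ob incl X)"
  using pull_fcomp_ob[OF small_pick_S small_incl] incl_pick by simp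

lemma leg_ar: "s \<in> Obj S \<Longrightarrow> f \<in> hom (cat (S\<rhd>)) X Y \<Longrightarrow> ar (leg s) f = ar (pick S s) (ar incl f)"
  using pull_fcomp_hom[OF small_pick_S small_incl] incl_pick by simp

lemmas to_apex = to_terminal[OF small_catD[OF cocone(1)] tip_ob cocone(4)]

lemma collapse_leg: "s \<in> Obj S \<Longrightarrow> collapse \<circ>\<^sub>F leg s = (id_ftr one :: ('u, 'u, 'u, 'u) ftr)"
  by (rule to_one_pick[OF small_catD[OF cocone(1)] incl_ob])

lemma collapse_apex: "collapse \<circ>\<^sub>F apex = (id_ftr one :: ('u, 'u, 'u, 'u) ftr)"
  by (rule to_one_pick[OF small_catD[OF cocone(1)] tip_ob])

lemma to_apex_hom:
  assumes X: "X \<in> Obj (cat (S\<rhd>))"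
  shows "tr to_apex X \<in> hom (cat (S\<rhd>)) X (ob collapse (ob apex X))"
  using nt_hom[OF pull_nt[OF to_apex(1) small_ftr_between_id[OF cocone(1)]] pull_ftr[OF small_ftr_between_id[OF cocone(1)]] X]
    pull_id[OF cocone(1)] X pull_fcomp_ob[OF small_collapse small_apex X] by simp

lemma to_apex_natural:
  assumes f: "f \<in> hom (cat (S\<rhd>)) X Y"
  shows "Comp (cat (S\<rhd>)) (tr to_apex Y) f = Comp (cat (S\<rhd>)) (ar collapse (ar apex f)) (tr to_apex X)"
  using nt_natural[OF pull_nt[OF to_apex(1) small_ftr_between_id[OF cocone(1)]] pull_ftr[OF small_ftr_between_id[OF cocone(1)]] f]
    pull_id[OF cocone(1)] f pull_fcomp_hom[OF small_collapse small_apex f] by simp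

lemma leg_to_apex:
  assumes s: "s \<in> Obj S"
  shows "nt_between (leg s) apex (leg_to_apex s)"
proof -
  note l = small_ftr_betweenD(1)[OF small_leg[OF s]]
  note c = small_ftr_betweenD(1)[OF small_collapse] and a = small_ftr_betweenD(1)[OF small_apex]
  note I = id_ftr[OF small_catD[OF cocone(1)]]
  have "(apex \<circ>\<^sub>F collapse) \<circ>\<^sub>F leg s = (apex :: ('u, 'u, 'u, 'u) ftr)"
    using fcomp_assoc[OF l c a] collapse_leg[OF s] fcomp_id(2)[OF a]
    by simp
  then show ?thesis
    using whisker_right[OF to_apex(1) l I] fcomp_id(1)[OF l] by simp
qed

lemma leg_to_apex_tr:
  "s \<in> Obj S \<Longrightarrow> X \<in> Obj (cat (S\<rhd>)) \<Longrightarrow> tr (leg_to_apex s) X = ar (leg s) (tr to_apex X)"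
  by (rule pull_whisker_right[OF to_apex(1) small_leg small_ftr_between_id[OF cocone(1)]])

lemma collapse_apex_ob:
  assumes "d \<in> Obj (cat one)"
  shows "ob apex (ob collapse d) = d"
  using pull_fcomp_ob[OF small_apex small_collapse assms]
    collapse_apex pull_id[OF small_one] assms by simp

lemma collapse_apex_ar:
  assumes "f \<in> hom (cat one) c d"
  shows "ar apex (ar collapse f) = f"
  using pull_fcomp_hom[OF small_apex small_collapse assms]
    collapse_apex pull_id[OF small_one] assms by simp

text \<open>
  The apex is terminal in the cocone, so evaluating there computes the colimit of a diagram on the
  cocone. The inverse to composition with the unit is restriction along \<open>apex\<close>.
\<close>

lemma apex_universal:
  assumes X: "X \<in> Obj (cat (S\<rhd>))"
  shows "universal_arrow (cat one) (cat (S\<rhd>)) (On_ftr \<D> collapse) X (ob apex X) (tr to_apex X)"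
proof (rule universalI)
  note CC = category_cat[OF cocone(1)] and C1 = category_cat[OF small_one]
  note pa = pull_ftr[OF small_apex]
  show aX: "ob apex X \<in> Obj (cat one)" by (rule pull_ob[OF small_apex X])
  note t = to_apex_hom[OF X]
  show "tr to_apex X \<in> hom (cat (S\<rhd>)) X (ob collapse (ob apex X))" by (rule t)
  fix d assume d: "d \<in> Obj (cat one)"
  note cd = pull_ob[OF small_collapse d]
  have unit_d: "tr to_apex (ob collapse d) = Ident (cat (S\<rhd>)) (ob collapse d)"
    using pull_whisker_left[OF to_apex(1) small_ftr_between_id[OF cocone(1)] small_collapse d]
      to_apex(2) pull_id_nt_cmp[OF small_collapse d] by simp
  have unit_X: "ar apex (tr to_apex X) = Ident (cat one) (ob apex X)"
    using pull_whisker_right[OF to_apex(1) small_apex small_ftr_between_id[OF cocone(1)] X]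
      to_apex(3) pull_id_nt_cmp[OF small_apex X] by simp
  show "\<exists>h\<in>hom (cat one) (ob apex X) d. \<forall>i\<in>{()}. Comp (cat (S\<rhd>)) (ar collapse h) (tr to_apex X) = f i"
    if f': "\<And>i. i \<in> {()} \<Longrightarrow> f i \<in> hom (cat (S\<rhd>)) X (ob collapse d)" for f
  proof -
    have f: "f () \<in> hom (cat (S\<rhd>)) X (ob collapse d)" using f' by simp
    have "ar apex (f ()) \<in> hom (cat one) (ob apex X) d"
      using pull_hom[OF small_apex f] collapse_apex_ob[OF d] by simp
    moreover have "Comp (cat (S\<rhd>)) (ar collapse (ar apex (f ()))) (tr to_apex X) = f ()"
      using to_apex_natural[OF f] unit_d comp_id_left[OF CC f] by simp
    ultimately show ?thesis by auto
  qed
  show "h = h'" if h: "h \<in> hom (cat one) (ob apex X) d" and h': "h' \<in> hom (cat one) (ob apex X) d"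
    and eq: "\<And>i. i \<in> {()} \<Longrightarrow> Comp (cat (S\<rhd>)) (ar collapse h) (tr to_apex X) =
      Comp (cat (S\<rhd>)) (ar collapse h') (tr to_apex X)" for h h'
  proof -
    have *: "ar apex (Comp (cat (S\<rhd>)) (ar collapse k) (tr to_apex X)) = k"
      if k: "k \<in> hom (cat one) (ob apex X) d" for k
      using ftr_comp[OF pa pull_hom[OF small_collapse k] t] collapse_apex_ar[OF k] unit_X
        comp_id_right[OF C1 k] by simp
    show ?thesis using arg_cong[OF eq[of "()"], of "ar apex"] *[OF h] *[OF h'] by simp
  qed
qed

text \<open>
  The internal notion of coproduct cocone asks for a left Kan extension. This is its external form, a
  coproduct in the value at the point; \<open>colimiting_cocone_iff\<close> identifies the two.
\<close>

definition coproduct_cocone :: "'o \<Rightarrow> bool" where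
  "coproduct_cocone X \<longleftrightarrow>
     is_coproduct (cat one) (Obj S) (\<lambda>s. ob (leg s) X) (ob apex X) (\<lambda>s. tr (leg_to_apex s) X)"

lemma leg_to_apex_hom:
  assumes s: "s \<in> Obj S" and X: "X \<in> Obj (cat (S\<rhd>))"
  shows "tr (leg_to_apex s) X \<in> hom (cat one) (ob (leg s) X) (ob apex X)"
  by (rule nt_hom[OF pull_nt[OF leg_to_apex[OF s] small_leg[OF s]] pull_ftr[OF small_leg[OF s]] X])

lemma leg_to_apex_natural:
  assumes s: "s \<in> Obj S" and f: "f \<in> hom (cat (S\<rhd>)) X Y"
  shows "Comp (cat one) (tr (leg_to_apex s) Y) (ar (leg s) f) =
    Comp (cat one) (ar apex f) (tr (leg_to_apex s) X)"
  by (rule nt_natural[OF pull_nt[OF leg_to_apex[OF s] small_leg[OF s]] pull_ftr[OF small_leg[OF s]] f])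

lemmas splits_S = splits_discrete[OF small_S discrete_S]

lemma colim_coproduct:
  assumes Y: "Y \<in> Obj (cat S)"
  shows "is_coproduct (cat one) (Obj S) (\<lambda>s. ob (pick S s) Y) (FOb (lkan \<D> (to_one S)) Y)
    (\<lambda>s. ar (pick S s) (Cmp (lkan_unit \<D> (to_one S)) Y))"
proof -
  note adj = lkan_adjunction[OF small_to_one_S] and t = pull_ftr[OF small_to_one_S]
  show ?thesis
    using universal_arrow_iff_coproduct[OF splits_S small_to_one_S to_one_S_pick Y
        ftr_ob[OF adjunction_ftr[OF adj t] Y] adjunction_unit(2)[OF adj t Y]]
      adjunction_unit_universal[OF adj t Y] by simp
qed

lemma iso_on_cocone:
  assumes f: "f \<in> hom (cat (S\<rhd>)) X Y"
  shows "iso (cat (S\<rhd>)) f \<longleftrightarrow> (\<forall>s\<in>Obj S. iso (cat one) (ar (leg s) f)) \<and> iso (cat one) (ar apex f)"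
  using iso_pointwise[OF cocone(1) f] by (auto simp: cocone(3))

text \<open>
  Restriction along \<open>to_one S\<close> is restriction along \<open>collapse\<close> followed by restriction along \<open>incl\<close>, so
  composing the universal arrows for the latter two yields one for the former, that is, a
  coproduct.
\<close>

lemma coproduct_of_universal:
  assumes U: "universal_arrow (cat (S\<rhd>)) (cat S) (On_ftr \<D> incl) Y X e" and Y: "Y \<in> Obj (cat S)"
  shows "is_coproduct (cat one) (Obj S) (\<lambda>s. ob (pick S s) Y) (ob apex X)
    (\<lambda>s. Comp (cat one) (tr (leg_to_apex s) X) (ar (pick S s) e))"
proof -
  note X = universal_ob[OF U]
  have e: "e \<in> hom (cat S) Y (ob incl X)" using universal_hom[OF U] by simp
  note t = to_apex_hom[OF X]
  note it = pull_hom[OF small_incl t]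
  have icd: "ob incl (ob collapse d) = ob (to_one S) d" if "d \<in> Obj (cat one)" for d
    using pull_fcomp_ob[OF small_incl small_collapse that] collapse_incl by simp
  note aX = pull_ob[OF small_apex X]
  have c: "Comp (cat S) (ar incl (tr to_apex X)) e \<in> hom (cat S) Y (ob (to_one S) (ob apex X))"
    using comp_in_hom[OF category_cat[OF small_S] it e] icd[OF aX] by simp
  have "universal_arrow (cat one) (cat S) (On_ftr \<D> (to_one S)) Y (ob apex X)
      (Comp (cat S) (ar incl (tr to_apex X)) e)"
    using universal_arrow_compose[OF pull_ftr[OF small_incl] pull_ftr[OF small_collapse] U apex_universal[OF X]]
      pull_fcomp[OF small_incl small_collapse] collapse_incl by simp
  then have cop: "is_coproduct (cat one) (Obj S) (\<lambda>s. ob (pick S s) Y) (ob apex X)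
      (\<lambda>s. ar (pick S s) (Comp (cat S) (ar incl (tr to_apex X)) e))"
    using universal_arrow_iff_coproduct[OF splits_S small_to_one_S to_one_S_pick Y aX c] by simp
  have eq: "ar (pick S s) (Comp (cat S) (ar incl (tr to_apex X)) e) =
      Comp (cat one) (tr (leg_to_apex s) X) (ar (pick S s) e)" if s: "s \<in> Obj S" for s
    using ftr_comp[OF pull_ftr[OF small_pick_S[OF s]] it e] leg_to_apex_tr[OF s X] leg_ar[OF s t] by simp
  show ?thesis by (rule coproduct_cong[OF cop refl eq])
qed

abbreviation ext :: "'o \<Rightarrow> 'o" where
  "ext Y \<equiv> FOb (lkan \<D> incl) Y"

abbreviation ext_unit :: "'o \<Rightarrow> 'm" where
  "ext_unit Y \<equiv> Cmp (lkan_unit \<D> incl) Y"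

lemma ext:
  assumes Y: "Y \<in> Obj (cat S)"
  shows "ext Y \<in> Obj (cat (S\<rhd>))" "ext_unit Y \<in> hom (cat S) Y (ob incl (ext Y))"
    "universal_arrow (cat (S\<rhd>)) (cat S) (On_ftr \<D> incl) Y (ext Y) (ext_unit Y)"
proof -
  note adj = lkan_adjunction[OF small_incl] and p = pull_ftr[OF small_incl]
  show "ext Y \<in> Obj (cat (S\<rhd>))" by (rule ftr_ob[OF adjunction_ftr[OF adj p] Y])
  show "ext_unit Y \<in> hom (cat S) Y (ob incl (ext Y))" by (rule adjunction_unit(2)[OF adj p Y])
  show "universal_arrow (cat (S\<rhd>)) (cat S) (On_ftr \<D> incl) Y (ext Y) (ext_unit Y)"
    by (rule adjunction_unit_universal[OF adj p Y])
qed

text \<open>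
  Left Kan extension along \<open>incl\<close> is fully faithful. It is enough to look at one object \<open>s\<close> at a time, and
  there (Der4) applies: the slice over the image of \<open>s\<close> is terminal, so the mate asserts that the unit at
  \<open>s\<close> is universal for restriction along an isomorphism of categories, and such arrows are
  invertible.
\<close>

lemma ext_unit_iso:
  assumes Y: "Y \<in> Obj (cat S)"
  shows "iso (cat S) (ext_unit Y)"
proof -
  note C1 = category_cat[OF small_one]
  have "iso (cat one) (ar (pick S s) (ext_unit Y))" if s: "s \<in> Obj S" for s
  proof -
    let ?b = "FOb incl s" and ?X = "ext Y" and ?g0 = "ext_unit Y"
    let ?T = "small_slice_over incl ?b"
    let ?t = "to_one ?T :: ('u, 'u, 'u, 'u) ftr"
    let ?p = "small_slice_over_proj incl ?b"
    note Sc = small_catD[OF small_S]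
    have homS: "hom S s s = {Ident S s}"
      using discrete_hom(2)[OF discrete_S] id_in_hom[OF Sc s] by blast
    have isolated: "\<forall>a'\<in>Obj S. \<forall>f\<in>hom (S\<rhd>) (FOb incl a') ?b. a' = s \<and> f = Ident (S\<rhd>) ?b"
    proof (intro ballI)
      fix a' f assume a': "a' \<in> Obj S" and f: "f \<in> hom (S\<rhd>) (FOb incl a') ?b"
      obtain g where g: "g \<in> hom S a' s" "f = FAr incl g" using cocone(5)[OF a' s f] by blast
      show "a' = s \<and> f = Ident (S\<rhd>) ?b"
        using discrete_hom[OF discrete_S g(1)] g(2) ftr_ident[OF cocone(2) s] by simp
    qed
    note sl = small_slice_over_singleton[OF universe cocone(2) s homS isolated]
    obtain z where z: "Obj ?T = {z}" "pick ?T z \<circ>\<^sub>F ?t = id_ftr ?T" using sl(1) by blast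
    have zT: "z \<in> Obj ?T" by (simp add: z)
    let ?w = "pick ?T z :: ('u, 'u, 'u, 'u) ftr"
    have t: "small_ftr_between ?T one ?t" by (rule small_to_one[OF sl(2)])
    have w: "small_ftr_between one ?T ?w" by (rule small_pick[OF sl(2) zT])
    have tw: "?t \<circ>\<^sub>F ?w = id_ftr one" by (rule to_one_pick[OF small_catD[OF sl(2)] zT])
    note ps = small_pick_S[OF s]
    have p: "small_ftr_between ?T S ?p" unfolding sl(3) by (rule small_ftr_between_comp[OF t ps])
    have pw: "?p \<circ>\<^sub>F ?w = pick S s"
      unfolding sl(3)
      using fcomp_assoc[OF small_ftr_betweenD(1)[OF w] small_ftr_betweenD(1)[OF t] small_ftr_betweenD(1)[OF ps]]
        tw fcomp_id(2)[OF small_ftr_betweenD(1)[OF ps]] by simp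
    note l = small_leg[OF s]
    have ip: "small_ftr_between ?T (S\<rhd>) (incl \<circ>\<^sub>F ?p)" by (rule small_ftr_between_comp[OF p small_incl])
    have lt: "incl \<circ>\<^sub>F ?p = leg s \<circ>\<^sub>F ?t"
      unfolding sl(3)
      using fcomp_assoc[OF small_ftr_betweenD(1)[OF t] small_ftr_betweenD(1)[OF ps] cocone(2)] incl_pick[OF s]
      by simp
    have \<delta>: "nt_between (On_ftr \<D> ?p \<circ>\<^sub>F On_ftr \<D> incl) (On_ftr \<D> ?t \<circ>\<^sub>F On_ftr \<D> (leg s))
        (On_nt \<D> (small_slice_over_nt incl ?b))"
      using pull_nt[OF id_nt[OF small_ftr_betweenD(1)[OF ip]] ip] sl(4)
        pull_fcomp[OF p small_incl] pull_fcomp[OF t l] lt by simp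
    note X = ext(1)[OF Y] and g0 = ext(2)[OF Y]
    have \<delta>X: "tr (small_slice_over_nt incl ?b) ?X = Ident (cat ?T) (ob ?p (ob incl ?X))"
      unfolding sl(4) using pull_id_nt_cmp[OF ip X] pull_fcomp_ob[OF p small_incl X] by simp
    have mate: "nat_iso (slice_mate_left \<D> incl ?b)"
      using derivator small_ftr_betweenD(4)[OF small_incl] cocone(2) incl_ob[OF s]
      by (auto simp: is_derivator_def Der4_def ftr_between_def)
    define g where "g = ar ?p ?g0"
    have obl: "ob (leg s) ?X = ob (pick S s) (ob incl ?X)" by (rule leg_ob[OF s X])
    have obp: "ob ?p Y' = ob ?t (ob (pick S s) Y')" if "Y' \<in> Obj (cat S)" for Y'
      unfolding sl(3) by (rule pull_fcomp_ob[OF t ps that])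
    have arp: "ar ?p f = ar ?t (ar (pick S s) f)" if "f \<in> hom (cat S) Y' Y''" for f Y' Y''
      unfolding sl(3) by (rule pull_fcomp_hom[OF t ps that])
    have g: "g \<in> hom (cat ?T) (ob ?p Y) (ob ?p (ob incl ?X))"
      unfolding g_def by (rule pull_hom[OF p g0])
    have tX: "Tgt incl = S\<rhd>" using cocone(2) by (simp add: ftr_between_def)
    note CT = category_cat[OF sl(2)]
    have "\<forall>y\<in>Obj (cat S). universal_arrow (cat one) (cat ?T) (On_ftr \<D> ?t) (ob ?p y) (ob (leg s) (ext y))
        (Comp (cat ?T) (tr (small_slice_over_nt incl ?b) (ext y)) (ar ?p (ext_unit y)))"
      using mate
        nat_iso_mate_iff[OF lkan_adjunction[OF small_incl] pull_ftr[OF small_incl] lkan_adjunction[OF t]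
          pull_ftr[OF t] pull_ftr[OF p] pull_ftr[OF l] \<delta>]
      unfolding slice_mate_left_def Let_def tX by blast
    from bspec[OF this Y] have U: "universal_arrow (cat one) (cat ?T) (On_ftr \<D> ?t) (ob ?p Y) (ob (leg s) ?X) g"
      unfolding \<delta>X g_def[symmetric] comp_id_left[OF CT g] .
    note sY = pull_ob[OF ps Y]
    have idp: "Ident (cat ?T) (ob ?p Y) \<in> hom (cat ?T) (ob ?p Y) (ob ?t (ob (pick S s) Y))"
      using id_in_hom[OF CT pull_ob[OF p Y]] obp[OF Y] by simp
    \<comment> \<open>Factoring the identity through the universal arrow produces the inverse.\<close>
    obtain h where h: "h \<in> hom (cat one) (ob (leg s) ?X) (ob (pick S s) Y)"
      "Comp (cat ?T) (ar ?t h) g = Ident (cat ?T) (ob ?p Y)"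
      using universal_factor[OF U sY, of "\<lambda>_. Ident (cat ?T) (ob ?p Y)"] idp by auto
    let ?k = "ar (pick S s) ?g0"
    have k: "?k \<in> hom (cat one) (ob (pick S s) Y) (ob (leg s) ?X)"
      using pull_hom[OF ps g0] obl by simp
    have wt: "ar ?w (ar ?t f) = f" if "f \<in> hom (cat one) c d" for f c d
      using pull_fcomp_hom[OF w t that] tw pull_id[OF small_one] that by simp
    have wg: "ar ?w g = ?k"
      unfolding g_def using pull_fcomp_hom[OF w p g0] pw by simp
    have gt: "g = ar ?t ?k" unfolding g_def by (rule arp[OF g0])
    have "ar ?w (Comp (cat ?T) (ar ?t h) g) = Comp (cat one) h ?k"
      unfolding gt ftr_comp[OF pull_ftr[OF t] h(1) k, symmetric] by (rule wt[OF comp_in_hom[OF C1 h(1) k]])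
    moreover have "ar ?w (Ident (cat ?T) (ob ?p Y)) = Ident (cat one) (ob (pick S s) Y)"
      using ftr_ident[OF pull_ftr[OF w] pull_ob[OF p Y]] pull_fcomp_ob[OF w p Y] pw by simp
    ultimately have hk: "Comp (cat one) h ?k = Ident (cat one) (ob (pick S s) Y)" using h(2) by simp
    have tk: "ar ?t ?k \<in> hom (cat ?T) (ob ?t (ob (pick S s) Y)) (ob ?t (ob (leg s) ?X))"
      by (rule pull_hom[OF t k])
    note lX = pull_ob[OF l X]
    have kh: "Comp (cat one) ?k h = Ident (cat one) (ob (leg s) ?X)"
    proof (rule universal_eq[OF U pull_ftr[OF t] C1 comp_in_hom[OF C1 k h(1)] id_in_hom[OF C1 lX]])
      have g': "g \<in> hom (cat ?T) (ob ?p Y) (ob ?t (ob (leg s) ?X))" using universal_hom[OF U] by simp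
      have "Comp (cat ?T) (ar ?t (Comp (cat one) ?k h)) g = Comp (cat ?T) (ar ?t ?k) (Comp (cat ?T) (ar ?t h) g)"
        unfolding ftr_comp[OF pull_ftr[OF t] k h(1)]
        by (rule comp_assoc[OF CT tk pull_hom[OF t h(1)] g', symmetric])
      also have "\<dots> = g"
        unfolding h(2) gt[symmetric] by (rule comp_id_right[OF CT g])
      also have "\<dots> = Comp (cat ?T) (ar ?t (Ident (cat one) (ob (leg s) ?X))) g"
        using ftr_ident[OF pull_ftr[OF t] lX] comp_id_left[OF CT g'] by simp
      finally show "Comp (cat ?T) (ar ?t (Comp (cat one) ?k h)) g =
          Comp (cat ?T) (ar ?t (Ident (cat one) (ob (leg s) ?X))) g" .
    qed
    show ?thesis by (rule isoI[OF k h(1) hk kh])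
  qed
  then show ?thesis using iso_pointwise[OF small_S ext(2)[OF Y]] by simp
qed

text \<open>
  The comparison from the extension of \<open>Y\<close> to \<open>X\<close> is invertible if and only if it is so at every object of
  the cocone. At the legs it is \<open>e\<close>, up to the invertible unit of the extension; at the apex it compares the
  vertices of two cocones on isomorphic families, the first of which is a coproduct.
\<close>

lemma universal_along_incl_iff:
  assumes X: "X \<in> Obj (cat (S\<rhd>))" and e: "e \<in> hom (cat S) Y (ob incl X)"
  shows "universal_arrow (cat (S\<rhd>)) (cat S) (On_ftr \<D> incl) Y X e \<longleftrightarrow>
    iso (cat S) e \<and> coproduct_cocone X"
proof -
  note CS = category_cat[OF small_S] and CC = category_cat[OF cocone(1)] and C1 = category_cat[OF small_one]
  note pi = pull_ftr[OF small_incl]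
  note Y = hom_dom_in[OF CS e]
  have legs_of_universal: "coproduct_cocone Z"
    if U: "universal_arrow (cat (S\<rhd>)) (cat S) (On_ftr \<D> incl) Y Z k" and k: "iso (cat S) k" for Z k
  proof -
    note Z = universal_ob[OF U]
    have kh: "k \<in> hom (cat S) Y (ob incl Z)" using universal_hom[OF U] by simp
    show ?thesis
      unfolding coproduct_cocone_def
    proof (rule iffD2[OF coproduct_square_source[OF C1 coproduct_of_universal[OF U Y]]])
      show "ar (pick S s) k \<in> hom (cat one) (ob (pick S s) Y) (ob (leg s) Z)" if "s \<in> Obj S" for s
        using pull_hom[OF small_pick_S[OF that] kh] leg_ob[OF that Z] by simp
      show "iso (cat one) (ar (pick S s) k)" if "s \<in> Obj S" for s
        by (rule pull_iso[OF small_pick_S[OF that] kh k])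
      show idh: "Ident (cat one) (ob apex Z) \<in> hom (cat one) (ob apex Z) (ob apex Z)"
        by (rule id_in_hom[OF C1 pull_ob[OF small_apex Z]])
      show "tr (leg_to_apex s) Z \<in> hom (cat one) (ob (leg s) Z) (ob apex Z)" if "s \<in> Obj S" for s
        by (rule leg_to_apex_hom[OF that Z])
      show "Comp (cat one) (Ident (cat one) (ob apex Z))
          (Comp (cat one) (tr (leg_to_apex s) Z) (ar (pick S s) k)) =
          Comp (cat one) (tr (leg_to_apex s) Z) (ar (pick S s) k)" if s: "s \<in> Obj S" for s
        by (rule comp_id_left[OF C1 coproduct_hom[OF coproduct_of_universal[OF U Y] s]])
      show "iso (cat one) (Ident (cat one) (ob apex Z))"
        by (rule iso_ident[OF C1 pull_ob[OF small_apex Z]])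
    qed
  qed
  note U0 = ext(3)[OF Y] and e0 = ext(2)[OF Y] and i0 = ext_unit_iso[OF Y] and X0 = ext(1)[OF Y]
  obtain h where h: "h \<in> hom (cat (S\<rhd>)) (ext Y) X" "Comp (cat S) (ar incl h) (ext_unit Y) = e"
    using universal_factor[OF U0 X, of "\<lambda>_. e"] e by auto
  have U_iff: "universal_arrow (cat (S\<rhd>)) (cat S) (On_ftr \<D> incl) Y X e \<longleftrightarrow> iso (cat (S\<rhd>)) h"
  proof (rule universal_square_source[OF CC pi U0])
    show "Ident (cat S) Y \<in> hom (cat S) Y Y" "iso (cat S) (Ident (cat S) Y)"
      by (rule id_in_hom[OF CS Y], rule iso_ident[OF CS Y])
    show "Comp (cat S) (ar incl h) (ext_unit Y) = Comp (cat S) e (Ident (cat S) Y)"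
      unfolding h(2) by (rule comp_id_right[OF CS e, symmetric])
  qed (rule h(1), rule e)
  note ih = pull_hom[OF small_incl h(1)]
  show ?thesis
  proof
    assume U: "universal_arrow (cat (S\<rhd>)) (cat S) (On_ftr \<D> incl) Y X e"
    then have "iso (cat (S\<rhd>)) h" using U_iff by simp
    from iso_comp[OF CS ih pull_iso[OF small_incl h(1) this] e0 i0]
    have "iso (cat S) e" using h(2) by simp
    then show "iso (cat S) e \<and> coproduct_cocone X" using legs_of_universal[OF U] by simp
  next
    assume a: "iso (cat S) e \<and> coproduct_cocone X"
    have iih: "iso (cat S) (ar incl h)"
      using iso_cancel_right[OF CS e0 i0 ih] h(2) a by simp
    have legs: "iso (cat one) (ar (leg s) h)" if s: "s \<in> Obj S" for s
      using pull_iso[OF small_pick_S[OF s] ih iih] leg_ar[OF s h(1)] by simp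
    have "iso (cat one) (ar apex h)"
    proof (rule iffD1[OF coproduct_square_source[OF C1 legs_of_universal[OF U0 i0, unfolded coproduct_cocone_def]]])
      show "ar (leg s) h \<in> hom (cat one) (ob (leg s) (ext Y)) (ob (leg s) X)" if "s \<in> Obj S" for s
        by (rule pull_hom[OF small_leg[OF that] h(1)])
      show "ar apex h \<in> hom (cat one) (ob apex (ext Y)) (ob apex X)" by (rule pull_hom[OF small_apex h(1)])
      show "tr (leg_to_apex s) X \<in> hom (cat one) (ob (leg s) X) (ob apex X)" if "s \<in> Obj S" for s
        by (rule leg_to_apex_hom[OF that X])
      show "Comp (cat one) (ar apex h) (tr (leg_to_apex s) (ext Y)) =
          Comp (cat one) (tr (leg_to_apex s) X) (ar (leg s) h)" if "s \<in> Obj S" for s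
        by (rule leg_to_apex_natural[OF that h(1), symmetric])
      show "is_coproduct (cat one) (Obj S) (\<lambda>s. ob (leg s) X) (ob apex X) (\<lambda>s. tr (leg_to_apex s) X)"
        using a by (simp add: coproduct_cocone_def)
    qed (rule legs)
    then show "universal_arrow (cat (S\<rhd>)) (cat S) (On_ftr \<D> incl) Y X e"
      using U_iff iso_on_cocone[OF h(1)] legs by simp
  qed
qed

lemma ext_coproduct_cocone:
  assumes Y: "Y \<in> Obj (cat S)"
  shows "coproduct_cocone (ext Y)"
  using universal_along_incl_iff[OF ext(1,2)[OF Y]] ext(3)[OF Y] by simp

text \<open>
  If \<open>X\<close> is a coproduct externally, the identity of its base is a universal arrow, so that \<open>X\<close> is the
  extension of its base.
\<close>

lemma colimiting_cocone_iff:
  "colimiting_cocone \<D> S X \<longleftrightarrow> X \<in> Obj (cat (S\<rhd>)) \<and> coproduct_cocone X"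
proof
  note CS = category_cat[OF small_S] and CC = category_cat[OF cocone(1)]
  note pi = pull_ftr[OF small_incl]
  assume "colimiting_cocone \<D> S X"
  then obtain Y h where X: "X \<in> Obj (cat (S\<rhd>))" and Y: "Y \<in> Obj (cat S)"
    and h: "h \<in> hom (cat (S\<rhd>)) (ext Y) X" "iso (cat (S\<rhd>)) h"
    unfolding colimiting_cocone_def isomorphic_def by blast
  have "universal_arrow (cat (S\<rhd>)) (cat S) (On_ftr \<D> incl) Y X (Comp (cat S) (ar incl h) (ext_unit Y))"
    using universal_postcomp_iso[OF CC pi ext(3)[OF Y] h] by simp
  then have "coproduct_cocone X"
    using universal_along_incl_iff[OF X comp_in_hom[OF CS pull_hom[OF small_incl h(1)] ext(2)[OF Y]]] by simp
  then show "X \<in> Obj (cat (S\<rhd>)) \<and> coproduct_cocone X" using X by simp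
next
  note CS = category_cat[OF small_S] and CC = category_cat[OF cocone(1)]
  note pi = pull_ftr[OF small_incl]
  assume a: "X \<in> Obj (cat (S\<rhd>)) \<and> coproduct_cocone X"
  then have X: "X \<in> Obj (cat (S\<rhd>))" by simp
  let ?Y = "ob incl X"
  note Y = pull_ob[OF small_incl X]
  have U: "universal_arrow (cat (S\<rhd>)) (cat S) (On_ftr \<D> incl) ?Y X (Ident (cat S) ?Y)"
    using universal_along_incl_iff[OF X id_in_hom[OF CS Y]] a iso_ident[OF CS Y] by simp
  obtain h where h: "h \<in> hom (cat (S\<rhd>)) (ext ?Y) X" "Comp (cat S) (ar incl h) (ext_unit ?Y) = Ident (cat S) ?Y"
    using universal_factor[OF ext(3)[OF Y] X, of "\<lambda>_. Ident (cat S) ?Y"] id_in_hom[OF CS Y] by auto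
  have "iso (cat (S\<rhd>)) h"
    using universal_comparison_iso[OF CC pi ext(3)[OF Y] U h(1)] h(2) by simp
  then show "colimiting_cocone \<D> S X"
    unfolding colimiting_cocone_def isomorphic_def using X Y h(1) by blast
qed

end

section \<open>Morphisms of derivators\<close>

locale derivator_morphism = D: derivator \<D> + E: derivator \<E>
  for \<D> :: "('u, 'o1, 'm1) prederivator" and \<E> :: "('u, 'o2, 'm2) prederivator" +
  fixes F :: "('u, 'o1, 'm1, 'o2, 'm2) mor"
  assumes morphism: "is_morphism \<D> \<E> F"
begin

abbreviation Fob :: "('u, 'u) cat \<Rightarrow> 'o1 \<Rightarrow> 'o2" where
  "Fob A \<equiv> FOb (Mor_ftr F A)"

abbreviation Far :: "('u, 'u) cat \<Rightarrow> 'm1 \<Rightarrow> 'm2" where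
  "Far A \<equiv> FAr (Mor_ftr F A)"

abbreviation coh :: "('u, 'u, 'u, 'u) ftr \<Rightarrow> 'o1 \<Rightarrow> 'm2" where
  "coh u \<equiv> Cmp (Mor_coh F u)"

lemma F_ftr: "small_cat A \<Longrightarrow> ftr_between (D.cat A) (E.cat A) (Mor_ftr F A)"
  using morphism by (simp add: is_morphism_def)

lemma coh_nt:
  assumes u: "small_ftr_between A B u"
  shows "nt_between (On_ftr \<E> u \<circ>\<^sub>F Mor_ftr F B) (Mor_ftr F A \<circ>\<^sub>F On_ftr \<D> u) (Mor_coh F u)"
    and "nat_iso (Mor_coh F u)"
  using morphism small_ftr_betweenD[OF u] by (auto simp: is_morphism_def)

lemma coh_hom:
  assumes u: "small_ftr_between A B u" and X: "X \<in> Obj (D.cat B)"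
  shows "coh u X \<in> hom (E.cat A) (E.ob u (Fob B X)) (Fob A (D.ob u X))"
    and "iso (E.cat A) (coh u X)"
proof -
  note FB = F_ftr[OF small_ftr_betweenD(3)[OF u]]
  note s = fcomp[OF FB E.pull_ftr[OF u]]
  show "coh u X \<in> hom (E.cat A) (E.ob u (Fob B X)) (Fob A (D.ob u X))"
    using nt_hom[OF coh_nt(1)[OF u] s X] by (simp add: fcomp_ob[OF FB X] fcomp_ob[OF D.pull_ftr[OF u] X])
  show "iso (E.cat A) (coh u X)" by (rule nat_iso_cmp[OF coh_nt(2,1)[OF u] s X])
qed

lemma coh_natural:
  assumes u: "small_ftr_between A B u" and f: "f \<in> hom (D.cat B) X Y"
  shows "Comp (E.cat A) (coh u Y) (E.ar u (Far B f)) = Comp (E.cat A) (Far A (D.ar u f)) (coh u X)"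
proof -
  note FB = F_ftr[OF small_ftr_betweenD(3)[OF u]]
  note s = fcomp[OF FB E.pull_ftr[OF u]]
  show ?thesis
    using nt_natural[OF coh_nt(1)[OF u] s f] by (simp add: fcomp_hom[OF FB f] fcomp_hom[OF D.pull_ftr[OF u] f])
qed

lemma coh_id: "small_cat A \<Longrightarrow> X \<in> Obj (D.cat A) \<Longrightarrow> coh (id_ftr A) X = Ident (E.cat A) (Fob A X)"
  using morphism id_nt_cmp[OF F_ftr] by (simp add: is_morphism_def)

lemma coh_fcomp:
  assumes u: "small_ftr_between A B u" and v: "small_ftr_between B C v" and X: "X \<in> Obj (D.cat C)"
  shows "coh (v \<circ>\<^sub>F u) X = Comp (E.cat A) (coh u (D.ob v X)) (E.ar u (coh v X))"
proof -
  note FB = F_ftr[OF small_ftr_betweenD(3)[OF u]] and FC = F_ftr[OF small_ftr_betweenD(3)[OF v]]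
  note su = fcomp[OF FB E.pull_ftr[OF u]] and sv = fcomp[OF FC E.pull_ftr[OF v]]
  have "Mor_coh F (v \<circ>\<^sub>F u) = (Mor_coh F u \<star>\<^sub>r On_ftr \<D> v) \<circ>\<^sub>v (On_ftr \<E> u \<star>\<^sub>l Mor_coh F v)"
    using morphism small_ftr_betweenD[OF u] small_ftr_betweenD[OF v] by (auto simp: is_morphism_def)
  then show ?thesis
    using vcomp_cmp[OF whisker_left[OF coh_nt(1)[OF v] sv E.pull_ftr[OF u]] fcomp[OF sv E.pull_ftr[OF u]] X]
    by (simp add: whisker_left_cmp[OF coh_nt(1)[OF v] sv E.pull_ftr[OF u] X]
        whisker_right_cmp[OF coh_nt(1)[OF u] D.pull_ftr[OF v] su X])
qed

lemma coh_2cell: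
  assumes \<alpha>: "nt_between u v \<alpha>" and u: "small_ftr_between A B u" and X: "X \<in> Obj (D.cat B)"
  shows "Comp (E.cat A) (coh v X) (E.tr \<alpha> (Fob B X)) = Comp (E.cat A) (Far A (D.tr \<alpha> X)) (coh u X)"
proof -
  note FA = F_ftr[OF small_ftr_betweenD(2)[OF u]] and FB = F_ftr[OF small_ftr_betweenD(3)[OF u]]
  note n = D.small_nt_between[OF \<alpha> u]
  note su = fcomp[OF FB E.pull_ftr[OF u]]
  have "Mor_coh F v \<circ>\<^sub>v (On_nt \<E> \<alpha> \<star>\<^sub>r Mor_ftr F B) = (Mor_ftr F A \<star>\<^sub>l On_nt \<D> \<alpha>) \<circ>\<^sub>v Mor_coh F u"
    using morphism n small_ftr_betweenD[OF u] by (auto simp: is_morphism_def)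
  from arg_cong[OF this, of "\<lambda>\<alpha>. Cmp \<alpha> X"] show ?thesis
    by (simp add: vcomp_cmp[OF whisker_right[OF E.pull_nt[OF \<alpha> u] FB E.pull_ftr[OF u]] su X]
        vcomp_cmp[OF coh_nt(1)[OF u] su X]
        whisker_right_cmp[OF E.pull_nt[OF \<alpha> u] FB E.pull_ftr[OF u] X]
        whisker_left_cmp[OF D.pull_nt[OF \<alpha> u] D.pull_ftr[OF u] FA X])
qed

text \<open>
  The coherence isomorphisms of \<open>F\<close> form an isomorphism between the two cocones.
\<close>

lemma coproduct_pull_iff:
  assumes u: "small_ftr_between A B u" and c: "c \<in> Obj (D.cat B)"
    and \<iota>: "\<And>i. i \<in> I \<Longrightarrow> \<iota> i \<in> hom (D.cat B) (x i) c"
  shows "is_coproduct (E.cat A) I (\<lambda>i. E.ob u (Fob B (x i))) (E.ob u (Fob B c)) (\<lambda>i. E.ar u (Far B (\<iota> i))) \<longleftrightarrow>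
    is_coproduct (E.cat A) I (\<lambda>i. Fob A (D.ob u (x i))) (Fob A (D.ob u c)) (\<lambda>i. Far A (D.ar u (\<iota> i)))"
proof (rule coproduct_iso_square)
  note A = small_ftr_betweenD(2)[OF u] and B = small_ftr_betweenD(3)[OF u]
  have x: "x i \<in> Obj (D.cat B)" if "i \<in> I" for i
    by (rule hom_dom_in[OF D.category_cat[OF B] \<iota>[OF that]])
  show "category (E.cat A)" by (rule E.category_cat[OF A])
  show "coh u (x i) \<in> hom (E.cat A) (E.ob u (Fob B (x i))) (Fob A (D.ob u (x i)))"
    "iso (E.cat A) (coh u (x i))" if "i \<in> I" for i
    by (rule coh_hom[OF u x[OF that]])+
  show "coh u c \<in> hom (E.cat A) (E.ob u (Fob B c)) (Fob A (D.ob u c))" "iso (E.cat A) (coh u c)"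
    by (rule coh_hom[OF u c])+
  show "E.ar u (Far B (\<iota> i)) \<in> hom (E.cat A) (E.ob u (Fob B (x i))) (E.ob u (Fob B c))" if "i \<in> I" for i
    by (rule E.pull_hom[OF u ftr_hom[OF F_ftr[OF B] \<iota>[OF that]]])
  show "Far A (D.ar u (\<iota> i)) \<in> hom (E.cat A) (Fob A (D.ob u (x i))) (Fob A (D.ob u c))" if "i \<in> I" for i
    by (rule ftr_hom[OF F_ftr[OF A] D.pull_hom[OF u \<iota>[OF that]]])
  show "Comp (E.cat A) (coh u c) (E.ar u (Far B (\<iota> i))) =
      Comp (E.cat A) (Far A (D.ar u (\<iota> i))) (coh u (x i))" if "i \<in> I" for i
    by (rule coh_natural[OF u \<iota>[OF that]])
qed

text \<open>
  The target has a coproduct of the image family, and the comparison from it to the image of the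
  coproduct can be tested at each object of \<open>A\<close> by (Der2). Evaluation at an object commutes with \<open>F\<close> up
  to isomorphism and preserves coproducts, so the value there is a comparison for \<open>F\<close> at the
  point, where coproducts are preserved.
\<close>

lemma preserves_coproducts_levelwise:
  fixes I :: "'u set"
  assumes I: "small_set I" and A: "small_cat A" and pres: "preserves_coproducts I (Mor_ftr F one)"
  shows "preserves_coproducts I (Mor_ftr F A)"
proof -
  note FA = F_ftr[OF A] and F1 = F_ftr[OF D.small_one]
  note EA = E.category_cat[OF A] and E1 = E.category_cat[OF E.small_one]
  have "is_coproduct (E.cat A) I (\<lambda>i. Fob A (x i)) (Fob A c) (\<lambda>i. Far A (\<iota> i))"
    if cop: "is_coproduct (D.cat A) I x c \<iota>" for x c \<iota>
  proof -
    note c = coproduct_ob[OF cop] and \<iota> = coproduct_hom[OF cop]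
    note F\<iota> = ftr_hom[OF FA \<iota>]
    have Fx: "Fob A (x i) \<in> Obj (E.cat A)" if "i \<in> I" for i
      by (rule hom_dom_in[OF EA F\<iota>[OF that]])
    obtain d \<kappa> where d: "is_coproduct (E.cat A) I (\<lambda>i. Fob A (x i)) d \<kappa>"
      using E.coproducts_exist[of I A "\<lambda>i. Fob A (x i)", OF I A Fx] by blast
    obtain h where h: "h \<in> hom (E.cat A) d (Fob A c)" "\<And>i. i \<in> I \<Longrightarrow> Comp (E.cat A) h (\<kappa> i) = Far A (\<iota> i)"
      using coproduct_factor[OF d ftr_ob[OF FA c], of "\<lambda>i. Far A (\<iota> i)"] F\<iota> by blast
    have "iso (E.cat one) (E.ar (pick A a) h)" if a: "a \<in> Obj A" for a
    proof -
      let ?a = "pick A a :: ('u, 'u, 'u, 'u) ftr"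
      note p = E.small_pick[OF A a]
      note \<kappa> = coproduct_hom[OF d]
      have "is_coproduct (E.cat one) I (\<lambda>i. Fob one (D.ob ?a (x i))) (Fob one (D.ob ?a c))
          (\<lambda>i. Far one (D.ar ?a (\<iota> i)))"
        using pres D.pull_preserves_coproducts[OF p cop] ftr_betweenD(3,4)[OF F1]
        unfolding preserves_coproducts_def by simp
      then have Fc: "is_coproduct (E.cat one) I (\<lambda>i. E.ob ?a (Fob A (x i))) (E.ob ?a (Fob A c))
          (\<lambda>i. E.ar ?a (Far A (\<iota> i)))"
        using coproduct_pull_iff[of one A ?a c I \<iota> x, OF p c \<iota>] by simp
      show ?thesis
      proof (rule iffD1[OF coproduct_square_source[OF E1 E.pull_preserves_coproducts[OF p d]]])
        show "Ident (E.cat one) (E.ob ?a (Fob A (x i))) \<in>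
            hom (E.cat one) (E.ob ?a (Fob A (x i))) (E.ob ?a (Fob A (x i)))"
          "iso (E.cat one) (Ident (E.cat one) (E.ob ?a (Fob A (x i))))" if "i \<in> I" for i
          using id_in_hom[OF E1 E.pull_ob[OF p Fx[OF that]]] iso_ident[OF E1 E.pull_ob[OF p Fx[OF that]]] .
        show "E.ar ?a h \<in> hom (E.cat one) (E.ob ?a d) (E.ob ?a (Fob A c))" by (rule E.pull_hom[OF p h(1)])
        show "E.ar ?a (Far A (\<iota> i)) \<in> hom (E.cat one) (E.ob ?a (Fob A (x i))) (E.ob ?a (Fob A c))"
          if "i \<in> I" for i by (rule E.pull_hom[OF p F\<iota>[OF that]])
        show "Comp (E.cat one) (E.ar ?a h) (E.ar ?a (\<kappa> i)) =
            Comp (E.cat one) (E.ar ?a (Far A (\<iota> i))) (Ident (E.cat one) (E.ob ?a (Fob A (x i))))"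
          if i: "i \<in> I" for i
          unfolding comp_id_right[OF E1 E.pull_hom[OF p F\<iota>[OF i]]]
          using ftr_comp[OF E.pull_ftr[OF p] h(1) \<kappa>[OF i]] h(2)[OF i] by simp
      qed (rule Fc)
    qed
    then have ih: "iso (E.cat A) h" using E.iso_pointwise[OF A h(1)] by simp
    have "universal (E.cat A) I (\<lambda>_. E.cat A) (\<lambda>_. id_ftr (E.cat A)) (\<lambda>i. Fob A (x i)) (Fob A c)
        (\<lambda>i. Comp (E.cat A) (FAr (id_ftr (E.cat A)) h) (\<kappa> i))"
      by (rule universal_postcomp_iso[OF EA id_ftr[OF EA] d[unfolded is_coproduct_iff_universal[OF EA]] h(1) ih])
    then have "universal (E.cat A) I (\<lambda>_. E.cat A) (\<lambda>_. id_ftr (E.cat A)) (\<lambda>i. Fob A (x i)) (Fob A c)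
        (\<lambda>i. Far A (\<iota> i))"
      by (rule universal_cong) (use h in simp)
    then show ?thesis by (simp add: is_coproduct_iff_universal[OF EA])
  qed
  then show ?thesis
    unfolding preserves_coproducts_def ftr_betweenD(3,4)[OF FA] by blast
qed

lemma preserves_lkan_iff:
  assumes u: "small_ftr_between A B u"
  shows "preserves_lkan \<D> \<E> F u \<longleftrightarrow> (\<forall>Y\<in>Obj (D.cat A).
    universal_arrow (E.cat B) (E.cat A) (On_ftr \<E> u) (Fob A Y) (Fob B (FOb (lkan \<D> u) Y))
      (Comp (E.cat A) (inv_arr (E.cat A) (coh u (FOb (lkan \<D> u) Y))) (Far A (Cmp (lkan_unit \<D> u) Y))))"
proof -
  note FA = F_ftr[OF small_ftr_betweenD(2)[OF u]] and FB = F_ftr[OF small_ftr_betweenD(3)[OF u]]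
  note su = fcomp[OF FB E.pull_ftr[OF u]]
  note L = adjunction_ftr[OF D.lkan_adjunction[OF u] D.pull_ftr[OF u]]
  have "preserves_lkan \<D> \<E> F u \<longleftrightarrow> (\<forall>Y\<in>Obj (D.cat A).
    universal_arrow (E.cat B) (E.cat A) (On_ftr \<E> u) (Fob A Y) (Fob B (FOb (lkan \<D> u) Y))
      (Comp (E.cat A) (Cmp (inv_nt (Mor_coh F u)) (FOb (lkan \<D> u) Y)) (Far A (Cmp (lkan_unit \<D> u) Y))))"
    unfolding preserves_lkan_def lkan_mate_def small_ftr_betweenD(5,6)[OF u]
    by (rule nat_iso_mate_iff[OF D.lkan_adjunction[OF u] D.pull_ftr[OF u] E.lkan_adjunction[OF u]
          E.pull_ftr[OF u] FA FB inv_nt[OF coh_nt(2,1)[OF u] su]])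
  then show ?thesis
    using inv_nt_cmp[OF coh_nt(1)[OF u] su ftr_ob[OF L]] by simp
qed

end

locale discrete_morphism = derivator_morphism \<D> \<E> F + D: discrete_diagrams \<D> S + E: discrete_diagrams \<E> S
  for \<D> :: "('u, 'o1, 'm1) prederivator" and \<E> :: "('u, 'o2, 'm2) prederivator"
    and F :: "('u, 'o1, 'm1, 'o2, 'm2) mor" and S :: "('u, 'u) cat"
begin

text \<open>
  Compatibility of \<open>F\<close> with the transformations from the legs to the apex makes the coherence
  isomorphisms at the legs and at the apex into an isomorphism of cocones.
\<close>

lemma coproduct_cocone_image_iff:
  assumes X: "X \<in> Obj (D.cat (S\<rhd>))"
  shows "E.coproduct_cocone (Fob (S\<rhd>) X) \<longleftrightarrow>
    is_coproduct (E.cat one) (Obj S) (\<lambda>s. Fob one (D.ob (D.leg s) X)) (Fob one (D.ob D.apex X))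
      (\<lambda>s. Far one (D.tr (D.leg_to_apex s) X))"
  unfolding E.coproduct_cocone_def
proof (rule coproduct_iso_square)
  note FX = ftr_ob[OF F_ftr[OF D.cocone(1)] X]
  show "category (E.cat one)" by (rule E.category_cat[OF E.small_one])
  show "coh (D.leg s) X \<in> hom (E.cat one) (E.ob (D.leg s) (Fob (S\<rhd>) X)) (Fob one (D.ob (D.leg s) X))"
    "iso (E.cat one) (coh (D.leg s) X)" if "s \<in> Obj S" for s
    by (rule coh_hom[OF D.small_leg[OF that] X])+
  show "coh D.apex X \<in> hom (E.cat one) (E.ob D.apex (Fob (S\<rhd>) X)) (Fob one (D.ob D.apex X))"
    "iso (E.cat one) (coh D.apex X)"
    by (rule coh_hom[OF D.small_apex X])+
  show "E.tr (D.leg_to_apex s) (Fob (S\<rhd>) X) \<in>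
      hom (E.cat one) (E.ob (D.leg s) (Fob (S\<rhd>) X)) (E.ob D.apex (Fob (S\<rhd>) X))" if "s \<in> Obj S" for s
    by (rule E.leg_to_apex_hom[OF that FX])
  show "Far one (D.tr (D.leg_to_apex s) X) \<in>
      hom (E.cat one) (Fob one (D.ob (D.leg s) X)) (Fob one (D.ob D.apex X))" if "s \<in> Obj S" for s
    by (rule ftr_hom[OF F_ftr[OF D.small_one] D.leg_to_apex_hom[OF that X]])
  show "Comp (E.cat one) (coh D.apex X) (E.tr (D.leg_to_apex s) (Fob (S\<rhd>) X)) =
      Comp (E.cat one) (Far one (D.tr (D.leg_to_apex s) X)) (coh (D.leg s) X)" if "s \<in> Obj S" for s
    by (rule coh_2cell[OF D.leg_to_apex[OF that] D.small_leg[OF that] X])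
qed

text \<open>
  The arrow whose universality is at stake is invertible for every \<open>F\<close>, since the unit of the extension is.
  What remains of universality is the condition on the cocone.
\<close>

lemma preserves_lkan_incl_iff:
  "preserves_lkan \<D> \<E> F D.incl \<longleftrightarrow> (\<forall>Y\<in>Obj (D.cat S). E.coproduct_cocone (Fob (S\<rhd>) (D.ext Y)))"
proof -
  note FS = F_ftr[OF D.small_S] and FC = F_ftr[OF D.cocone(1)] and ES = E.category_cat[OF D.small_S]
  have "universal_arrow (E.cat (S\<rhd>)) (E.cat S) (On_ftr \<E> D.incl) (Fob S Y) (Fob (S\<rhd>) (D.ext Y))
      (Comp (E.cat S) (inv_arr (E.cat S) (coh D.incl (D.ext Y))) (Far S (D.ext_unit Y))) \<longleftrightarrow>
      E.coproduct_cocone (Fob (S\<rhd>) (D.ext Y))" if Y: "Y \<in> Obj (D.cat S)" for Y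
  proof -
    note X = D.ext(1)[OF Y]
    note g = coh_hom[OF D.small_incl X]
    note g' = inv_arr(1)[OF ES g(2,1)] iso_inv_arr[OF ES g(2,1)]
    note \<eta> = ftr_hom[OF FS D.ext(2)[OF Y]] ftr_iso[OF FS D.ext(2)[OF Y] D.ext_unit_iso[OF Y]]
    show ?thesis
      using E.universal_along_incl_iff[OF ftr_ob[OF FC X] comp_in_hom[OF ES g'(1) \<eta>(1)]] iso_comp[OF ES g' \<eta>]
      by simp
  qed
  then show ?thesis unfolding preserves_lkan_iff[OF D.small_incl] by simp
qed

text \<open>
  Universality of the arrow that comes from the mate is the coproduct property of its components. To recognise
  these as the images under \<open>F\<close> of the components of the unit, the inverse of the coherence isomorphism
  of \<open>to_one S\<close> has to be evaluated at \<open>s\<close>: it is the coherence isomorphism of \<open>pick S s\<close>, because the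
  composite of the two functors is the identity.
\<close>

lemma preserves_lkan_to_one_iff:
  "preserves_lkan \<D> \<E> F (to_one S) \<longleftrightarrow> (\<forall>Y\<in>Obj (D.cat S).
     is_coproduct (E.cat one) (Obj S) (\<lambda>s. Fob one (D.ob (pick S s) Y)) (Fob one (FOb (lkan \<D> (to_one S)) Y))
       (\<lambda>s. Far one (D.ar (pick S s) (Cmp (lkan_unit \<D> (to_one S)) Y))))"
proof -
  let ?t = "to_one S :: ('u, 'u, 'u, 'u) ftr"
  note t = D.small_to_one_S
  note adj = D.lkan_adjunction[OF t] and tf = D.pull_ftr[OF t]
  note FS = F_ftr[OF D.small_S] and F1 = F_ftr[OF D.small_one]
  note ES = E.category_cat[OF D.small_S] and E1 = E.category_cat[OF D.small_one]
  have "universal_arrow (E.cat one) (E.cat S) (On_ftr \<E> ?t) (Fob S Y) (Fob one (FOb (lkan \<D> ?t) Y))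
      (Comp (E.cat S) (inv_arr (E.cat S) (coh ?t (FOb (lkan \<D> ?t) Y))) (Far S (Cmp (lkan_unit \<D> ?t) Y))) \<longleftrightarrow>
      is_coproduct (E.cat one) (Obj S) (\<lambda>s. Fob one (D.ob (pick S s) Y)) (Fob one (FOb (lkan \<D> ?t) Y))
       (\<lambda>s. Far one (D.ar (pick S s) (Cmp (lkan_unit \<D> ?t) Y)))" if Y: "Y \<in> Obj (D.cat S)" for Y
  proof -
    let ?Z = "FOb (lkan \<D> ?t) Y" and ?\<eta> = "Cmp (lkan_unit \<D> ?t) Y"
    note Z = ftr_ob[OF adjunction_ftr[OF adj tf] Y]
    note \<eta> = adjunction_unit(2)[OF adj tf Y]
    note F\<eta> = ftr_hom[OF FS \<eta>]
    note g = coh_hom[OF t Z]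
    note g' = inv_arr[OF ES g(2,1)]
    let ?e = "Comp (E.cat S) (inv_arr (E.cat S) (coh ?t ?Z)) (Far S ?\<eta>)"
    note e = comp_in_hom[OF ES g'(1) F\<eta>]
    note FZ = ftr_ob[OF F1 Z]
    have obt: "D.ob (pick S s) (D.ob ?t ?Z) = ?Z" "E.ob (pick S s) (E.ob ?t (Fob one ?Z)) = Fob one ?Z"
      if s: "s \<in> Obj S" for s
      using D.pull_fcomp_ob[OF D.small_pick_S[OF s] t Z] E.pull_fcomp_ob[OF D.small_pick_S[OF s] t FZ]
        D.to_one_S_pick[OF s] D.pull_id[OF D.small_one] E.pull_id[OF D.small_one] Z FZ by simp_all
    have pe: "E.ar (pick S s) ?e = Comp (E.cat one) (Far one (D.ar (pick S s) ?\<eta>)) (coh (pick S s) Y)"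
      and peh: "E.ar (pick S s) ?e \<in> hom (E.cat one) (E.ob (pick S s) (Fob S Y)) (Fob one ?Z)"
      if s: "s \<in> Obj S" for s
    proof -
      let ?p = "pick S s :: ('u, 'u, 'u, 'u) ftr"
      note p = D.small_pick_S[OF s]
      note pE = E.pull_ftr[OF p]
      note tZ = D.pull_ob[OF t Z]
      note cp = coh_hom(1)[OF p tZ]
      note cg = ftr_hom[OF pE g(1)] and cg' = ftr_hom[OF pE g'(1)]
      have unit: "Comp (E.cat one) (coh ?p (D.ob ?t ?Z)) (E.ar ?p (coh ?t ?Z)) = Ident (E.cat one) (Fob one ?Z)"
        using coh_fcomp[OF p t Z] D.to_one_S_pick[OF s] coh_id[OF D.small_one Z] by simp
      have "E.ar ?p (inv_arr (E.cat S) (coh ?t ?Z)) =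
          Comp (E.cat one) (Comp (E.cat one) (coh ?p (D.ob ?t ?Z)) (E.ar ?p (coh ?t ?Z)))
            (E.ar ?p (inv_arr (E.cat S) (coh ?t ?Z)))"
        unfolding unit using comp_id_left[OF E1 cg'] obt(2)[OF s] by simp
      also have "\<dots> = Comp (E.cat one) (coh ?p (D.ob ?t ?Z))
          (E.ar ?p (Comp (E.cat S) (coh ?t ?Z) (inv_arr (E.cat S) (coh ?t ?Z))))"
        unfolding ftr_comp[OF pE g(1) g'(1)] by (rule comp_assoc[OF E1 cp cg cg', symmetric])
      also have "\<dots> = coh ?p (D.ob ?t ?Z)"
        unfolding g'(3) ftr_ident[OF pE ftr_ob[OF FS tZ]] by (rule comp_id_right[OF E1 cp])
      finally have inv: "E.ar ?p (inv_arr (E.cat S) (coh ?t ?Z)) = coh ?p (D.ob ?t ?Z)" .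
      show "E.ar ?p ?e = Comp (E.cat one) (Far one (D.ar ?p ?\<eta>)) (coh ?p Y)"
        unfolding ftr_comp[OF pE g'(1) F\<eta>] inv by (rule coh_natural[OF p \<eta>])
      show "E.ar ?p ?e \<in> hom (E.cat one) (E.ob ?p (Fob S Y)) (Fob one ?Z)"
        using ftr_hom[OF pE e] obt(2)[OF s] by simp
    qed
    have "is_coproduct (E.cat one) (Obj S) (\<lambda>s. E.ob (pick S s) (Fob S Y)) (Fob one ?Z)
        (\<lambda>s. E.ar (pick S s) ?e) \<longleftrightarrow>
      is_coproduct (E.cat one) (Obj S) (\<lambda>s. Fob one (D.ob (pick S s) Y)) (Fob one ?Z)
        (\<lambda>s. Far one (D.ar (pick S s) ?\<eta>))"
    proof (rule coproduct_iso_square[OF E1])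
      show "coh (pick S s) Y \<in> hom (E.cat one) (E.ob (pick S s) (Fob S Y)) (Fob one (D.ob (pick S s) Y))"
        "iso (E.cat one) (coh (pick S s) Y)" if "s \<in> Obj S" for s
        by (rule coh_hom[OF D.small_pick_S[OF that] Y])+
      show "Ident (E.cat one) (Fob one ?Z) \<in> hom (E.cat one) (Fob one ?Z) (Fob one ?Z)"
        "iso (E.cat one) (Ident (E.cat one) (Fob one ?Z))"
        by (rule id_in_hom[OF E1 FZ], rule iso_ident[OF E1 FZ])
      show "Far one (D.ar (pick S s) ?\<eta>) \<in> hom (E.cat one) (Fob one (D.ob (pick S s) Y)) (Fob one ?Z)"
        if s: "s \<in> Obj S" for s
        using ftr_hom[OF F1 D.pull_hom[OF D.small_pick_S[OF s] \<eta>]] obt(1)[OF s] by simp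
      show "Comp (E.cat one) (Ident (E.cat one) (Fob one ?Z)) (E.ar (pick S s) ?e) =
          Comp (E.cat one) (Far one (D.ar (pick S s) ?\<eta>)) (coh (pick S s) Y)" if s: "s \<in> Obj S" for s
        unfolding comp_id_left[OF E1 peh[OF s]] by (rule pe[OF s])
    qed (rule peh)
    then show ?thesis
      using E.universal_arrow_iff_coproduct[OF E.splits_S t D.to_one_S_pick ftr_ob[OF FS Y] FZ e] by simp
  qed
  then show ?thesis unfolding preserves_lkan_iff[OF t] by simp
qed

section \<open>The equivalent conditions\<close>

lemma preserves_if_to_one:
  assumes "preserves_lkan \<D> \<E> F (to_one S)"
  shows "preserves_coproducts (Obj S) (Mor_ftr F one)"
proof (rule preserves_coproductsI[OF F_ftr[OF D.small_one]])
  let ?t = "to_one S :: ('u, 'u, 'u, 'u) ftr"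
  fix x assume x: "\<And>s. s \<in> Obj S \<Longrightarrow> x s \<in> Obj (D.cat one)"
  obtain Y a where Y: "Y \<in> Obj (D.cat S)"
    and a: "\<forall>s\<in>Obj S. a s \<in> hom (D.cat one) (D.ob (pick S s) Y) (x s) \<and> iso (D.cat one) (a s)"
    using D.splits_surj[OF D.splits_S, of x] x by blast
  have "is_coproduct (D.cat one) (Obj S) (\<lambda>s. D.ob (pick S s) Y) (FOb (lkan \<D> ?t) Y)
      (\<lambda>s. D.ar (pick S s) (Cmp (lkan_unit \<D> ?t) Y))"
    by (rule D.colim_coproduct[OF Y])
  moreover have "is_coproduct (E.cat one) (Obj S) (\<lambda>s. Fob one (D.ob (pick S s) Y)) (Fob one (FOb (lkan \<D> ?t) Y))
       (\<lambda>s. Far one (D.ar (pick S s) (Cmp (lkan_unit \<D> ?t) Y)))"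
    using assms Y unfolding preserves_lkan_to_one_iff by blast
  ultimately show "\<exists>y a c e. (\<forall>i\<in>Obj S. a i \<in> hom (D.cat one) (y i) (x i) \<and> iso (D.cat one) (a i)) \<and>
      is_coproduct (D.cat one) (Obj S) y c e \<and>
      is_coproduct (E.cat one) (Obj S) (\<lambda>i. Fob one (y i)) (Fob one c) (\<lambda>i. Far one (e i))"
    using a by (intro exI conjI)
qed

lemma to_one_if_preserves:
  assumes pres: "preserves_coproducts (Obj S) (Mor_ftr F one)"
  shows "preserves_lkan \<D> \<E> F (to_one S)"
  unfolding preserves_lkan_to_one_iff
proof
  let ?t = "to_one S :: ('u, 'u, 'u, 'u) ftr"
  fix Y assume Y: "Y \<in> Obj (D.cat S)"
  have "is_coproduct (D.cat one) (Obj S) (\<lambda>s. D.ob (pick S s) Y) (FOb (lkan \<D> ?t) Y)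
      (\<lambda>s. D.ar (pick S s) (Cmp (lkan_unit \<D> ?t) Y))"
    by (rule D.colim_coproduct[OF Y])
  then show "is_coproduct (E.cat one) (Obj S) (\<lambda>s. Fob one (D.ob (pick S s) Y)) (Fob one (FOb (lkan \<D> ?t) Y))
       (\<lambda>s. Far one (D.ar (pick S s) (Cmp (lkan_unit \<D> ?t) Y)))"
    using pres unfolding preserves_coproducts_def ftr_betweenD(3,4)[OF F_ftr[OF D.small_one]] by blast
qed

lemma cocones_if_preserves:
  assumes pres: "preserves_coproducts (Obj S) (Mor_ftr F one)" and X: "colimiting_cocone \<D> S X"
  shows "colimiting_cocone \<E> S (Fob (S\<rhd>) X)"
proof -
  have X1: "X \<in> Obj (D.cat (S\<rhd>))" and X2: "D.coproduct_cocone X"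
    using X D.colimiting_cocone_iff by simp_all
  have "E.coproduct_cocone (Fob (S\<rhd>) X)"
    unfolding coproduct_cocone_image_iff[OF X1]
    using pres X2 unfolding preserves_coproducts_def D.coproduct_cocone_def
      ftr_betweenD(3,4)[OF F_ftr[OF D.small_one]] by blast
  then show ?thesis
    using E.colimiting_cocone_iff ftr_ob[OF F_ftr[OF D.cocone(1)] X1] by simp
qed

lemma incl_if_cocones:
  assumes "\<And>X. colimiting_cocone \<D> S X \<Longrightarrow> colimiting_cocone \<E> S (Fob (S\<rhd>) X)"
  shows "preserves_lkan \<D> \<E> F D.incl"
  unfolding preserves_lkan_incl_iff
proof
  fix Y assume Y: "Y \<in> Obj (D.cat S)"
  have "colimiting_cocone \<D> S (D.ext Y)"
    using D.colimiting_cocone_iff D.ext(1)[OF Y] D.ext_coproduct_cocone[OF Y] by simp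
  from assms[OF this] show "E.coproduct_cocone (Fob (S\<rhd>) (D.ext Y))"
    using E.colimiting_cocone_iff by simp
qed

text \<open>
  Every family of objects at the point underlies some diagram on \<open>S\<close>, and the extension of this diagram
  to the cocone contains a coproduct of the family that \<open>F\<close> preserves.
\<close>

lemma preserves_if_incl:
  assumes "preserves_lkan \<D> \<E> F D.incl"
  shows "preserves_coproducts (Obj S) (Mor_ftr F one)"
proof (rule preserves_coproductsI[OF F_ftr[OF D.small_one]])
  note D1 = D.category_cat[OF D.small_one]
  fix x assume x: "\<And>s. s \<in> Obj S \<Longrightarrow> x s \<in> Obj (D.cat one)"
  obtain Y a where Y: "Y \<in> Obj (D.cat S)"
    and a: "\<forall>s\<in>Obj S. a s \<in> hom (D.cat one) (D.ob (pick S s) Y) (x s) \<and> iso (D.cat one) (a s)"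
    using D.splits_surj[OF D.splits_S, of x] x by blast
  note X = D.ext(1)[OF Y]
  let ?k = "\<lambda>s. D.ar (pick S s) (D.ext_unit Y)"
  have k: "?k s \<in> hom (D.cat one) (D.ob (pick S s) Y) (D.ob (D.leg s) (D.ext Y))" "iso (D.cat one) (?k s)"
    if s: "s \<in> Obj S" for s
    using D.pull_hom[OF D.small_pick_S[OF s] D.ext(2)[OF Y]] D.leg_ob[OF s X]
      D.pull_iso[OF D.small_pick_S[OF s] D.ext(2)[OF Y] D.ext_unit_iso[OF Y]] by simp_all
  define b where "b s = Comp (D.cat one) (a s) (inv_arr (D.cat one) (?k s))" for s
  have b: "\<forall>s\<in>Obj S. b s \<in> hom (D.cat one) (D.ob (D.leg s) (D.ext Y)) (x s) \<and> iso (D.cat one) (b s)"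
  proof
    fix s assume s: "s \<in> Obj S"
    have as: "a s \<in> hom (D.cat one) (D.ob (pick S s) Y) (x s)" "iso (D.cat one) (a s)" using a s by simp_all
    note k' = inv_arr(1)[OF D1 k(2)[OF s] k(1)[OF s]] iso_inv_arr[OF D1 k(2)[OF s] k(1)[OF s]]
    show "b s \<in> hom (D.cat one) (D.ob (D.leg s) (D.ext Y)) (x s) \<and> iso (D.cat one) (b s)"
      unfolding b_def using comp_in_hom[OF D1 as(1) k'(1)] iso_comp[OF D1 as k'] by simp
  qed
  have "is_coproduct (D.cat one) (Obj S) (\<lambda>s. D.ob (D.leg s) (D.ext Y)) (D.ob D.apex (D.ext Y))
      (\<lambda>s. D.tr (D.leg_to_apex s) (D.ext Y))"
    using D.ext_coproduct_cocone[OF Y] unfolding D.coproduct_cocone_def .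
  moreover have "is_coproduct (E.cat one) (Obj S) (\<lambda>s. Fob one (D.ob (D.leg s) (D.ext Y)))
      (Fob one (D.ob D.apex (D.ext Y))) (\<lambda>s. Far one (D.tr (D.leg_to_apex s) (D.ext Y)))"
    using assms Y coproduct_cocone_image_iff[OF X] unfolding preserves_lkan_incl_iff by blast
  ultimately show "\<exists>y a c e. (\<forall>i\<in>Obj S. a i \<in> hom (D.cat one) (y i) (x i) \<and> iso (D.cat one) (a i)) \<and>
      is_coproduct (D.cat one) (Obj S) y c e \<and>
      is_coproduct (E.cat one) (Obj S) (\<lambda>i. Fob one (y i)) (Fob one c) (\<lambda>i. Far one (e i))"
    using b by (intro exI conjI)
qed

end

theorem proposition7p3:
  fixes \<D> :: "('u, 'o1, 'm1) prederivator"
    and \<E> :: "('u, 'o2, 'm2) prederivator"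
    and F :: "('u, 'o1, 'm1, 'o2, 'm2) mor"
    and S :: "('u, 'u) cat"
  assumes "infinite (UNIV :: 'u set)" and "regularCard |UNIV :: 'u set|"
    and "is_derivator \<D>" and "is_derivator \<E>" and "is_morphism \<D> \<E> F"
    and "small_cat S" and "discrete S"
  shows "let i = preserves_lkan \<D> \<E> F (to_one S);
             ii = preserves_lkan \<D> \<E> F (small_cocone_incl S);
             iii = (\<forall>X. colimiting_cocone \<D> S X \<longrightarrow>
                        colimiting_cocone \<E> S (FOb (Mor_ftr F (S\<rhd>)) X));
             iv = preserves_coproducts (Obj S) (Mor_ftr F one);
             v = (\<forall>A. small_cat A \<longrightarrow> preserves_coproducts (Obj S) (Mor_ftr F A))
         in (i \<longleftrightarrow> ii) \<and> (i \<longleftrightarrow> iii) \<and> (i \<longleftrightarrow> iv) \<and> (i \<longleftrightarrow> v)"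
proof -
  interpret discrete_morphism \<D> \<E> F S
    by unfold_locales (use assms in auto)
  have small_obj: "small_set (Obj S)" using assms(6) by (simp add: small_cat_def)
  show ?thesis
    unfolding Let_def
    using preserves_if_to_one to_one_if_preserves cocones_if_preserves incl_if_cocones preserves_if_incl
      preserves_coproducts_levelwise[OF small_obj] D.small_one
    by blast
qed

end
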